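(* Fix $\alpha>0$ and a positive function $\rho$ on $(0,\infty)$ such that $\lim_{x\downarrow0}x^2/\rho(x)=0$. For integers $n\ge3$ let $m^{(n)}(\omega)\in M^-_{\ln n}(V^{(1)})$ be the $\ln n$-minimum at the bottom of the $\ln n$-valley of $V^{(1)}$ covering the origin, let $\mathfrak m^{(n)}(\omega)=m^{(n)}(\omega)/\ln^2n$, and let $\delta_n=\rho\big(\frac{\ln(\ln n)}{\ln n}\big)$. Then for each $n$ there exists a Borel subset $\Omega_n\subset\Omega$ with $\mathbf P(\Omega_n)\ge1-\alpha$ such that $$\lim_{n\uparrow\infty}\ \inf_{\omega\in\Omega_n}P_0^\omega\Big(\Big|\frac{X_n}{\ln^2n}-\mathfrak m^{(n)}(\omega)\Big|\le\delta_n\Big)=1.$$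
   Context: Let $\kappa>0$ and let $\mathbf P$ be a law on $\Omega=[\kappa,1-\kappa]^{\mathbb Z}$ under which the coordinates $\omega_x$, $x\in\mathbb Z$, are i.i.d. with $\mathbf E[\ln\frac{\omega_x}{1-\omega_x}]=0$ and $\mathbf E[\ln^2\frac{\omega_x}{1-\omega_x}]>0$. For fixed $\omega$, $P_x^\omega$ is the law of the random walk $(X_n)_{n\ge0}$ on $\mathbb Z$ started at $x$ with $\mathrm{Prob}(X_{n+1}=y+1|X_n=y)=\omega_y$, $\mathrm{Prob}(X_{n+1}=y-1|X_n=y)=1-\omega_y$. The potential is $V(0)=0$, $V(x)=\sum_{i=1}^x\ln\frac{1-\omega_i}{\omega_i}$ for $x\ge1$, $V(x)=-\sum_{i=x+1}^0\ln\frac{1-\omega_i}{\omega_i}$ for $x\le-1$; $V^{(1)}\in C(\mathbb R)$ is its linear interpolation. For $\gamma\in C(\mathbb R)$ and $h>0$, $x\in\mathbb R$ is an $h$-minimum of $\gamma$ if there are $a<x<b$ with $\gamma(a)\ge\gamma(x)+h$, $\gamma(b)\ge\gamma(x)+h$ and $\gamma(x)=\min_{[a,b]}\gamma$; it is an $h$-maximum of $\gamma$ if it is an $h$-minimum of $-\gamma$. Two $h$-minima (resp. two $h$-maxima) $x,x'$ are equivalent if $\max_{z\in[x\wedge x',x\vee x']}|\gamma(z)-\gamma(x)|<h$. $M_h^-(\gamma)$ (resp. $M_h^+(\gamma)$) is the set of smallest elements (when they exist) of the equivalence classes of $h$-minima (resp. $h$-maxima). The $h$-valleys are the pieces of $\gamma$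 between consecutive points of $M_h^+(\gamma)$. The $\ln n$-valley of $V^{(1)}$ covering the origin is the one between $a^{(n)}=\max\{x<0:x\in M^+_{\ln n}(V^{(1)})\}$ and $b^{(n)}=\min\{x\ge0:x\in M^+_{\ln n}(V^{(1)})\}$, and $m^{(n)}$ is the unique point of $M^-_{\ln n}(V^{(1)})$ in $(a^{(n)},b^{(n)})$; these are well defined $\mathbf P$-a.s. *)

theory Defs
  imports "HOL-Probability.Probability"
begin

type_synonym env = "int \<Rightarrow> real"

text \<open>\<open>bernoulli_pmf\<close> truncates its parameter to the unit interval; the environments
  considered take values in \<open>{\<kappa>..1 - \<kappa>}\<close> with \<open>\<kappa> > 0\<close>.\<close>

definition rw_step :: "env \<Rightarrow> int \<Rightarrow> int pmf" where
  "rw_step \<omega> y = map_pmf (\<lambda>b. if b then y + 1 else y - 1) (bernoulli_pmf (\<omega> y))"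

text \<open>Conditional law of the position at time \<open>n\<close>, given the positions \<open>p 0, \<dots>, p (n - 1)\<close>.\<close>

definition rw_kernel :: "env \<Rightarrow> int \<Rightarrow> nat \<Rightarrow> (nat \<Rightarrow> int) \<Rightarrow> int measure" where
  "rw_kernel \<omega> x n p =
     measure_pmf (if n = 0 then return_pmf x else rw_step \<omega> (p (n - 1)))"

lemma Ionescu_Tulcea_rw_kernel:
  "Ionescu_Tulcea (rw_kernel \<omega> x) (\<lambda>_. count_space UNIV)"
proof (rule Ionescu_Tulcea.intro)
  fix i
  show "rw_kernel \<omega> x i \<in> PiM {0..<i} (\<lambda>_. count_space UNIV) \<rightarrow>\<^sub>M subprob_algebra (count_space UNIV)"
  proof (cases i)
    case 0
    then show ?thesis
      by (simp add: rw_kernel_def[abs_def] measure_pmf_in_subprob_algebra)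
  next
    case (Suc j)
    have "(\<lambda>y. measure_pmf (rw_step \<omega> y)) \<in> count_space UNIV \<rightarrow>\<^sub>M subprob_algebra (count_space UNIV)"
      by (simp add: measure_pmf_in_subprob_algebra)
    moreover have "(\<lambda>p. p j) \<in> PiM {0..<Suc j} (\<lambda>_. count_space UNIV) \<rightarrow>\<^sub>M count_space (UNIV :: int set)"
      by (rule measurable_component_singleton) simp
    ultimately show ?thesis
      unfolding Suc rw_kernel_def[abs_def] by (simp add: measurable_compose)
  qed
next
  fix i p
  show "prob_space (rw_kernel \<omega> x i p)"
    by (simp add: rw_kernel_def measure_pmf.prob_space_axioms)
qed

interpretation rw: Ionescu_Tulcea "rw_kernel \<omega> x" "\<lambda>_. count_space UNIV" for \<omega> x
  by (rule Ionescu_Tulcea_rw_kernel)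

text \<open>The walk in environment \<open>\<omega>\<close> started at \<open>x\<close>, as a measure on trajectories
  obtained from the Ionescu-Tulcea extension theorem.\<close>

definition quenched_law :: "env \<Rightarrow> int \<Rightarrow> (nat \<Rightarrow> int) measure" where
  "quenched_law \<omega> x = rw.PF.lim \<omega> x"

lemma sets_quenched_law [measurable_cong]:
  "sets (quenched_law \<omega> x) = sets (PiM UNIV (\<lambda>_. count_space UNIV))"
  by (simp add: quenched_law_def)

lemma space_quenched_law [simp]: "space (quenched_law \<omega> x) = UNIV"
  by (simp add: quenched_law_def space_PiM)

lemma prob_space_quenched_law: "prob_space (quenched_law \<omega> x)"
proof
  have "emeasure (quenched_law \<omega> x) (prod_emb UNIV (\<lambda>_. count_space UNIV) {} {\<lambda>_. undefined}) =
    emeasure (rw.CI \<omega> x {}) {\<lambda>_. undefined}"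
    unfolding quenched_law_def by (rule rw.lim) (auto simp: PiM_empty)
  moreover have "prod_emb UNIV (\<lambda>_. count_space UNIV) {} {\<lambda>_. undefined} = (UNIV :: (nat \<Rightarrow> int) set)"
    by (auto simp: prod_emb_def restrict_def)
  moreover have "emeasure (rw.CI \<omega> x {}) {\<lambda>_. undefined} = 1"
    using prob_space.emeasure_space_1[OF rw.PF.prob_space_P[of "{}" \<omega> x]]
    by (simp add: rw.PF.space_P PiM_empty)
  ultimately show "emeasure (quenched_law \<omega> x) (space (quenched_law \<omega> x)) = 1"
    by simp
qed

lemma emeasure_rw_C:
  "emeasure (rw.C \<omega> x 0 n (\<lambda>_. undefined)) {restrict p {0..<n}} =
     (\<Prod>i<n. emeasure (rw_kernel \<omega> x i p) {p i})"
proof (induction n)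
  case 0
  show ?case
    by (simp add: PiM_empty restrict_def)
next
  case (Suc n)
  let ?M = "\<lambda>n. PiM {0..<n} (\<lambda>_. count_space (UNIV :: int set))"
  let ?C = "rw.C \<omega> x 0 n (\<lambda>_. undefined)"
  have sing [measurable]: "{restrict p {0..<m}} \<in> sets (?M m)" for m
    using sets_PiM_I_finite[of "{0..<m}" "\<lambda>i. {p i}" "\<lambda>_. count_space UNIV"]
    by (simp add: PiE_eq_singleton[THEN iffD2, of _ _ p])
  have sp: "space ?C = space (?M n)"
    using rw.space_C[where n = 0 and m = n and x = "\<lambda>_. undefined"] by (simp add: PiM_empty)
  have st: "sets ?C = sets (?M n)"
    using rw.sets_C[where n = 0 and m = n and x = "\<lambda>_. undefined"] by (simp add: PiM_empty)
  have eP: "emeasure (rw.eP \<omega> x n q) {restrict p {0..<Suc n}} =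
      emeasure (rw_kernel \<omega> x n p) {p n} * indicator {restrict p {0..<n}} q"
    if q: "q \<in> space (?M n)" for q
  proof -
    have *: "(\<lambda>y. q(n := y)) -` {restrict p {0..<Suc n}} =
        (if q = restrict p {0..<n} then {p n} else {})"
    proof (cases "q = restrict p {0..<n}")
      case True
      then show ?thesis
        by (auto simp: fun_eq_iff less_Suc_eq dest: spec[of _ n] split: if_splits)
    next
      case False
      have "q = restrict p {0..<n}" if "q(n := y) = restrict p {0..<Suc n}" for y
      proof
        fix i
        show "q i = restrict p {0..<n} i"
          using fun_cong[OF that, of i] q
          by (cases "i < n") (auto simp: space_PiM PiE_iff extensional_def)
      qed
      with False show ?thesis by auto
    qed
    have "rw_kernel \<omega> x n (restrict p {0..<n}) = rw_kernel \<omega> x n p"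
      by (simp add: rw_kernel_def)
    then show ?thesis
      by (subst rw.emeasure_eP[OF q sing]) (auto simp: *)
  qed
  have "emeasure (rw.C \<omega> x 0 (Suc n) (\<lambda>_. undefined)) {restrict p {0..<Suc n}} =
      (\<integral>\<^sup>+ q. emeasure (rw.eP \<omega> x n q) {restrict p {0..<Suc n}} \<partial>?C)"
    using rw.measurable_eP[of \<omega> x n] by simp
      (subst emeasure_bind[where N = "?M (Suc n)"],
        auto simp: sp space_PiM PiE_eq_empty_iff measurable_cong_sets[OF st refl])
  also have "\<dots> = (\<integral>\<^sup>+ q. emeasure (rw_kernel \<omega> x n p) {p n} * indicator {restrict p {0..<n}} q \<partial>?C)"
    by (intro nn_integral_cong eP) (simp add: sp)
  also have "\<dots> = emeasure (rw_kernel \<omega> x n p) {p n} * emeasure ?C {restrict p {0..<n}}"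
    by (intro nn_integral_cmult_indicator) (simp add: st)
  also have "\<dots> = (\<Prod>i<Suc n. emeasure (rw_kernel \<omega> x i p) {p i})"
    by (simp add: Suc.IH mult.commute)
  finally show ?case .
qed

text \<open>These finite-dimensional probabilities determine the law.\<close>

lemma quenched_law_cylinder:
  "\<P>(X in quenched_law \<omega> x. \<forall>i\<le>n. X i = p i) =
     (if p 0 = x then (\<Prod>i<n. pmf (rw_step \<omega> (p i)) (p (Suc i))) else 0)"
proof -
  let ?J = "{0..<Suc n}"
  let ?M = "PiM ?J (\<lambda>_. count_space (UNIV :: int set))"
  have sing: "{restrict p ?J} \<in> sets ?M"
    using sets_PiM_I_finite[of ?J "\<lambda>i. {p i}" "\<lambda>_. count_space UNIV"]
    by (simp add: PiE_eq_singleton[THEN iffD2, of _ _ p])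
  have emb: "prod_emb UNIV (\<lambda>_. count_space UNIV) ?J {restrict p ?J} = {X. \<forall>i\<le>n. X i = p i}"
    by (auto simp: prod_emb_def space_PiM fun_eq_iff less_Suc_eq_le restrict_apply split: if_splits)
  have "emeasure (quenched_law \<omega> x) {X. \<forall>i\<le>n. X i = p i} = emeasure (rw.CI \<omega> x ?J) {restrict p ?J}"
    unfolding quenched_law_def emb[symmetric] by (rule rw.lim) (use sing in auto)
  also have "\<dots> = emeasure (rw.C \<omega> x 0 (Suc n) (\<lambda>_. undefined)) {restrict p ?J}"
    using rw.emeasure_CI[OF subset_refl sing, of \<omega> x]
    using sing[THEN sets.sets_into_space] by (simp add: prod_emb_id)
  also have "\<dots> = (\<Prod>i<Suc n. emeasure (rw_kernel \<omega> x i p) {p i})"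
    by (rule emeasure_rw_C)
  also have "\<dots> = emeasure (rw_kernel \<omega> x 0 p) {p 0} *
      (\<Prod>i<n. emeasure (rw_kernel \<omega> x (Suc i) p) {p (Suc i)})"
    by (rule prod.lessThan_Suc_shift)
  also have "\<dots> = ennreal (if p 0 = x then (\<Prod>i<n. pmf (rw_step \<omega> (p i)) (p (Suc i))) else 0)"
    by (simp add: rw_kernel_def emeasure_pmf_single prod_ennreal prod_nonneg ennreal_mult' indicator_def)
  finally show ?thesis
    by (simp add: measure_def prod_nonneg)
qed

definition pot :: "env \<Rightarrow> int \<Rightarrow> real" where
  "pot \<omega> x =
     (if x \<ge> 0 then (\<Sum>i\<in>{1..x}. ln ((1 - \<omega> i) / \<omega> i))
      else - (\<Sum>i\<in>{x+1..0}. ln ((1 - \<omega> i) / \<omega> i)))"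

definition pot_interp :: "env \<Rightarrow> real \<Rightarrow> real" where
  "pot_interp \<omega> t =
     pot \<omega> \<lfloor>t\<rfloor> + (t - of_int \<lfloor>t\<rfloor>) * (pot \<omega> (\<lfloor>t\<rfloor> + 1) - pot \<omega> \<lfloor>t\<rfloor>)"

definition h_minimum :: "real \<Rightarrow> (real \<Rightarrow> real) \<Rightarrow> real \<Rightarrow> bool" where
  "h_minimum h \<gamma> x \<longleftrightarrow>
     (\<exists>a b. a < x \<and> x < b \<and> \<gamma> a \<ge> \<gamma> x + h \<and> \<gamma> b \<ge> \<gamma> x + h \<and> (\<forall>y\<in>{a..b}. \<gamma> x \<le> \<gamma> y))"

definition h_maximum :: "real \<Rightarrow> (real \<Rightarrow> real) \<Rightarrow> real \<Rightarrow> bool" where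
  "h_maximum h \<gamma> x \<longleftrightarrow> h_minimum h (\<lambda>y. - \<gamma> y) x"

text \<open>For continuous \<open>\<gamma>\<close> the pointwise bound says that the maximum of
  \<open>\<bar>\<gamma> z - \<gamma> x\<bar>\<close> over the compact interval between \<open>x\<close> and \<open>x'\<close> is less than \<open>h\<close>.\<close>

definition h_equiv :: "real \<Rightarrow> (real \<Rightarrow> real) \<Rightarrow> real set \<Rightarrow> (real \<times> real) set" where
  "h_equiv h \<gamma> S =
     {(x, x'). x \<in> S \<and> x' \<in> S \<and> (\<forall>z\<in>{min x x'..max x x'}. \<bar>\<gamma> z - \<gamma> x\<bar> < h)}"

definition M_minus :: "real \<Rightarrow> (real \<Rightarrow> real) \<Rightarrow> real set" where
  "M_minus h \<gamma> =
     {x. \<exists>C \<in> Collect (h_minimum h \<gamma>) // h_equiv h \<gamma> (Collect (h_minimum h \<gamma>)).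
           x \<in> C \<and> (\<forall>y\<in>C. x \<le> y)}"

definition M_plus :: "real \<Rightarrow> (real \<Rightarrow> real) \<Rightarrow> real set" where
  "M_plus h \<gamma> =
     {x. \<exists>C \<in> Collect (h_maximum h \<gamma>) // h_equiv h \<gamma> (Collect (h_maximum h \<gamma>)).
           x \<in> C \<and> (\<forall>y\<in>C. x \<le> y)}"

text \<open>The end points and the bottom of the \<open>ln n\<close>-valley covering the origin. They are
  unspecified for the exceptional environments in which the maximum, the minimum or the
  unique point does not exist.\<close>

definition valley_left :: "nat \<Rightarrow> env \<Rightarrow> real" where
  "valley_left n \<omega> = (GREATEST x. x < 0 \<and> x \<in> M_plus (ln (real n)) (pot_interp \<omega>))"

definition valley_right :: "nat \<Rightarrow> env \<Rightarrow> real" where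
  "valley_right n \<omega> = (LEAST x. x \<ge> 0 \<and> x \<in> M_plus (ln (real n)) (pot_interp \<omega>))"

definition valley_bottom :: "nat \<Rightarrow> env \<Rightarrow> real" where
  "valley_bottom n \<omega> =
     (THE x. x \<in> M_minus (ln (real n)) (pot_interp \<omega>) \<and>
             valley_left n \<omega> < x \<and> x < valley_right n \<omega>)"

end

theory Submission
  imports Defs "HOL-Real_Asymp.Real_Asymp"
begin

text \<open>The potential \<open>V = pot \<omega>\<close> is a two-sided random walk with centred bounded steps, and the quenched walk is
the reversible walk with conductance \<open>exp (- V x)\<close> on the edge between \<open>x\<close> and \<open>x + 1\<close>. Put
\<open>h = ln n\<close> and \<open>c = 10 * ln h\<close>. The theorem rests on two facts. A deterministic one: if the valley of height
\<open>h\<close> around the origin keeps its shape when all relevant heights are changed by about \<open>c\<close>, then at time \<open>n = exp h\<close>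
the walk is close to the bottom \<open>m\<close>. A probabilistic one: up to an event of arbitrarily small probability, the
potential has such a stable valley, and every point of it where the potential is below \<open>V m + c\<close> lies within
distance \<open>K * c\<^sup>2\<close> of \<open>m\<close>, with \<open>K\<close> depending on \<open>\<alpha>\<close> only. As \<open>c\<^sup>2 / h\<^sup>2\<close> is of order \<open>(ln h / h)\<^sup>2\<close>, and
hence of smaller order than \<open>\<rho> (ln h / h)\<close>, such points are in the prescribed window.

For the deterministic part (\<open>localisation_right\<close>, \<open>localisation_left\<close>), let the walls of the valley rise to
\<open>V m + h + c\<close>. On its way to \<open>m\<close> the walk climbs at most about \<open>h - c\<close>, so its expected travel time is of order at most
\<open>exp (h - c)\<close> times the square of the width of the valley, hence \<open>m\<close> is visited before time \<open>n\<close>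
(\<open>hitting_time_bound\<close>). After that, reversibility bounds the probability of being at \<open>y\<close>, at any time
whatsoever, by a constant times \<open>exp (V m - V y)\<close> (\<open>transition_prob_le_weight_ratio\<close>). Summing this over the
\<open>n\<close> times at the ends of the valley shows that the walk has not left it, and summing it over the points at
height at least \<open>V m + c\<close> shows that the walk is not there at time \<open>n\<close>. All sums have polynomially many
terms in \<open>h\<close>, which the factor \<open>exp (- c) = h powr (-10)\<close> absorbs. That \<open>m\<close> is the valley bottom of the
statement is \<open>valley_shape_exists\<close> together with \<open>valley_bottom_eqI\<close>.

For the probabilistic part, follow the potential from the origin to one side and cut the path at the times when
it has fallen by a further \<open>c\<close> below its last cutting point. Each piece is a trial: from its start the path
either falls by \<open>c\<close>, and the next trial begins, or rises by \<open>h + c\<close> first, which is a success and happens with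
probability about \<open>c / h\<close>. The successful trial contains the lowest point before the rise. The bad events are
that the trial before the successful one lasted much longer than \<open>c\<^sup>2\<close>, that the successful path lingers near
its minimum for that long or comes back to it from far above, and that some trial climbs to \<open>h - 2 * c\<close>
and falls back. In a single trial each of them has a probability that is small compared with
\<open>c / h\<close>; a geometric series over the trials then gives a small total (\<open>trial_bound\<close>). Which side contains
the bottom is decided by the heights to which the potential rises on the two sides before it has first risen by \<open>h\<close>
above its running minimum. They are independent, and neither is concentrated on a scale
smaller than \<open>h\<close> (\<open>drawup_bound\<close>), so they differ by \<open>4 * c\<close> with high probability (\<open>near_tie_bound\<close>). When they do,
the valley is stable (\<open>environment_localised\<close>).

All probabilities for the potential are bounded by one device, \<open>superharmonic_bound\<close>: the event is recognised by a
state machine that reads the steps of the potential, and an explicit superharmonic function of the state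
dominates its probability. Gambler's ruin, exit times and the strong Markov property at the cutting times
are all contained in the choice of that function, which is piecewise a combination of the harmonic functions
\<open>1\<close>, \<open>x\<close> and \<open>v * t - x\<^sup>2\<close>.\<close>

section \<open>The law of the walk as iterates of its transition operator\<close>

definition walk_op :: "(int \<Rightarrow> real) \<Rightarrow> (int \<Rightarrow> real) \<Rightarrow> int \<Rightarrow> real" where
  "walk_op p f x = p x * f (x + 1) + (1 - p x) * f (x - 1)"

lemma walk_op_mono:
  assumes "0 \<le> p x" "p x \<le> 1" "f (x + 1) \<le> g (x + 1)" "f (x - 1) \<le> g (x - 1)"
  shows "walk_op p f x \<le> walk_op p g x"
  unfolding walk_op_def using assms by (intro add_mono mult_left_mono) auto

lemma walk_op_reflect:
  "walk_op (\<lambda>x. 1 - p (- x)) (\<lambda>x. f (- x)) x = walk_op p f (- x)"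
  by (simp add: walk_op_def)

lemma walk_op_funpow_reflect:
  "(walk_op (\<lambda>x. 1 - p (- x)) ^^ n) (\<lambda>x. f (- x)) x = (walk_op p ^^ n) f (- x)"
proof (induction n arbitrary: x)
  case (Suc n)
  have "(walk_op (\<lambda>x. 1 - p (- x)) ^^ n) (\<lambda>x. f (- x)) = (\<lambda>x. (walk_op p ^^ n) f (- x))"
    using Suc.IH by blast
  then show ?case by (simp add: walk_op_reflect)
qed simp

lemma nn_integral_rw_step:
  assumes "0 \<le> \<omega> y" "\<omega> y \<le> 1" "\<And>x. 0 \<le> f x"
  shows "(\<integral>\<^sup>+z. ennreal (f z) \<partial>rw_step \<omega> y) = ennreal (walk_op \<omega> f y)"
  using assms
  by (simp add: rw_step_def walk_op_def ennreal_plus[symmetric] ennreal_mult[symmetric] mult.commute del: ennreal_plus)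

primrec position_pmf :: "env \<Rightarrow> int \<Rightarrow> nat \<Rightarrow> int pmf" where
  "position_pmf \<omega> x 0 = return_pmf x"
| "position_pmf \<omega> x (Suc n) = bind_pmf (position_pmf \<omega> x n) (rw_step \<omega>)"

text \<open>Paths are listed backwards, so the head is the present position. Whole paths are used because
\<open>quenched_law\<close> is known through its cylinder probabilities.\<close>

primrec path_pmf :: "env \<Rightarrow> int \<Rightarrow> nat \<Rightarrow> int list pmf" where
  "path_pmf \<omega> x 0 = return_pmf [x]"
| "path_pmf \<omega> x (Suc n) = bind_pmf (path_pmf \<omega> x n) (\<lambda>l. map_pmf (\<lambda>y. y # l) (rw_step \<omega> (hd l)))"

lemma map_hd_path_pmf: "map_pmf hd (path_pmf \<omega> x n) = position_pmf \<omega> x n"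
proof (induction n)
  case (Suc n)
  have "map_pmf hd (path_pmf \<omega> x (Suc n)) = bind_pmf (path_pmf \<omega> x n) (\<lambda>l. rw_step \<omega> (hd l))"
    by (simp add: map_bind_pmf map_pmf_comp)
  also have "\<dots> = bind_pmf (map_pmf hd (path_pmf \<omega> x n)) (rw_step \<omega>)"
    by (simp add: bind_map_pmf)
  finally show ?case using Suc.IH by simp
qed simp

lemma pmf_path_pmf:
  "pmf (path_pmf \<omega> x n) (rev (map p [0..<Suc n])) =
     (if p 0 = x then (\<Prod>i<n. pmf (rw_step \<omega> (p i)) (p (Suc i))) else 0)"
proof (induction n)
  case 0
  then show ?case by (auto simp: indicator_def)
next
  case (Suc n)
  let ?l = "rev (map p [0..<Suc n])"
  have hd: "hd ?l = p n" by simp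
  have 1: "pmf (map_pmf (\<lambda>y. y # l) (rw_step \<omega> (hd l))) (p (Suc n) # ?l) =
     (if l = ?l then pmf (rw_step \<omega> (p n)) (p (Suc n)) else 0)" for l
  proof (cases "l = ?l")
    case True
    then show ?thesis using hd
      by (simp only: if_True) (subst pmf_map_inj', auto simp: inj_def)
  next
    case False
    then have "p (Suc n) # ?l \<notin> (\<lambda>y. y # l) ` set_pmf (rw_step \<omega> (hd l))" by auto
    then show ?thesis using False by (simp add: pmf_map_outside del: upt_Suc)
  qed
  have "pmf (path_pmf \<omega> x (Suc n)) (rev (map p [0..<Suc (Suc n)])) =
    measure_pmf.expectation (path_pmf \<omega> x n) (\<lambda>l. if l = ?l then pmf (rw_step \<omega> (p n)) (p (Suc n)) else 0)"
    using 1 by (simp add: pmf_bind)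
  also have "\<dots> = measure_pmf.expectation (path_pmf \<omega> x n)
      (\<lambda>l. pmf (rw_step \<omega> (p n)) (p (Suc n)) * indicator {?l} l)"
    by (intro Bochner_Integration.integral_cong) auto
  also have "\<dots> = pmf (rw_step \<omega> (p n)) (p (Suc n)) * pmf (path_pmf \<omega> x n) ?l"
    by (simp add: measure_pmf_single)
  finally show ?case using Suc.IH by (simp add: mult.commute)
qed

text \<open>Up to time \<open>n\<close> both laws live on the countable set of lists, and by \<open>quenched_law_cylinder\<close> they agree
on singletons.\<close>

lemma quenched_law_position:
  "\<P>(X in quenched_law \<omega> x. X n \<in> B) = measure_pmf.prob (position_pmf \<omega> x n) B"
proof -
  interpret Q: prob_space "quenched_law \<omega> x" by (rule prob_space_quenched_law)
  define path where "path X = rev (map X [0..<Suc n])" for X :: "nat \<Rightarrow> int"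
  have coord [measurable]: "(\<lambda>X. X i) \<in> quenched_law \<omega> x \<rightarrow>\<^sub>M count_space UNIV" for i
    unfolding measurable_cong_sets[OF sets_quenched_law refl] by (rule measurable_component_singleton) simp
  have cyl: "path -` {l} \<inter> space (quenched_law \<omega> x) = {X \<in> space (quenched_law \<omega> x). \<forall>i\<le>n. X i = rev l ! i}"
    if "length l = Suc n" for l
  proof -
    have "path X = l \<longleftrightarrow> map X [0..<Suc n] = rev l" for X
      unfolding path_def by (metis rev_rev_ident)
    then show ?thesis
      using that by (auto simp: list_eq_iff_nth_eq less_Suc_eq_le simp del: upt_Suc)
  qed
  have len: "path X = l \<Longrightarrow> length l = Suc n" for X l by (auto simp: path_def)
  have path_m [measurable]: "path \<in> quenched_law \<omega> x \<rightarrow>\<^sub>M count_space UNIV"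
  proof (rule measurable_count_space_eq2_countable[THEN iffD2])
    show "path \<in> space (quenched_law \<omega> x) \<rightarrow> UNIV \<and>
      (\<forall>a\<in>UNIV. path -` {a} \<inter> space (quenched_law \<omega> x) \<in> sets (quenched_law \<omega> x))"
    proof (intro conjI ballI)
      fix l :: "int list"
      show "path -` {l} \<inter> space (quenched_law \<omega> x) \<in> sets (quenched_law \<omega> x)"
      proof (cases "length l = Suc n")
        case True
        show ?thesis unfolding cyl[OF True] by measurable
      next
        case False
        then have "path -` {l} = {}" using len by auto
        then show ?thesis by simp
      qed
    qed auto
  qed
  have eq: "distr (quenched_law \<omega> x) (count_space UNIV) path = measure_pmf (path_pmf \<omega> x n)"
  proof (rule measure_eqI_countable[of _ UNIV])
    fix l :: "int list"
    have le: "set_pmf (path_pmf \<omega> x m) \<subseteq> {l. length l = Suc m}" for m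
      by (induction m) auto
    show "emeasure (distr (quenched_law \<omega> x) (count_space UNIV) path) {l} = emeasure (measure_pmf (path_pmf \<omega> x n)) {l}"
    proof (cases "length l = Suc n")
      case True
      have "rev (map (\<lambda>i. rev l ! i) [0..<Suc n]) = l"
        using True by (metis length_rev map_nth rev_rev_ident)
      then have "pmf (path_pmf \<omega> x n) l = \<P>(X in quenched_law \<omega> x. \<forall>i\<le>n. X i = rev l ! i)"
        using quenched_law_cylinder[of \<omega> x n "\<lambda>i. rev l ! i"] pmf_path_pmf[of \<omega> x n "\<lambda>i. rev l ! i"]
        by (simp del: upt_Suc)
      then show ?thesis
        using cyl[OF True] by (simp add: emeasure_distr Q.emeasure_eq_measure emeasure_pmf_single)
    next
      case False
      then have "path -` {l} = {}" using len by auto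
      moreover have "pmf (path_pmf \<omega> x n) l = 0" using le[of n] False by (auto simp: pmf_eq_0_set_pmf)
      ultimately show ?thesis by (simp add: emeasure_distr emeasure_pmf_single)
    qed
  qed simp_all
  have "\<P>(X in quenched_law \<omega> x. X n \<in> B) = measure (distr (quenched_law \<omega> x) (count_space UNIV) path) {l. hd l \<in> B}"
  proof -
    have "hd (path X) = X n" for X by (simp add: path_def)
    then show ?thesis by (subst measure_distr) (auto simp: vimage_def Int_def)
  qed
  also have "\<dots> = measure (map_pmf hd (path_pmf \<omega> x n)) B"
    by (simp add: eq vimage_def)
  finally show ?thesis by (simp add: map_hd_path_pmf)
qed

lemma walk_op_nonneg:
  assumes "\<And>x. 0 \<le> p x \<and> p x \<le> 1" "\<And>x. 0 \<le> f x"
  shows "0 \<le> walk_op p f x"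
  using assms by (simp add: walk_op_def)

lemma nn_integral_position:
  assumes "\<And>y. 0 \<le> \<omega> y \<and> \<omega> y \<le> 1" "\<And>x. 0 \<le> f x"
  shows "(\<integral>\<^sup>+z. ennreal (f z) \<partial>position_pmf \<omega> x n) = ennreal ((walk_op \<omega> ^^ n) f x)"
  using assms(2)
proof (induction n arbitrary: f)
  case (Suc n)
  have "(\<integral>\<^sup>+z. ennreal (f z) \<partial>position_pmf \<omega> x (Suc n)) =
      (\<integral>\<^sup>+z. ennreal (walk_op \<omega> f z) \<partial>position_pmf \<omega> x n)"
    using assms(1) Suc.prems by (simp add: nn_integral_rw_step)
  also have "\<dots> = ennreal ((walk_op \<omega> ^^ n) (walk_op \<omega> f) x)"
    using assms(1) Suc.prems by (intro Suc.IH walk_op_nonneg) auto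
  finally show ?case by (simp add: funpow_swap1)
qed (simp add: nn_integral_return_pmf)

lemma walk_op_funpow_nonneg:
  assumes "\<And>x. 0 \<le> p x \<and> p x \<le> 1" "\<And>x. 0 \<le> f x"
  shows "0 \<le> (walk_op p ^^ n) f x"
  using assms(2) by (induction n arbitrary: x) (auto intro!: walk_op_nonneg assms(1))

text \<open>The only contact with the measure on trajectories. In terms of the operator, the Markov property is the
recursion for its powers, and statements about exit and hitting times become inductions on the number
of steps.\<close>

lemma quenched_law_eq_walk_op:
  assumes "\<And>y. 0 \<le> \<omega> y \<and> \<omega> y \<le> 1"
  shows "\<P>(X in quenched_law \<omega> x. X n \<in> B) = (walk_op \<omega> ^^ n) (indicator B) x"
proof -
  have "ennreal (measure_pmf.prob (position_pmf \<omega> x n) B) = ennreal ((walk_op \<omega> ^^ n) (indicator B) x)"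
    using nn_integral_position[where \<omega> = \<omega> and f = "indicator B" and x = x and n = n, OF assms]
    by (simp add: ennreal_indicator measure_pmf.emeasure_eq_measure)
  then have "measure_pmf.prob (position_pmf \<omega> x n) B = (walk_op \<omega> ^^ n) (indicator B) x"
    using assms by (subst (asm) ennreal_inj) (auto intro: walk_op_funpow_nonneg)
  then show ?thesis unfolding quenched_law_position .
qed


lemma walk_op_sum:
  "walk_op p (\<lambda>x. \<Sum>i\<in>I. f i x) = (\<lambda>x. \<Sum>i\<in>I. walk_op p (f i) x)"
  by (simp add: walk_op_def sum.distrib sum_distrib_left fun_eq_iff)

lemma walk_op_scale: "walk_op p (\<lambda>x. c * f x) = (\<lambda>x. c * walk_op p f x)"
  by (simp add: walk_op_def algebra_simps fun_eq_iff)

lemma walk_op_funpow_sum: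
  "(walk_op p ^^ n) (\<lambda>x. \<Sum>i\<in>I. f i x) = (\<lambda>x. \<Sum>i\<in>I. (walk_op p ^^ n) (f i) x)"
  by (induction n) (simp_all add: walk_op_sum)

lemma walk_op_funpow_scale: "(walk_op p ^^ n) (\<lambda>x. c * f x) = (\<lambda>x. c * (walk_op p ^^ n) f x)"
  by (induction n) (simp_all add: walk_op_scale)

lemma walk_op_funpow_add:
  "(walk_op p ^^ n) (\<lambda>x. f x + g x) = (\<lambda>x. (walk_op p ^^ n) f x + (walk_op p ^^ n) g x)"
  by (induction n) (simp_all add: walk_op_def algebra_simps fun_eq_iff)

lemma walk_op_funpow_mono:
  assumes "\<And>x. 0 \<le> p x \<and> p x \<le> 1" "\<And>x. f x \<le> g x"
  shows "(walk_op p ^^ n) f x \<le> (walk_op p ^^ n) g x"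
  using assms(2) by (induction n arbitrary: x) (auto intro!: walk_op_mono simp: assms(1))

lemma walk_op_funpow_le_1:
  assumes p: "\<And>x. 0 \<le> p x \<and> p x \<le> 1" and f: "\<And>x. f x \<le> 1"
  shows "(walk_op p ^^ n) f x \<le> 1"
proof -
  have "(walk_op p ^^ n) (\<lambda>_. 1) x = 1" for x
    by (induction n arbitrary: x) (simp_all add: walk_op_def)
  then show ?thesis using walk_op_funpow_mono[where p = p and f = f and g = "\<lambda>_. 1", OF p f, of n x] by simp
qed

section \<open>Occupation and hitting estimates for reversible walks\<close>

text \<open>The walk can leave \<open>{a..b}\<close> only after a visit to \<open>a\<close> or \<open>b\<close>; the right-hand side is the expected number
of such visits.\<close>

lemma walk_op_exit:
  assumes p: "\<And>x. 0 \<le> p x \<and> p x \<le> 1" and x: "x \<in> {a..b}"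
  shows "(walk_op p ^^ k) (indicator (- {a..b})) x \<le> (\<Sum>j\<le>k. (walk_op p ^^ j) (indicator {a, b}) x)"
  using x
proof (induction k arbitrary: x)
  case (Suc k)
  have nn: "0 \<le> (walk_op p ^^ j) (indicator {a, b}) x" for j x
    by (intro walk_op_funpow_nonneg p) auto
  show ?case
  proof (cases "x = a \<or> x = b")
    case True
    have "(walk_op p ^^ Suc k) (indicator (- {a..b})) x \<le> 1"
      by (intro walk_op_funpow_le_1 p) (auto simp: indicator_def)
    also have "1 = (walk_op p ^^ 0) (indicator {a, b}) x"
      using True by auto
    also have "\<dots> \<le> (\<Sum>j\<le>Suc k. (walk_op p ^^ j) (indicator {a, b}) x)"
      by (rule member_le_sum) (use nn in auto)
    finally show ?thesis .
  next
    case False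
    then have x: "x + 1 \<in> {a..b}" "x - 1 \<in> {a..b}" using Suc.prems by auto
    have "(walk_op p ^^ Suc k) (indicator (- {a..b})) x \<le>
        walk_op p (\<lambda>x. \<Sum>j\<le>k. (walk_op p ^^ j) (indicator {a, b}) x) x"
      using p Suc.IH[OF x(1)] Suc.IH[OF x(2)] by (auto intro!: walk_op_mono)
    also have "\<dots> = (\<Sum>j\<le>k. (walk_op p ^^ Suc j) (indicator {a, b}) x)"
      by (simp add: walk_op_sum)
    also have "\<dots> \<le> (\<Sum>j\<le>Suc k. (walk_op p ^^ j) (indicator {a, b}) x)"
      using nn[of 0] by (simp add: sum.atMost_Suc_shift del: sum.atMost_Suc)
    finally show ?thesis .
  qed
qed auto

text \<open>The random walk on the network in which the edge between \<open>x\<close> and \<open>x + 1\<close> has conductance \<open>C x\<close>.\<close>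

definition edge_prob :: "(int \<Rightarrow> real) \<Rightarrow> int \<Rightarrow> real" where
  "edge_prob C x = C x / (C x + C (x - 1))"

lemma edge_prob_bounds: "(\<And>x. C x > 0) \<Longrightarrow> 0 \<le> edge_prob C x \<and> edge_prob C x \<le> 1"
  by (simp add: edge_prob_def add_pos_pos less_imp_le)

text \<open>The mirror image of the edge between \<open>x\<close> and \<open>x + 1\<close> is the edge between \<open>- x - 1\<close> and \<open>- x\<close>, whence the
shift.\<close>

lemma edge_prob_reflect:
  assumes "\<And>x. C x > 0"
  shows "edge_prob (\<lambda>x. C (- x - 1)) = (\<lambda>x. 1 - edge_prob C (- x))"
proof
  fix x
  have "C (- x) + C (- x - 1) > 0" using assms by (intro add_pos_pos)
  then show "edge_prob (\<lambda>x. C (- x - 1)) x = 1 - edge_prob C (- x)"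
    by (simp add: edge_prob_def field_simps)
qed

text \<open>The measure \<open>C y + C (y - 1)\<close> is stationary. Divided by its value at \<open>m\<close> it dominates the point mass at
\<open>m\<close>, and so it dominates the law of the walk from \<open>m\<close> at every later time. Because of this uniformity in time the
bound can be used in place of convergence to equilibrium inside the valley.\<close>

lemma transition_prob_le_weight_ratio:
  assumes C: "\<And>x. C x > 0"
  shows "(walk_op (edge_prob C) ^^ k) (indicator {y}) m \<le> (C y + C (y - 1)) / (C m + C (m - 1))"
proof (induction k arbitrary: y)
  case 0
  show ?case using C[of m] C[of "m - 1"] C[of y] C[of "y - 1"] by (auto simp: indicator_def)
next
  case (Suc k)
  let ?p = "edge_prob C" and ?\<mu> = "\<lambda>x. C x + C (x - 1)"
  note pos = C[of y] C[of "y - 1"] C[of "y + 1"] C[of "y - 2"] C[of m] C[of "m - 1"]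
  have "walk_op ?p (indicator {y}) =
      (\<lambda>x. ?p (y - 1) * indicator {y - 1} x + (1 - ?p (y + 1)) * indicator {y + 1} x)"
    by (auto simp: walk_op_def fun_eq_iff indicator_def)
  then have "(walk_op ?p ^^ Suc k) (indicator {y}) m =
      ?p (y - 1) * (walk_op ?p ^^ k) (indicator {y - 1}) m +
      (1 - ?p (y + 1)) * (walk_op ?p ^^ k) (indicator {y + 1}) m"
    by (simp add: funpow_swap1 walk_op_funpow_add walk_op_funpow_scale)
  also have "\<dots> \<le> ?p (y - 1) * (?\<mu> (y - 1) / ?\<mu> m) + (1 - ?p (y + 1)) * (?\<mu> (y + 1) / ?\<mu> m)"
    by (intro add_mono mult_left_mono Suc.IH) (use edge_prob_bounds[of C] C in auto)
  also have "\<dots> = ?\<mu> y / ?\<mu> m"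
  proof -
    have "?p (y - 1) * ?\<mu> (y - 1) = C (y - 1)" "(1 - ?p (y + 1)) * ?\<mu> (y + 1) = C y"
      using pos by (simp_all add: edge_prob_def field_simps)
    then have "?p (y - 1) * ?\<mu> (y - 1) + (1 - ?p (y + 1)) * ?\<mu> (y + 1) = ?\<mu> y"
      by linarith
    then show ?thesis
      by (simp only: times_divide_eq_right add_divide_distrib[symmetric])
  qed
  finally show ?case .
qed

text \<open>A walk outside \<open>W\<close> at time \<open>k\<close> either has visited \<open>a\<close> or \<open>b\<close>, which accounts for \<open>k + 1\<close> times and two
points, or is at one of the points of \<open>{a..b} - W\<close>.\<close>

lemma outside_window_from_bottom:
  assumes C: "\<And>x. C x > 0" and ab: "a \<le> m" "m \<le> b" "a < b"
    and ends: "(C a + C (a - 1)) / (C m + C (m - 1)) \<le> \<epsilon>" "(C b + C (b - 1)) / (C m + C (m - 1)) \<le> \<epsilon>"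
    and far: "\<And>y. y \<in> {a..b} - W \<Longrightarrow> (C y + C (y - 1)) / (C m + C (m - 1)) \<le> \<eta>"
    and eta: "0 \<le> \<eta>"
  shows "(walk_op (edge_prob C) ^^ k) (indicator (- W)) m \<le> 2 * (real k + 1) * \<epsilon> + (real_of_int (b - a) + 1) * \<eta>"
proof -
  let ?P = "walk_op (edge_prob C)"
  note p = edge_prob_bounds[where C = C, OF C]
  have "(?P ^^ k) (indicator (- W)) m \<le>
      (?P ^^ k) (\<lambda>x. indicator (- {a..b}) x + (\<Sum>y\<in>{a..b} - W. indicator {y} x)) m"
  proof (rule walk_op_funpow_mono[OF p])
    fix x
    show "(indicator (- W) x :: real) \<le> indicator (- {a..b}) x + (\<Sum>y\<in>{a..b} - W. indicator {y} x)"
    proof (cases "x \<in> {a..b} - W")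
      case True
      then have "(indicator {x} x :: real) \<le> (\<Sum>y\<in>{a..b} - W. indicator {y} x)"
        by (intro member_le_sum) auto
      then show ?thesis by (auto simp: indicator_def)
    next
      case False
      then show ?thesis by (auto simp: indicator_def intro!: sum_nonneg)
    qed
  qed
  also have "\<dots> = (?P ^^ k) (indicator (- {a..b})) m + (\<Sum>y\<in>{a..b} - W. (?P ^^ k) (indicator {y}) m)"
    by (simp add: walk_op_funpow_add walk_op_funpow_sum)
  also have "(?P ^^ k) (indicator (- {a..b})) m \<le> (\<Sum>j\<le>k. (?P ^^ j) (indicator {a, b}) m)"
    using ab by (intro walk_op_exit p) auto
  also have "\<dots> \<le> (\<Sum>j\<le>k. 2 * \<epsilon>)"
  proof (rule sum_mono)
    fix j
    have "indicator {a, b} = (\<lambda>x. indicator {a} x + indicator {b} x :: real)"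
      using ab by (auto simp: indicator_def fun_eq_iff)
    then have "(?P ^^ j) (indicator {a, b}) m = (?P ^^ j) (indicator {a}) m + (?P ^^ j) (indicator {b}) m"
      by (simp add: walk_op_funpow_add)
    then show "(?P ^^ j) (indicator {a, b}) m \<le> 2 * \<epsilon>"
      using transition_prob_le_weight_ratio[where C = C, OF C, where k = j and m = m and y = a]
        transition_prob_le_weight_ratio[where C = C, OF C, where k = j and m = m and y = b] ends by simp
  qed
  also have "(\<Sum>y\<in>{a..b} - W. (?P ^^ k) (indicator {y}) m) \<le> (\<Sum>y\<in>{a..b} - W. \<eta>)"
    using transition_prob_le_weight_ratio[where C = C, OF C] far by (intro sum_mono) (meson order_trans)
  also have "\<dots> \<le> (real_of_int (b - a) + 1) * \<eta>"
  proof -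
    have "card ({a..b} - W) \<le> card {a..b}" by (intro card_mono) auto
    then have "real (card ({a..b} - W)) \<le> real_of_int (b - a) + 1" using ab by simp
    then show ?thesis using eta by (simp add: mult_right_mono)
  qed
  finally show ?thesis by (simp add: algebra_simps)
qed

text \<open>The first summand bounds the probability that the walk is strictly between \<open>a\<close> and \<open>m\<close> up to time \<open>n\<close>, by
Markov's inequality for the exit time; the second that it reaches \<open>a\<close> before \<open>m\<close>; the third is what remains to be
paid after the first visit to \<open>m\<close>.\<close>

lemma hitting_time_bound:
  assumes C: "\<And>x. C x > 0" and n: "n > 0" and x: "a \<le> x" "x \<le> m"
    and climb: "\<And>z y. a \<le> z \<Longrightarrow> z \<le> y \<Longrightarrow> y < m \<Longrightarrow> C z / C y \<le> Q"
    and barrier: "\<And>y. x \<le> y \<Longrightarrow> y < m \<Longrightarrow> C a / C y \<le> \<eta>"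
    and f: "\<And>x. 0 \<le> f x" "\<And>x. f x \<le> 1"
    and bottom: "\<And>k. k \<le> n \<Longrightarrow> (walk_op (edge_prob C) ^^ k) f m \<le> s"
  shows "(walk_op (edge_prob C) ^^ n) f x \<le>
    2 * Q * (real_of_int (m - a))\<^sup>2 / real n + real_of_int (m - x) * \<eta> + s"
proof (cases "a < m")
  case False
  then have "x = m" "a = m" using x by auto
  then show ?thesis using bottom[of n] by simp
next
  case am: True
  let ?P = "walk_op (edge_prob C)" and ?p = "edge_prob C"
  note p = edge_prob_bounds[where C = C, OF C]
  define \<mu> where "\<mu> x = C x + C (x - 1)" for x
  have mu: "\<mu> x > 0" for x unfolding \<mu>_def using C by (intro add_pos_pos)
  have p_up: "?p x * (1 / C x) = 1 / \<mu> x" and p_dn: "(1 - ?p x) * (1 / C (x - 1)) = 1 / \<mu> x" for x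
    using C[of x] C[of "x - 1"] mu[of x] unfolding edge_prob_def \<mu>_def by (simp_all add: field_simps)
  \<comment> \<open>\<open>g x\<close> is the probability of hitting \<open>a\<close> before \<open>m\<close>; \<open>F x\<close> is the expected time spent strictly between
    \<open>a\<close> and \<open>m\<close> before \<open>m\<close> is reached when \<open>a\<close> reflects, which dominates the exit time; \<open>u k x\<close> is the probability of no exit before time \<open>k\<close>.\<close>
  define Z where "Z = (\<Sum>y\<in>{a..<m}. 1 / C y)"
  define g where "g x = (\<Sum>y\<in>{x..<m}. 1 / C y) / Z" for x
  define G where "G y = (\<Sum>z\<in>{a<..y}. \<mu> z)" for y
  define F where "F x = (\<Sum>y\<in>{x..<m}. (1 / C y) * G y)" for x
  define u :: "nat \<Rightarrow> int \<Rightarrow> real" where "u = rec_nat (\<lambda>x. if a < x \<and> x < m then 1 else 0)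
      (\<lambda>_ v x. if a < x \<and> x < m then ?P v x else 0)"
  have u0: "u 0 = (\<lambda>x. if a < x \<and> x < m then 1 else 0)"
    and uS: "u (Suc n) = (\<lambda>x. if a < x \<and> x < m then ?P (u n) x else 0)" for n
    unfolding u_def by simp_all
  have "1 / C a \<le> Z"
    unfolding Z_def by (rule member_le_sum) (use am C in \<open>auto intro: less_imp_le\<close>)
  moreover have "1 / C a > 0" using C by simp
  ultimately have Z: "Z > 0" by linarith
  with \<open>1 / C a \<le> Z\<close> have Z': "1 / Z \<le> C a"
    using C[of a] by (simp add: field_simps)
  have split: "sum k {x..<m} = k x + sum k {x + 1..<m}" if "x < m" for x and k :: "int \<Rightarrow> real"
  proof -
    have "{x..<m} = insert x {x + 1..<m}" using that by auto
    then show ?thesis by simp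
  qed
  have g_step: "?P g x = g x" if "a < x" "x < m" for x
  proof -
    have "g (x + 1) = g x - 1 / C x / Z" "g (x - 1) = 1 / C (x - 1) / Z + g x"
      using split[of x] split[of "x - 1"] that by (simp_all add: g_def add_divide_distrib)
    then have "?P g x = g x - ?p x * (1 / C x) / Z + (1 - ?p x) * (1 / C (x - 1)) / Z"
      unfolding walk_op_def by (simp only:) (simp add: algebra_simps)
    then show ?thesis unfolding p_up p_dn by simp
  qed
  have F_step: "?P F x = F x - 1" if "a < x" "x < m" for x
  proof -
    have "{a<..x} = insert x {a<..x - 1}" using that by auto
    then have G: "G x = \<mu> x + G (x - 1)" by (simp add: G_def)
    have "F (x + 1) = F x - 1 / C x * G x" "F (x - 1) = 1 / C (x - 1) * G (x - 1) + F x"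
      using split[of x] split[of "x - 1"] that by (simp_all add: F_def)
    then have "?P F x = F x - ?p x * (1 / C x) * G x + (1 - ?p x) * (1 / C (x - 1)) * G (x - 1)"
      unfolding walk_op_def by (simp only:) (simp add: algebra_simps)
    also have "\<dots> = F x - (G x - G (x - 1)) / \<mu> x"
      unfolding p_up p_dn by (simp add: diff_divide_distrib)
    finally show ?thesis using G mu[of x] by simp
  qed
  have G0: "0 \<le> G y" for y unfolding G_def using mu by (intro sum_nonneg) (auto intro: less_imp_le)
  have F0: "0 \<le> F x" for x unfolding F_def using C G0 by (intro sum_nonneg) (auto intro!: divide_nonneg_pos)
  have g0: "0 \<le> g x" for x unfolding g_def using C Z by (intro divide_nonneg_pos sum_nonneg) (auto intro: less_imp_le)
  have u_nonneg: "0 \<le> u n x" for n x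
    by (induction n arbitrary: x) (auto simp: u0 uS intro!: walk_op_nonneg p)
  have u_dec: "u (Suc n) x \<le> u n x" for n x
  proof (induction n arbitrary: x)
    case 0
    have "walk_op ?p (u 0) x \<le> walk_op ?p (\<lambda>_. 1) x"
      using p by (intro walk_op_mono) (auto simp: u0)
    then show ?case by (auto simp: u0 uS walk_op_def)
  next
    case (Suc n)
    have "?P (u (Suc n)) x \<le> ?P (u n) x" using p Suc.IH by (intro walk_op_mono) auto
    then show ?case by (subst uS, subst (2) uS) auto
  qed
  have u_sum: "(\<Sum>k<n. u k x) \<le> F x" for n x
  proof (induction n arbitrary: x)
    case (Suc n)
    show ?case
    proof (cases "a < x \<and> x < m")
      case True
      have "(\<Sum>k<Suc n. u k x) = 1 + ?P (\<lambda>x. \<Sum>k<n. u k x) x"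
        using True by (simp add: sum.lessThan_Suc_shift u0 uS walk_op_sum del: sum.lessThan_Suc)
      also have "?P (\<lambda>x. \<Sum>k<n. u k x) x \<le> ?P F x"
        using p Suc.IH by (intro walk_op_mono) auto
      finally show ?thesis using F_step True by simp
    next
      case False
      have "u k x = 0" for k
      proof (cases k)
        case 0
        show ?thesis unfolding 0 u0 using False by (rule if_not_P)
      next
        case (Suc j)
        show ?thesis unfolding Suc uS using False by (rule if_not_P)
      qed
      then show ?thesis using F0 by simp
    qed
  qed (simp add: F0)
  have u_bound: "real n * u n x \<le> F x" for n x
  proof -
    have "u n x \<le> u k x" if "k \<le> n" for k
      using lift_Suc_antimono_le[of "\<lambda>k. u k x" k n] u_dec that by simp
    then have "(\<Sum>k<n. u n x) \<le> (\<Sum>k<n. u k x)" by (intro sum_mono) auto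
    also have "\<dots> \<le> F x" by (rule u_sum)
    finally show ?thesis by simp
  qed
  have s0: "0 \<le> s" using bottom[of 0] f(1)[of m] by simp
  have main: "(?P ^^ k) f x \<le> u k x + g x + s" if "k \<le> n" "a \<le> x" "x \<le> m" for k x
    using that
  proof (induction k arbitrary: x)
    case 0
    show ?case
    proof (cases "x = m \<or> x = a")
      case True
      then show ?thesis
      proof
        assume "x = m" then show ?thesis using bottom[of 0] g0[of m] u_nonneg[of 0 m] by simp
      next
        assume "x = a" then show ?thesis using f(2)[of a] Z s0 u_nonneg[of 0 a]
          by (simp add: g_def Z_def[symmetric])
      qed
    next
      case False
      then show ?thesis using 0 f(2)[of x] g0[of x] s0 by (simp add: u0)
    qed
  next
    case (Suc k)
    consider "x = m" | "x = a" | "a < x" "x < m" using Suc.prems by force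
    then show ?case
    proof cases
      case 1
      then show ?thesis using bottom[of "Suc k"] Suc.prems g0[of m] u_nonneg[of "Suc k" m] by simp
    next
      case 2
      have "(?P ^^ Suc k) f a \<le> 1" by (intro walk_op_funpow_le_1 p f)
      then show ?thesis using 2 Z s0 u_nonneg[of "Suc k" a] by (simp add: g_def Z_def[symmetric])
    next
      case 3
      have "(?P ^^ Suc k) f x \<le> ?P (\<lambda>x. u k x + g x + s) x"
        using Suc.IH[of "x + 1"] Suc.IH[of "x - 1"] Suc.prems 3 p by (auto intro!: walk_op_mono)
      also have "\<dots> = ?P (u k) x + ?P g x + s"
        by (simp add: walk_op_def algebra_simps)
      finally show ?thesis using 3 g_step by (simp add: uS)
    qed
  qed
  have Q0: "0 \<le> Q" using climb[of a a] am C[of a] by simp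
  have "F x \<le> (\<Sum>y\<in>{x..<m}. real_of_int (m - a) * (2 * Q))"
    unfolding F_def
  proof (rule sum_mono)
    fix y assume y: "y \<in> {x..<m}"
    have "1 / C y * G y = (\<Sum>z\<in>{a<..y}. C z / C y + C (z - 1) / C y)"
      by (simp add: G_def \<mu>_def sum_distrib_left add_divide_distrib)
    also have "\<dots> \<le> (\<Sum>z\<in>{a<..y}. Q + Q)"
      using y by (intro sum_mono add_mono climb) auto
    also have "\<dots> = real_of_int (y - a) * (2 * Q)" using y x by simp
    also have "\<dots> \<le> real_of_int (m - a) * (2 * Q)"
      using y Q0 by (intro mult_right_mono) auto
    finally show "1 / C y * G y \<le> real_of_int (m - a) * (2 * Q)" .
  qed
  also have "\<dots> = real_of_int (m - x) * (real_of_int (m - a) * (2 * Q))" using x by simp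
  also have "\<dots> \<le> real_of_int (m - a) * (real_of_int (m - a) * (2 * Q))"
    using x Q0 by (intro mult_right_mono) auto
  finally have "F x \<le> real_of_int (m - a) * (real_of_int (m - a) * (2 * Q))" .
  then have "real n * u n x \<le> real_of_int (m - a) * (real_of_int (m - a) * (2 * Q))"
    by (rule order_trans[OF u_bound])
  also have "\<dots> = 2 * Q * (real_of_int (m - a))\<^sup>2"
    by (simp only: power2_eq_square mult_ac)
  finally have "real n * u n x \<le> 2 * Q * (real_of_int (m - a))\<^sup>2" .
  then have "u n x \<le> 2 * Q * (real_of_int (m - a))\<^sup>2 / real n"
    using n by (subst pos_le_divide_eq) (simp_all only: of_nat_0_less_iff mult.commute)
  moreover have "g x \<le> real_of_int (m - x) * \<eta>"
  proof -
    have "g x = (\<Sum>y\<in>{x..<m}. 1 / C y * (1 / Z))" by (simp add: g_def sum_divide_distrib)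
    also have "\<dots> \<le> (\<Sum>y\<in>{x..<m}. \<eta>)"
    proof (rule sum_mono)
      fix y assume y: "y \<in> {x..<m}"
      have "1 / C y * (1 / Z) \<le> 1 / C y * C a"
        using Z' C[of y] by (intro mult_left_mono) auto
      also have "\<dots> \<le> \<eta>" using barrier[of y] y by simp
      finally show "1 / C y * (1 / Z) \<le> \<eta>" .
    qed
    finally show ?thesis using x by simp
  qed
  ultimately show ?thesis using main[of n x] x by simp
qed

lemma hitting_time_bound_left:
  assumes C: "\<And>x. C x > 0" and n: "n > 0" and x: "m \<le> x" "x \<le> b"
    and climb: "\<And>z y. m \<le> y \<Longrightarrow> y \<le> z \<Longrightarrow> z < b \<Longrightarrow> C z / C y \<le> Q"
    and barrier: "\<And>y. m \<le> y \<Longrightarrow> y < x \<Longrightarrow> C (b - 1) / C y \<le> \<eta>"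
    and f: "\<And>x. 0 \<le> f x" "\<And>x. f x \<le> 1"
    and bottom: "\<And>k. k \<le> n \<Longrightarrow> (walk_op (edge_prob C) ^^ k) f m \<le> s"
  shows "(walk_op (edge_prob C) ^^ n) f x \<le>
    2 * Q * (real_of_int (b - m))\<^sup>2 / real n + real_of_int (x - m) * \<eta> + s"
proof -
  have refl: "(walk_op (edge_prob (\<lambda>x. C (- x - 1))) ^^ k) (\<lambda>x. f (- x)) y =
      (walk_op (edge_prob C) ^^ k) f (- y)" for k y
    unfolding edge_prob_reflect[where C = C, OF C] by (rule walk_op_funpow_reflect[where p = "edge_prob C" and f = f])
  have "(walk_op (edge_prob (\<lambda>x. C (- x - 1))) ^^ n) (\<lambda>x. f (- x)) (- x) \<le>
      2 * Q * (real_of_int (- m - (- b)))\<^sup>2 / real n + real_of_int (- m - (- x)) * \<eta> + s"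
  proof (rule hitting_time_bound)
    show "C (- z - 1) / C (- y - 1) \<le> Q" if "- b \<le> z" "z \<le> y" "y < - m" for z y
      using climb[of "- y - 1" "- z - 1"] that by simp
    show "C (- (- b) - 1) / C (- y - 1) \<le> \<eta>" if "- x \<le> y" "y < - m" for y
      using barrier[of "- y - 1"] that by simp
    show "(walk_op (edge_prob (\<lambda>x. C (- x - 1))) ^^ k) (\<lambda>x. f (- x)) (- m) \<le> s" if "k \<le> n" for k
      unfolding refl using bottom[OF that] by simp
  qed (use C n x f in auto)
  then show ?thesis unfolding refl by (simp add: power2_commute)
qed


section \<open>Localisation in a valley with stable walls\<close>

text \<open>The walk in the potential \<open>V\<close>; for \<open>V = pot \<omega>\<close> its transition probabilities are those of \<open>\<omega>\<close> (\<open>pot_walk_pot\<close>).\<close>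

definition pot_walk :: "(int \<Rightarrow> real) \<Rightarrow> int \<Rightarrow> real" where
  "pot_walk V = edge_prob (\<lambda>x. exp (- V x))"

text \<open>With \<open>n = exp N\<close>, reaching a height \<open>N + c\<close> above the bottom within \<open>n\<close> steps costs \<open>n * exp (- N - c)\<close>.\<close>

lemma bottom_stays_in_window:
  assumes L: "\<And>x. \<bar>V x - V (x - 1)\<bar> \<le> L"
    and n: "n > 0" "real n = exp N" and k: "k \<le> n" and ab: "a \<le> m" "m \<le> b" "a < b" "real_of_int (b - a) \<le> D" "1 \<le> D"
    and ends: "V m + N + c \<le> V a" "V m + N + c \<le> V b"
    and far: "\<And>y. a \<le> y \<Longrightarrow> y \<le> b \<Longrightarrow> \<bar>real_of_int (y - m)\<bar> > w \<Longrightarrow> V m + c \<le> V y"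
  shows "(walk_op (pot_walk V) ^^ k) (indicator (- {y. \<bar>real_of_int (y - m)\<bar> \<le> w})) m \<le> (1 + exp L) * (6 * D) * exp (- c)"
proof -
  have ratio: "(exp (- V y) + exp (- V (y - 1))) / (exp (- V m) + exp (- V (m - 1))) \<le> (1 + exp L) * exp (- e)"
    if "V m + e \<le> V y" for y e
  proof -
    have "- V (y - 1) \<le> L + (- V y)" using L[of y] by linarith
    then have "exp (- V (y - 1)) \<le> exp L * exp (- V y)" by (simp only: exp_add[symmetric] exp_le_cancel_iff)
    then have "exp (- V y) + exp (- V (y - 1)) \<le> (1 + exp L) * exp (- V y)"
      by (simp add: algebra_simps)
    also have "\<dots> \<le> (1 + exp L) * exp (- e + (- V m))"
      using that by (intro mult_left_mono) (auto intro: add_nonneg_nonneg)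
    finally have "exp (- V y) + exp (- V (y - 1)) \<le> (1 + exp L) * exp (- e) * exp (- V m)"
      by (simp only: exp_add mult.assoc)
    also have "\<dots> \<le> (1 + exp L) * exp (- e) * (exp (- V m) + exp (- V (m - 1)))"
      by (intro mult_left_mono mult_nonneg_nonneg) (auto intro: add_nonneg_nonneg)
    finally show ?thesis by (subst pos_divide_le_eq) (auto intro: add_pos_pos)
  qed
  have "(walk_op (pot_walk V) ^^ k) (indicator (- {y. \<bar>real_of_int (y - m)\<bar> \<le> w})) m \<le>
      2 * (real k + 1) * ((1 + exp L) * exp (- (N + c))) + (real_of_int (b - a) + 1) * ((1 + exp L) * exp (- c))"
    unfolding pot_walk_def
    using ab ends ratio[of "N + c" a] ratio[of "N + c" b]
    by (intro outside_window_from_bottom) (auto simp: add.assoc intro!: ratio far mult_nonneg_nonneg add_nonneg_nonneg)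
  also have "2 * (real k + 1) * ((1 + exp L) * exp (- (N + c))) \<le> 2 * (2 * real n) * ((1 + exp L) * exp (- (N + c)))"
    using k n by (intro mult_right_mono) (auto intro: add_nonneg_nonneg)
  also have "\<dots> = 4 * ((1 + exp L) * exp (- c))"
  proof -
    have "exp (- (N + c)) = exp (- c) / exp N" by (simp add: exp_diff[symmetric])
    then show ?thesis by (simp add: n(2))
  qed
  also have "4 * ((1 + exp L) * exp (- c)) + (real_of_int (b - a) + 1) * ((1 + exp L) * exp (- c)) =
      (4 + (real_of_int (b - a) + 1)) * ((1 + exp L) * exp (- c))" by (simp add: algebra_simps)
  also have "\<dots> \<le> (6 * D) * ((1 + exp L) * exp (- c))"
    using ab by (intro mult_right_mono) (auto intro: add_nonneg_nonneg)
  finally show ?thesis by (simp add: algebra_simps)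
qed

lemma localisation_arith:
  assumes "c' \<le> c" "1 \<le> D" "0 \<le> (L::real)"
  shows "2 * D\<^sup>2 * exp (- c') + D * exp (- c) + (1 + exp L) * (6 * D) * exp (- c) \<le> 9 * (1 + exp L) * D\<^sup>2 * exp (- c')"
proof -
  have e: "exp (- c) \<le> exp (- c')" "1 \<le> 1 + exp L" "D \<le> D\<^sup>2" 
    using assms by (auto simp: power2_eq_square intro: order_trans[of 0 1])
  have "D * exp (- c) \<le> (1 + exp L) * D\<^sup>2 * exp (- c')"
    using e assms(2) by (intro mult_mono) (auto intro: order_trans[OF _ mult_right_mono[of 1 "1 + exp L" "D\<^sup>2"]])
  moreover have "(1 + exp L) * (6 * D) * exp (- c) \<le> (1 + exp L) * (6 * D\<^sup>2) * exp (- c')"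
    using e assms(2) by (intro mult_mono) (auto intro: add_nonneg_nonneg)
  ultimately have "2 * D\<^sup>2 * exp (- c') + D * exp (- c) + (1 + exp L) * (6 * D) * exp (- c) \<le>
      2 * D\<^sup>2 * exp (- c') + (1 + exp L) * D\<^sup>2 * exp (- c') + (1 + exp L) * (6 * D\<^sup>2) * exp (- c')"
    by linarith
  also have "\<dots> = 9 * (1 + exp L) * D\<^sup>2 * exp (- c') - 2 * (exp L * (D\<^sup>2 * exp (- c')))"
    by (simp add: algebra_simps)
  also have "\<dots> \<le> 9 * (1 + exp L) * D\<^sup>2 * exp (- c')" by simp
  finally show ?thesis .
qed

text \<open>Climbs of at most \<open>N - c'\<close> between \<open>a\<close> and \<open>m\<close> are overcome well within \<open>exp N\<close> steps, the barrier at \<open>a\<close> is higher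
by \<open>c\<close> than everything between the origin and \<open>m\<close>, and from \<open>m\<close> the walk cannot leave over a wall of height
\<open>N + c\<close>.\<close>

lemma localisation_right:
  assumes L: "\<And>x. \<bar>V x - V (x - 1)\<bar> \<le> L"
    and n: "n > 0" "real n = exp N"
    and ab: "a < 0" "0 \<le> m" "m \<le> b" "real_of_int (b - a) \<le> D"
    and c: "c' \<le> c"
    and ends: "V m + N + c \<le> V a" "V m + N + c \<le> V b"
    and far: "\<And>y. a \<le> y \<Longrightarrow> y \<le> b \<Longrightarrow> \<bar>real_of_int (y - m)\<bar> > w \<Longrightarrow> V m + c \<le> V y"
    and climb: "\<And>x y. a \<le> x \<Longrightarrow> x \<le> y \<Longrightarrow> y \<le> m \<Longrightarrow> V y - V x \<le> N - c'"
    and barrier: "\<And>x. 0 \<le> x \<Longrightarrow> x \<le> m \<Longrightarrow> V x + c \<le> V a"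
  shows "(walk_op (pot_walk V) ^^ n) (indicator (- {y. \<bar>real_of_int (y - m)\<bar> \<le> w})) 0
    \<le> 9 * (1 + exp L) * D\<^sup>2 * exp (- c')"
proof -
  have D1: "1 \<le> D" using ab by linarith
  have "(walk_op (pot_walk V) ^^ n) (indicator (- {y. \<bar>real_of_int (y - m)\<bar> \<le> w})) 0 \<le>
     2 * exp (N - c') * (real_of_int (m - a))\<^sup>2 / real n + real_of_int (m - 0) * exp (- c) + (1 + exp L) * (6 * D) * exp (- c)"
    unfolding pot_walk_def
  proof (rule hitting_time_bound)
    show "exp (- V z) / exp (- V y) \<le> exp (N - c')" if "a \<le> z" "z \<le> y" "y < m" for z y
      using climb[of z y] that by (simp add: exp_diff[symmetric])
    show "exp (- V a) / exp (- V y) \<le> exp (- c)" if "0 \<le> y" "y < m" for y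
      using barrier[of y] that by (simp add: exp_diff[symmetric])
    show "(walk_op (edge_prob (\<lambda>x. exp (- V x))) ^^ k) (indicator (- {y. \<bar>real_of_int (y - m)\<bar> \<le> w})) m
        \<le> (1 + exp L) * (6 * D) * exp (- c)" if "k \<le> n" for k
      unfolding pot_walk_def[symmetric]
      by (rule bottom_stays_in_window[where V = V and a = a and b = b and N = N and n = n, OF L]) (use n that ab ends far D1 in auto)
  qed (use n ab in \<open>auto simp: indicator_def\<close>)
  also have "2 * exp (N - c') * (real_of_int (m - a))\<^sup>2 / real n = 2 * (real_of_int (m - a))\<^sup>2 * exp (- c')"
    by (simp add: n(2) exp_diff exp_minus field_simps)
  also have "\<dots> \<le> 2 * D\<^sup>2 * exp (- c')"
    using ab by (intro mult_mono power_mono) auto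
  also have "real_of_int (m - 0) * exp (- c) \<le> D * exp (- c)" using ab by (intro mult_right_mono) auto
  also have "2 * D\<^sup>2 * exp (- c') + D * exp (- c) + (1 + exp L) * (6 * D) * exp (- c) \<le> 9 * (1 + exp L) * D\<^sup>2 * exp (- c')"
    by (rule localisation_arith) (use c D1 L[of 0] in auto)
  finally show ?thesis by simp
qed

text \<open>The outermost edge on the right has conductance \<open>exp (- V (b - 1))\<close> rather than \<open>exp (- V b)\<close>; this
asymmetry of the potential under reflection is what the loss \<open>L\<close> in \<open>c'\<close> pays for.\<close>

lemma localisation_left:
  assumes L: "\<And>x. \<bar>V x - V (x - 1)\<bar> \<le> L"
    and n: "n > 0" "real n = exp N"
    and ab: "a \<le> m" "m \<le> 0" "0 < b" "real_of_int (b - a) \<le> D"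
    and c: "c' \<le> c - L"
    and ends: "V m + N + c \<le> V a" "V m + N + c \<le> V b"
    and far: "\<And>y. a \<le> y \<Longrightarrow> y \<le> b \<Longrightarrow> \<bar>real_of_int (y - m)\<bar> > w \<Longrightarrow> V m + c \<le> V y"
    and climb: "\<And>x y. m \<le> y \<Longrightarrow> y \<le> x \<Longrightarrow> x \<le> b \<Longrightarrow> V y - V x \<le> N - c'"
    and barrier: "\<And>x. m \<le> x \<Longrightarrow> x \<le> 0 \<Longrightarrow> V x + c \<le> V b"
  shows "(walk_op (pot_walk V) ^^ n) (indicator (- {y. \<bar>real_of_int (y - m)\<bar> \<le> w})) 0
    \<le> 9 * (1 + exp L) * D\<^sup>2 * exp (- c')"
proof -
  have D1: "1 \<le> D" using ab by linarith
  have L0: "0 \<le> L" using L[of 0] by linarith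
  have "(walk_op (pot_walk V) ^^ n) (indicator (- {y. \<bar>real_of_int (y - m)\<bar> \<le> w})) 0 \<le>
     2 * exp (N - c') * (real_of_int (b - m))\<^sup>2 / real n + real_of_int (0 - m) * exp (- (c - L)) + (1 + exp L) * (6 * D) * exp (- c)"
    unfolding pot_walk_def
  proof (rule hitting_time_bound_left)
    show "exp (- V z) / exp (- V y) \<le> exp (N - c')" if "m \<le> y" "y \<le> z" "z < b" for z y
      using climb[of y z] that by (simp add: exp_diff[symmetric])
    show "exp (- V (b - 1)) / exp (- V y) \<le> exp (- (c - L))" if "m \<le> y" "y < 0" for y
      using barrier[of y] that L[of b] by (simp add: exp_diff[symmetric])
    show "(walk_op (edge_prob (\<lambda>x. exp (- V x))) ^^ k) (indicator (- {y. \<bar>real_of_int (y - m)\<bar> \<le> w})) m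
        \<le> (1 + exp L) * (6 * D) * exp (- c)" if "k \<le> n" for k
      unfolding pot_walk_def[symmetric]
      by (rule bottom_stays_in_window[where V = V and a = a and b = b and N = N and n = n, OF L]) (use n that ab ends far D1 in auto)
  qed (use n ab in \<open>auto simp: indicator_def\<close>)
  also have "2 * exp (N - c') * (real_of_int (b - m))\<^sup>2 / real n = 2 * (real_of_int (b - m))\<^sup>2 * exp (- c')"
    by (simp add: n(2) exp_diff exp_minus field_simps)
  also have "\<dots> \<le> 2 * D\<^sup>2 * exp (- c')"
    using ab by (intro mult_mono power_mono) auto
  also have "real_of_int (0 - m) * exp (- (c - L)) \<le> D * exp (- (c - L))" using ab by (intro mult_right_mono) auto
  also have "(1 + exp L) * (6 * D) * exp (- c) \<le> (1 + exp L) * (6 * D) * exp (- (c - L))"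
    using L0 D1 by (intro mult_left_mono) (auto intro!: mult_nonneg_nonneg add_nonneg_nonneg)
  also have "2 * D\<^sup>2 * exp (- c') + D * exp (- (c - L)) + (1 + exp L) * (6 * D) * exp (- (c - L)) \<le> 9 * (1 + exp L) * D\<^sup>2 * exp (- c')"
    by (rule localisation_arith) (use c D1 L0 in auto)
  finally show ?thesis by simp
qed

section \<open>Valleys of a real function\<close>

lemma h_equiv_iff:
  "(x, x') \<in> h_equiv h \<gamma> S \<longleftrightarrow> x \<in> S \<and> x' \<in> S \<and> (\<forall>z. min x x' \<le> z \<and> z \<le> max x x' \<longrightarrow> \<bar>\<gamma> z - \<gamma> x\<bar> < h)"
  by (auto simp: h_equiv_def)

text \<open>The walls that make \<open>x\<close> an \<open>h\<close>-minimum cannot lie between \<open>x\<close> and \<open>x'\<close>, so \<open>x'\<close> is inside them.\<close>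

lemma h_minimum_equiv_le:
  assumes x: "h_minimum h \<gamma> x"
    and near: "\<forall>z. min x x' \<le> z \<and> z \<le> max x x' \<longrightarrow> \<bar>\<gamma> z - \<gamma> x\<bar> < h"
  shows "\<gamma> x \<le> \<gamma> x'"
proof -
  obtain a b where ab: "a < x" "x < b" "\<gamma> a \<ge> \<gamma> x + h" "\<gamma> b \<ge> \<gamma> x + h"
    and min: "\<forall>y\<in>{a..b}. \<gamma> x \<le> \<gamma> y"
    using x by (auto simp: h_minimum_def)
  have "a \<le> x'"
  proof (rule ccontr)
    assume "\<not> a \<le> x'"
    then have "\<bar>\<gamma> a - \<gamma> x\<bar> < h" using near ab by auto
    then show False using ab by linarith
  qed
  moreover have "x' \<le> b"
  proof (rule ccontr)
    assume "\<not> x' \<le> b"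
    then have "\<bar>\<gamma> b - \<gamma> x\<bar> < h" using near ab by auto
    then show False using ab by linarith
  qed
  ultimately show ?thesis using min by simp
qed

text \<open>Equivalent minima have equal height. The relation compares with the height of its first argument only, so its symmetry and
transitivity depend on this.\<close>

lemma h_equiv_height:
  assumes "(x, x') \<in> h_equiv h \<gamma> (Collect (h_minimum h \<gamma>))"
  shows "\<gamma> x = \<gamma> x'"
proof (rule ccontr)
  assume ne: "\<gamma> x \<noteq> \<gamma> x'"
  have x: "h_minimum h \<gamma> x" and x': "h_minimum h \<gamma> x'"
    and near: "\<forall>z. min x x' \<le> z \<and> z \<le> max x x' \<longrightarrow> \<bar>\<gamma> z - \<gamma> x\<bar> < h"
    using assms by (auto simp: h_equiv_iff)
  have lt: "\<gamma> x < \<gamma> x'" using h_minimum_equiv_le[OF x near] ne by simp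
  obtain a b where ab: "a < x'" "x' < b" "\<gamma> a \<ge> \<gamma> x' + h" "\<gamma> b \<ge> \<gamma> x' + h"
    and min: "\<forall>y\<in>{a..b}. \<gamma> x' \<le> \<gamma> y"
    using x' by (auto simp: h_minimum_def)
  have "x < a \<or> b < x" using min lt by (meson atLeastAtMost_iff not_le)
  then show False
  proof
    assume "x < a"
    then have "\<bar>\<gamma> a - \<gamma> x\<bar> < h" using near ab by auto
    then show False using ab lt by linarith
  next
    assume "b < x"
    then have "\<bar>\<gamma> b - \<gamma> x\<bar> < h" using near ab by auto
    then show False using ab lt by linarith
  qed
qed

lemma equiv_h_equiv:
  assumes "h > 0"
  shows "equiv (Collect (h_minimum h \<gamma>)) (h_equiv h \<gamma> (Collect (h_minimum h \<gamma>)))"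
proof (rule equivI)
  let ?S = "Collect (h_minimum h \<gamma>)"
  show "h_equiv h \<gamma> ?S \<subseteq> ?S \<times> ?S" by (auto simp: h_equiv_iff)
  show "refl_on ?S (h_equiv h \<gamma> ?S)"
    using assms by (auto simp: refl_on_def h_equiv_iff)
  show "sym (h_equiv h \<gamma> ?S)"
  proof (rule symI)
    fix x y assume xy: "(x, y) \<in> h_equiv h \<gamma> ?S"
    then show "(y, x) \<in> h_equiv h \<gamma> ?S"
      using h_equiv_height[OF xy] by (auto simp: h_equiv_iff min.commute max.commute)
  qed
  show "trans (h_equiv h \<gamma> ?S)"
  proof (rule transI)
    fix x y z assume xy: "(x, y) \<in> h_equiv h \<gamma> ?S" and yz: "(y, z) \<in> h_equiv h \<gamma> ?S"
    have "\<bar>\<gamma> t - \<gamma> x\<bar> < h" if "min x z \<le> t" "t \<le> max x z" for t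
    proof -
      have "(min x y \<le> t \<and> t \<le> max x y) \<or> (min y z \<le> t \<and> t \<le> max y z)"
        using that by (auto simp: min_def max_def split: if_splits)
      then show ?thesis using xy yz h_equiv_height[OF xy] by (auto simp: h_equiv_iff)
    qed
    then show "(x, z) \<in> h_equiv h \<gamma> ?S" using xy yz by (auto simp: h_equiv_iff)
  qed
qed

lemma M_minus_iff:
  assumes "h > 0"
  shows "x \<in> M_minus h \<gamma> \<longleftrightarrow> h_minimum h \<gamma> x \<and>
    (\<forall>y. (x, y) \<in> h_equiv h \<gamma> (Collect (h_minimum h \<gamma>)) \<longrightarrow> x \<le> y)"
proof -
  let ?S = "Collect (h_minimum h \<gamma>)" and ?R = "h_equiv h \<gamma> (Collect (h_minimum h \<gamma>))"
  note E = equiv_h_equiv[OF assms, of \<gamma>]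
  show ?thesis
  proof
    assume "x \<in> M_minus h \<gamma>"
    then obtain C where C: "C \<in> ?S // ?R" "x \<in> C" "\<forall>y\<in>C. x \<le> y" by (auto simp: M_minus_def)
    then obtain x0 where x0: "x0 \<in> ?S" "C = ?R `` {x0}" by (auto elim: quotientE)
    then have x: "(x0, x) \<in> ?R" using C by simp
    have "x \<in> ?S" using x unfolding h_equiv_iff by blast
    moreover have "C = ?R `` {x}" unfolding x0(2) by (rule equiv_class_eq[OF E x])
    ultimately show "h_minimum h \<gamma> x \<and> (\<forall>y. (x, y) \<in> ?R \<longrightarrow> x \<le> y)" using C by auto
  next
    assume x: "h_minimum h \<gamma> x \<and> (\<forall>y. (x, y) \<in> ?R \<longrightarrow> x \<le> y)"
    then have "x \<in> ?S" by simp
    then have "?R `` {x} \<in> ?S // ?R" "x \<in> ?R `` {x}"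
      by (rule quotientI, rule equiv_class_self[OF E])
    then show "x \<in> M_minus h \<gamma>" using x unfolding M_minus_def by blast
  qed
qed

lemma M_plus_uminus: "M_plus h \<gamma> = M_minus h (\<lambda>x. - \<gamma> x)"
proof -
  have "h_equiv h \<gamma> S = h_equiv h (\<lambda>x. - \<gamma> x) S" for S
    by (auto simp: h_equiv_def abs_minus_commute)
  then show ?thesis by (simp add: M_plus_def M_minus_def h_maximum_def[abs_def])
qed

lemma M_plus_iff:
  assumes "h > 0"
  shows "x \<in> M_plus h \<gamma> \<longleftrightarrow> h_maximum h \<gamma> x \<and>
    (\<forall>y. h_maximum h \<gamma> y \<longrightarrow> (\<forall>z. min x y \<le> z \<and> z \<le> max x y \<longrightarrow> \<bar>\<gamma> z - \<gamma> x\<bar> < h) \<longrightarrow> x \<le> y)"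
proof -
  have abs: "\<bar>- \<gamma> z - - \<gamma> x\<bar> = \<bar>\<gamma> z - \<gamma> x\<bar>" for z by simp
  show ?thesis
    unfolding M_plus_uminus M_minus_iff[OF assms] h_equiv_iff h_maximum_def mem_Collect_eq abs
    by (rule conj_cong[OF refl]) (simp only: simp_thms imp_conjL)
qed

lemma h_maximum_iff:
  "h_maximum h \<gamma> x \<longleftrightarrow> (\<exists>a b. a < x \<and> x < b \<and> \<gamma> a \<le> \<gamma> x - h \<and> \<gamma> b \<le> \<gamma> x - h \<and> (\<forall>y. a \<le> y \<and> y \<le> b \<longrightarrow> \<gamma> y \<le> \<gamma> x))"
proof -
  have "- \<gamma> a \<ge> - \<gamma> x + h \<longleftrightarrow> \<gamma> a \<le> \<gamma> x - h" for a by linarith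
  then show ?thesis unfolding h_maximum_def h_minimum_def by (simp add: Ball_def)
qed

lemma equal_height:
  assumes "h_maximum h \<gamma> x" "h_maximum h \<gamma> y"
    and "\<forall>z. min x y \<le> z \<and> z \<le> max x y \<longrightarrow> \<bar>\<gamma> z - \<gamma> x\<bar> < h"
  shows "\<gamma> x = \<gamma> y"
proof -
  have "\<bar>- \<gamma> z - - \<gamma> x\<bar> = \<bar>\<gamma> z - \<gamma> x\<bar>" for z by simp
  then have "(x, y) \<in> h_equiv h (\<lambda>x. - \<gamma> x) (Collect (h_minimum h (\<lambda>x. - \<gamma> x)))"
    using assms unfolding h_equiv_iff h_maximum_def mem_Collect_eq by (simp only: simp_thms)
  from h_equiv_height[OF this] show ?thesis by simp
qed

text \<open>A configuration that determines a valley and its bottom: neither wall contains a counter-movement of size \<open>h\<close>.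
The strict inequalities on the left of \<open>l\<close>, \<open>m\<close> and \<open>r\<close> make these points the smallest of their
equivalence classes.\<close>

locale valley_shape =
  fixes h :: real and \<gamma> :: "real \<Rightarrow> real" and l m r :: real
  assumes h: "h > 0" and lm: "l < m" and mr: "m < r"
    and left_climb: "\<And>u v. l \<le> u \<Longrightarrow> u \<le> v \<Longrightarrow> v \<le> m \<Longrightarrow> \<gamma> v - \<gamma> u < h"
    and left_max: "\<And>u. l \<le> u \<Longrightarrow> u \<le> m \<Longrightarrow> \<gamma> u \<le> \<gamma> l"
    and left_drop: "\<exists>a<l. \<gamma> a \<le> \<gamma> l - h \<and> (\<forall>u. a \<le> u \<and> u < l \<longrightarrow> \<gamma> u < \<gamma> l)"
    and left_high: "\<gamma> m + h \<le> \<gamma> l"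
    and right_climb: "\<And>u v. m \<le> u \<Longrightarrow> u \<le> v \<Longrightarrow> v \<le> r \<Longrightarrow> \<gamma> u - \<gamma> v < h"
    and right_max: "\<And>u. m \<le> u \<Longrightarrow> u < r \<Longrightarrow> \<gamma> u < \<gamma> r"
    and right_drop: "\<exists>b>r. \<gamma> b \<le> \<gamma> r - h \<and> (\<forall>u. r \<le> u \<and> u \<le> b \<longrightarrow> \<gamma> u \<le> \<gamma> r)"
    and right_high: "\<gamma> m + h \<le> \<gamma> r"
    and left_min: "\<And>u. l \<le> u \<Longrightarrow> u < m \<Longrightarrow> \<gamma> m < \<gamma> u"
    and right_min: "\<And>u. m \<le> u \<Longrightarrow> u \<le> r \<Longrightarrow> \<gamma> m \<le> \<gamma> u"
begin

lemma left_end: "l \<in> M_plus h \<gamma>"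
proof -
  obtain a where a: "a < l" "\<gamma> a \<le> \<gamma> l - h" "\<forall>u. a \<le> u \<and> u < l \<longrightarrow> \<gamma> u < \<gamma> l"
    using left_drop by blast
  have mx: "h_maximum h \<gamma> l"
    unfolding h_maximum_iff
  proof (rule exI[of _ a], rule exI[of _ m], intro conjI allI impI)
    fix y assume "a \<le> y \<and> y \<le> m"
    then show "\<gamma> y \<le> \<gamma> l" using a(3) left_max by (cases "y < l") (auto intro: less_imp_le)
  qed (use a lm left_high in auto)
  have "l \<le> y" if y: "h_maximum h \<gamma> y" and near: "\<forall>z. min l y \<le> z \<and> z \<le> max l y \<longrightarrow> \<bar>\<gamma> z - \<gamma> l\<bar> < h" for y
  proof (rule ccontr)
    assume "\<not> l \<le> y"
    then have yl: "y < l" by simp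
    have "\<not> y \<le> a"
    proof
      assume "y \<le> a"
      then have "\<bar>\<gamma> a - \<gamma> l\<bar> < h" using near a(1) yl by auto
      then show False using a(2) by linarith
    qed
    then have "\<gamma> y < \<gamma> l" using a(3) yl by simp
    moreover have "\<gamma> l \<le> \<gamma> y"
      using equal_height[OF mx y near] by simp
    ultimately show False by simp
  qed
  then show ?thesis using mx unfolding M_plus_iff[OF h] by blast
qed

lemma right_end: "r \<in> M_plus h \<gamma>"
proof -
  obtain b where b: "b > r" "\<gamma> b \<le> \<gamma> r - h" "\<forall>u. r \<le> u \<and> u \<le> b \<longrightarrow> \<gamma> u \<le> \<gamma> r"
    using right_drop by blast
  have mx: "h_maximum h \<gamma> r"
    unfolding h_maximum_iff
  proof (rule exI[of _ m], rule exI[of _ b], intro conjI allI impI)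
    fix y assume "m \<le> y \<and> y \<le> b"
    then show "\<gamma> y \<le> \<gamma> r" using b(3) right_max[of y] by (cases "y < r") (auto intro: less_imp_le)
  qed (use b mr right_high in auto)
  have "r \<le> y" if y: "h_maximum h \<gamma> y" and near: "\<forall>z. min r y \<le> z \<and> z \<le> max r y \<longrightarrow> \<bar>\<gamma> z - \<gamma> r\<bar> < h" for y
  proof (rule ccontr)
    assume "\<not> r \<le> y"
    then have yr: "y < r" by simp
    have "\<not> y \<le> m"
    proof
      assume "y \<le> m"
      then have "\<bar>\<gamma> m - \<gamma> r\<bar> < h" using near mr yr by auto
      then show False using right_high by linarith
    qed
    then have "\<gamma> y < \<gamma> r" using right_max yr by simp
    moreover have "\<gamma> r = \<gamma> y"
      using equal_height[OF mx y near] .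
    ultimately show False by simp
  qed
  then show ?thesis using mx unfolding M_plus_iff[OF h] by blast
qed

text \<open>An \<open>h\<close>-maximum between \<open>m\<close> and \<open>r\<close> must see its lower point on the right beyond \<open>r\<close>, so it is at
least as high as \<open>r\<close>. One between \<open>l\<close> and \<open>m\<close> is likewise as high as \<open>l\<close>; there a tie is possible, but then it is
equivalent to \<open>l\<close> and not the smallest of its class.\<close>

lemma no_maximum_inside:
  assumes x: "l < x" "x < r"
  shows "x \<notin> M_plus h \<gamma>"
proof
  assume "x \<in> M_plus h \<gamma>"
  then have mx: "h_maximum h \<gamma> x"
    and least: "\<And>y. h_maximum h \<gamma> y \<Longrightarrow> (\<And>z. min x y \<le> z \<Longrightarrow> z \<le> max x y \<Longrightarrow> \<bar>\<gamma> z - \<gamma> x\<bar> < h) \<Longrightarrow> x \<le> y"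
    unfolding M_plus_iff[OF h] by blast+
  obtain a b where ab: "a < x" "x < b" "\<gamma> a \<le> \<gamma> x - h" "\<gamma> b \<le> \<gamma> x - h"
    and max: "\<And>y. a \<le> y \<Longrightarrow> y \<le> b \<Longrightarrow> \<gamma> y \<le> \<gamma> x"
    using mx unfolding h_maximum_iff by blast
  show False
  proof (cases "m \<le> x")
    case True
    have "b > r"
    proof (rule ccontr)
      assume "\<not> b > r"
      then show False using right_climb[of x b] True ab by linarith
    qed
    then have "\<gamma> r \<le> \<gamma> x" using max[of r] ab x by simp
    then show False using right_max[of x] True x by simp
  next
    case False
    have "a < l"
    proof (rule ccontr)
      assume "\<not> a < l"
      then show False using left_climb[of a x] False ab by linarith
    qed
    then have "\<gamma> l \<le> \<gamma> x" using max[of l] ab x by simp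
    then have eq: "\<gamma> x = \<gamma> l" using left_max[of x] False x by simp
    have "h_maximum h \<gamma> l" using left_end by (simp add: M_plus_iff[OF h])
    moreover have "\<bar>\<gamma> z - \<gamma> x\<bar> < h" if "min x l \<le> z" "z \<le> max x l" for z
    proof -
      have z: "l \<le> z" "z \<le> x" using that x by (simp_all add: min_def max_def split: if_splits)
      have "\<gamma> x - \<gamma> z < h" using z False by (intro left_climb) linarith+
      moreover have "\<gamma> z \<le> \<gamma> l" using z False by (intro left_max) linarith+
      ultimately show ?thesis using eq h by linarith
    qed
    ultimately show False using least[of l] x by simp
  qed
qed

lemma bottom: "m \<in> M_minus h \<gamma>"
proof -
  have mn: "h_minimum h \<gamma> m"
    unfolding h_minimum_def
  proof (rule exI[of _ l], rule exI[of _ r], intro conjI ballI)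
    fix y assume "y \<in> {l..r}"
    then show "\<gamma> m \<le> \<gamma> y" using left_min[of y] right_min[of y] by (cases "y < m") auto
  qed (use lm mr left_high right_high in auto)
  have "m \<le> y" if y: "(m, y) \<in> h_equiv h \<gamma> (Collect (h_minimum h \<gamma>))" for y
  proof (rule ccontr)
    assume "\<not> m \<le> y"
    then have ym: "y < m" by simp
    have "\<not> y \<le> l"
    proof
      assume "y \<le> l"
      then have "\<bar>\<gamma> l - \<gamma> m\<bar> < h" using y lm ym by (auto simp: h_equiv_iff)
      then show False using left_high by linarith
    qed
    then have "\<gamma> m < \<gamma> y" using left_min ym by simp
    then show False using h_equiv_height[OF y] by simp
  qed
  then show ?thesis using mn by (simp add: M_minus_iff[OF h])
qed

lemma no_other_minimum:
  assumes x: "x \<in> M_minus h \<gamma>" "l < x" "x < r"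
  shows "x = m"
proof -
  have mn: "h_minimum h \<gamma> x"
    and least: "\<And>y. (x, y) \<in> h_equiv h \<gamma> (Collect (h_minimum h \<gamma>)) \<Longrightarrow> x \<le> y"
    using x unfolding M_minus_iff[OF h] by blast+
  obtain a b where ab: "a < x" "x < b" "\<gamma> a \<ge> \<gamma> x + h" "\<gamma> b \<ge> \<gamma> x + h"
    and min: "\<And>y. a \<le> y \<Longrightarrow> y \<le> b \<Longrightarrow> \<gamma> x \<le> \<gamma> y"
    using mn unfolding h_minimum_def atLeastAtMost_iff Ball_def by blast
  consider "x = m" | "m < x" | "x < m" by linarith
  then show ?thesis
  proof cases
    case 2
    have "a < m"
    proof (rule ccontr)
      assume "\<not> a < m"
      then show False using right_climb[of a x] x ab by linarith
    qed
    then have "\<gamma> x \<le> \<gamma> m" using min[of m] ab 2 by simp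
    then have eq: "\<gamma> x = \<gamma> m" using right_min[of x] 2 x by simp
    have "\<bar>\<gamma> z - \<gamma> x\<bar> < h" if "m \<le> z" "z \<le> x" for z
    proof -
      have "\<gamma> z - \<gamma> x < h" using that 2 x(3) by (intro right_climb) linarith+
      moreover have "\<gamma> m \<le> \<gamma> z" using that x(3) by (intro right_min) linarith+
      ultimately show ?thesis using eq h by linarith
    qed
    moreover have "h_minimum h \<gamma> m" using bottom unfolding M_minus_iff[OF h] by blast
    moreover have "min x m = m" "max x m = x" using 2 by simp_all
    ultimately have "(x, m) \<in> h_equiv h \<gamma> (Collect (h_minimum h \<gamma>))"
      using mn by (simp only: h_equiv_iff mem_Collect_eq simp_thms) blast
    then show ?thesis using least[of m] 2 by simp
  next
    case 3
    have "m < b"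
    proof (rule ccontr)
      assume "\<not> m < b"
      then show False using left_climb[of x b] x ab by linarith
    qed
    then have "\<gamma> x \<le> \<gamma> m" using min[of m] ab 3 by simp
    then show ?thesis using left_min[of x] x 3 by simp
  qed
qed

end

lemma valley_bottom_eqI:
  assumes "valley_shape (ln (real n)) (pot_interp \<omega>) l m r" "l < 0" "0 \<le> r"
  shows "valley_bottom n \<omega> = m"
proof -
  interpret valley_shape "ln (real n)" "pot_interp \<omega>" l m r by fact
  have l: "valley_left n \<omega> = l"
    unfolding valley_left_def
  proof (rule Greatest_equality)
    fix y assume y: "y < 0 \<and> y \<in> M_plus (ln (real n)) (pot_interp \<omega>)"
    then show "y \<le> l" using no_maximum_inside[of y] assms by force
  qed (use left_end assms in auto)
  have r: "valley_right n \<omega> = r"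
    unfolding valley_right_def
  proof (rule Least_equality)
    fix y assume y: "0 \<le> y \<and> y \<in> M_plus (ln (real n)) (pot_interp \<omega>)"
    then show "r \<le> y" using no_maximum_inside[of y] assms by force
  qed (use right_end assms in auto)
  show ?thesis
    unfolding valley_bottom_def l r
  proof (rule the_equality)
    show "m \<in> M_minus (ln (real n)) (pot_interp \<omega>) \<and> l < m \<and> m < r"
      using bottom lm mr by simp
  qed (rule no_other_minimum, simp_all)
qed

section \<open>Valleys of an interpolated potential\<close>

definition interp :: "(int \<Rightarrow> real) \<Rightarrow> real \<Rightarrow> real" where
  "interp V t = V \<lfloor>t\<rfloor> + (t - of_int \<lfloor>t\<rfloor>) * (V (\<lfloor>t\<rfloor> + 1) - V \<lfloor>t\<rfloor>)"

lemma pot_interp_eq_interp: "pot_interp \<omega> = interp (pot \<omega>)"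
  by (simp add: pot_interp_def interp_def fun_eq_iff)

lemma interp_of_int [simp]: "interp V (of_int k) = V k"
  by (simp add: interp_def)

lemma interp_uminus: "interp (\<lambda>k. - V k) t = - interp V t"
  by (simp add: interp_def algebra_simps)

lemma interp_convex: "interp V t = (1 - (t - of_int \<lfloor>t\<rfloor>)) * V \<lfloor>t\<rfloor> + (t - of_int \<lfloor>t\<rfloor>) * V (\<lfloor>t\<rfloor> + 1)"
  by (simp add: interp_def algebra_simps)

lemma interp_less:
  assumes t: "of_int p \<le> t" "t < of_int q"
    and less: "\<And>k. p \<le> k \<Longrightarrow> k < q \<Longrightarrow> V k < B" and le: "V q \<le> B"
  shows "interp V t < B"
proof -
  define s where "s = t - of_int \<lfloor>t\<rfloor>"
  have s: "0 \<le> s" "s < 1" unfolding s_def by linarith+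
  have fl: "p \<le> \<lfloor>t\<rfloor>" "\<lfloor>t\<rfloor> < q" using t by (simp_all add: le_floor_iff floor_less_iff)
  then have "V (\<lfloor>t\<rfloor> + 1) \<le> B" using less[of "\<lfloor>t\<rfloor> + 1"] le by (cases "\<lfloor>t\<rfloor> + 1 = q") auto
  then have "s * V (\<lfloor>t\<rfloor> + 1) \<le> s * B" using s by (intro mult_left_mono)
  moreover have "(1 - s) * V \<lfloor>t\<rfloor> < (1 - s) * B" using s less[of "\<lfloor>t\<rfloor>"] fl by (intro mult_strict_left_mono) auto
  ultimately have "interp V t < (1 - s) * B + s * B" unfolding interp_convex s_def[symmetric] by linarith
  also have "\<dots> = B" by (simp add: algebra_simps)
  finally show ?thesis .
qed

lemma interp_le:
  assumes t: "of_int p \<le> t" "t \<le> of_int q"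
    and le: "\<And>k. p \<le> k \<Longrightarrow> k \<le> q \<Longrightarrow> V k \<le> B"
  shows "interp V t \<le> B"
proof (cases "t = of_int q")
  case True
  then have "p \<le> q" using t by simp
  then show ?thesis using True le[of q] by simp
next
  case False
  then have tq: "t < of_int q" using t by simp
  have "p \<le> q" using t by linarith
  then have "interp V t < B + e" if "e > 0" for e
    using that by (intro interp_less[OF t(1) tq]) (auto intro: add_mono_thms_linordered_field le_less_trans[OF le] order_trans[OF le])
  then show ?thesis by (meson field_le_epsilon less_imp_le)
qed

text \<open>Interpolation creates no new climbs: it is monotone on each cell, so extremal climbs start and end at integers.\<close>

lemma interp_climb:
  assumes h: "h > 0" and climb: "\<And>j k. p \<le> j \<Longrightarrow> j \<le> k \<Longrightarrow> k \<le> q \<Longrightarrow> V k - V j < h"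
    and uv: "of_int p \<le> u" "u \<le> v" "v \<le> of_int q"
  shows "interp V v - interp V u < h"
proof (cases "\<lfloor>u\<rfloor> = \<lfloor>v\<rfloor>")
  case True
  have eq: "interp V v - interp V u = (v - u) * (V (\<lfloor>v\<rfloor> + 1) - V \<lfloor>v\<rfloor>)"
    unfolding interp_def True by (simp add: algebra_simps)
  show ?thesis
  proof (cases "u = v \<or> V (\<lfloor>v\<rfloor> + 1) - V \<lfloor>v\<rfloor> \<le> 0")
    case True
    then have "(v - u) * (V (\<lfloor>v\<rfloor> + 1) - V \<lfloor>v\<rfloor>) \<le> 0"
      using uv by (auto intro: mult_nonneg_nonpos)
    then show ?thesis using eq h by simp
  next
    case False
    have vu: "0 \<le> v - u" "v - u \<le> 1" using \<open>\<lfloor>u\<rfloor> = \<lfloor>v\<rfloor>\<close> uv by linarith+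
    have "(v - u) * (V (\<lfloor>v\<rfloor> + 1) - V \<lfloor>v\<rfloor>) \<le> 1 * (V (\<lfloor>v\<rfloor> + 1) - V \<lfloor>v\<rfloor>)"
      using vu False by (intro mult_right_mono) auto
    moreover have "p \<le> \<lfloor>v\<rfloor>" using uv by (simp add: le_floor_iff)
    moreover have "of_int \<lfloor>v\<rfloor> < v" using \<open>\<lfloor>u\<rfloor> = \<lfloor>v\<rfloor>\<close> False uv by linarith
    then have "\<lfloor>v\<rfloor> + 1 \<le> q" using uv by linarith
    ultimately show ?thesis using climb[of "\<lfloor>v\<rfloor>" "\<lfloor>v\<rfloor> + 1"] eq by simp
  qed
next
  case False
  have le: "\<lfloor>u\<rfloor> + 1 \<le> \<lfloor>v\<rfloor>" using False floor_mono[OF uv(2)] by linarith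
  have p: "p \<le> \<lfloor>u\<rfloor>" using uv by (simp add: le_floor_iff)
  have q: "\<lceil>v\<rceil> \<le> q" using uv by (simp add: ceiling_le_iff)
  have "interp V v < h + min (V \<lfloor>u\<rfloor>) (V (\<lfloor>u\<rfloor> + 1))"
  proof -
    have "interp V v \<le> max (V \<lfloor>v\<rfloor>) (V \<lceil>v\<rceil>)"
    proof (rule interp_le)
      fix k assume "\<lfloor>v\<rfloor> \<le> k" "k \<le> \<lceil>v\<rceil>"
      then have "k = \<lfloor>v\<rfloor> \<or> k = \<lceil>v\<rceil>" by linarith
      then show "V k \<le> max (V \<lfloor>v\<rfloor>) (V \<lceil>v\<rceil>)" by auto
    qed linarith+
    moreover have "\<lfloor>v\<rfloor> \<le> q" "\<lfloor>v\<rfloor> \<le> \<lceil>v\<rceil>" using q by linarith+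
    ultimately show ?thesis
      using climb[of "\<lfloor>u\<rfloor>" "\<lfloor>v\<rfloor>"] climb[of "\<lfloor>u\<rfloor> + 1" "\<lfloor>v\<rfloor>"] climb[of "\<lfloor>u\<rfloor>" "\<lceil>v\<rceil>"] climb[of "\<lfloor>u\<rfloor> + 1" "\<lceil>v\<rceil>"]
        le p q by linarith
  qed
  moreover have "- interp V u \<le> - min (V \<lfloor>u\<rfloor>) (V (\<lfloor>u\<rfloor> + 1))"
    unfolding interp_uminus[symmetric]
  proof (rule interp_le)
    fix k assume "\<lfloor>u\<rfloor> \<le> k" "k \<le> \<lfloor>u\<rfloor> + 1"
    then have "k = \<lfloor>u\<rfloor> \<or> k = \<lfloor>u\<rfloor> + 1" by linarith
    then show "- V k \<le> - min (V \<lfloor>u\<rfloor>) (V (\<lfloor>u\<rfloor> + 1))" by auto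
  qed linarith+
  ultimately show ?thesis by linarith
qed

lemma leftmost_argmax:
  fixes V :: "int \<Rightarrow> real"
  assumes "p \<le> q"
  obtains l where "p \<le> l" "l \<le> q" "\<And>x. p \<le> x \<Longrightarrow> x \<le> q \<Longrightarrow> V x \<le> V l" "\<And>x. p \<le> x \<Longrightarrow> x < l \<Longrightarrow> V x < V l"
proof -
  define S where "S = {x \<in> {p..q}. V x = Max (V ` {p..q})}"
  have "Max (V ` {p..q}) \<in> V ` {p..q}" using assms by (intro Max_in) auto
  then have "S \<noteq> {}" by (auto simp: S_def)
  moreover have "finite S" unfolding S_def by (rule finite_subset[of _ "{p..q}"]) auto
  ultimately have S: "S \<noteq> {}" "finite S" .
  define l where "l = Min S"
  have l: "l \<in> S" unfolding l_def by (rule Min_in[OF S(2,1)])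
  have le: "V x \<le> V l" if "p \<le> x" "x \<le> q" for x
    using l that by (auto simp: S_def)
  show thesis
  proof
    show "p \<le> l" "l \<le> q" using l by (auto simp: S_def)
    show "V x < V l" if "p \<le> x" "x < l" for x
    proof -
      have "x \<notin> S" using that S unfolding l_def by (meson Min_le not_le)
      then show ?thesis using le[of x] that l unfolding S_def less_le by auto
    qed
  qed (rule le)
qed

lemma nearest_below:
  fixes m :: int
  assumes "P x" "x \<le> m"
  obtains a where "P a" "a \<le> m" "\<And>y. a < y \<Longrightarrow> y \<le> m \<Longrightarrow> \<not> P y"
proof -
  obtain a where a: "P a \<and> a \<le> m" "\<And>y. P y \<and> y \<le> m \<Longrightarrow> nat (m - a) \<le> nat (m - y)"
    using ex_has_least_nat[of "\<lambda>y. P y \<and> y \<le> m" x "\<lambda>y. nat (m - y)"] assms by blast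
  show thesis
    by (rule that[of a]) (use a in force)+
qed

lemma nearest_above:
  fixes m :: int
  assumes "P x" "m \<le> x"
  obtains b where "P b" "m \<le> b" "\<And>y. m \<le> y \<Longrightarrow> y < b \<Longrightarrow> \<not> P y"
proof -
  obtain b where b: "P b \<and> m \<le> b" "\<And>y. P y \<and> m \<le> y \<Longrightarrow> nat (b - m) \<le> nat (y - m)"
    using ex_has_least_nat[of "\<lambda>y. P y \<and> m \<le> y" x "\<lambda>y. nat (y - m)"] assms by blast
  show thesis
    by (rule that[of b]) (use b in force)+
qed

text \<open>Going left from \<open>m\<close>, let \<open>a1\<close> be the first point above which the potential rises by \<open>h\<close> on the way
back to \<open>m\<close>. The left end of the valley is the leftmost maximum between \<open>a1\<close> and \<open>m\<close>; the right end is found in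
the same way. The last hypothesis puts the origin into the valley: on the side of \<open>m\<close> where the
origin lies, there is a barrier that is higher than everything between \<open>m\<close> and the origin, and no counter-movement of
size \<open>h\<close> occurs before it.\<close>

lemma valley_shape_exists:
  fixes V :: "int \<Rightarrow> real"
  assumes h: "h > 0" and ab: "a < m" "m < b"
    and left_min: "\<And>x. a \<le> x \<Longrightarrow> x < m \<Longrightarrow> V m < V x"
    and right_min: "\<And>x. m \<le> x \<Longrightarrow> x \<le> b \<Longrightarrow> V m \<le> V x"
    and high: "V m + h \<le> V a" "V m + h \<le> V b"
    and unbounded: "\<And>B. \<exists>x\<le>a. V x \<le> B" "\<And>B. \<exists>x\<ge>b. V x \<le> B"
    and origin: "(0 \<le> m \<and> (\<forall>x y. a \<le> x \<and> x \<le> y \<and> y \<le> m \<longrightarrow> V y - V x < h) \<and> (\<forall>x. 0 \<le> x \<and> x \<le> m \<longrightarrow> V x < V a)) \<or>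
      (m \<le> 0 \<and> (\<forall>x y. m \<le> x \<and> x \<le> y \<and> y \<le> b \<longrightarrow> V x - V y < h) \<and> (\<forall>x. m \<le> x \<and> x \<le> 0 \<longrightarrow> V x < V b))"
  shows "\<exists>l r. valley_shape h (interp V) l (of_int m) r \<and> l < 0 \<and> 0 \<le> r"
proof -
  obtain x where x: "x \<le> a" "V x \<le> V a - h" using unbounded(1) by blast
  have "\<exists>y. x \<le> y \<and> y \<le> m \<and> V y - V x \<ge> h" using x ab by (intro exI[of _ a]) auto
  moreover have "x \<le> m" using x ab by simp
  ultimately obtain a1 where a1: "\<exists>y. a1 \<le> y \<and> y \<le> m \<and> V y - V a1 \<ge> h" "a1 \<le> m"
    "\<And>z. a1 < z \<Longrightarrow> z \<le> m \<Longrightarrow> \<not> (\<exists>y. z \<le> y \<and> y \<le> m \<and> V y - V z \<ge> h)"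
    by (rule nearest_below[where P = "\<lambda>x. \<exists>y. x \<le> y \<and> y \<le> m \<and> V y - V x \<ge> h"]) blast
  obtain x where x: "b \<le> x" "V x \<le> V b - h" using unbounded(2) by blast
  have "\<exists>y. m \<le> y \<and> y \<le> x \<and> V y - V x \<ge> h" using x ab by (intro exI[of _ b]) auto
  moreover have "m \<le> x" using x ab by simp
  ultimately obtain b1 where b1: "\<exists>y. m \<le> y \<and> y \<le> b1 \<and> V y - V b1 \<ge> h" "m \<le> b1"
    "\<And>z. m \<le> z \<Longrightarrow> z < b1 \<Longrightarrow> \<not> (\<exists>y. m \<le> y \<and> y \<le> z \<and> V y - V z \<ge> h)"
    by (rule nearest_above[where P = "\<lambda>x. \<exists>y. m \<le> y \<and> y \<le> x \<and> V y - V x \<ge> h"]) blast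
  obtain l where l: "a1 \<le> l" "l \<le> m" and l_max: "\<And>x. a1 \<le> x \<Longrightarrow> x \<le> m \<Longrightarrow> V x \<le> V l"
    and l_first: "\<And>x. a1 \<le> x \<Longrightarrow> x < l \<Longrightarrow> V x < V l"
    using leftmost_argmax[OF a1(2), of V] by blast
  obtain r where r: "m \<le> r" "r \<le> b1" and r_max: "\<And>x. m \<le> x \<Longrightarrow> x \<le> b1 \<Longrightarrow> V x \<le> V r"
    and r_first: "\<And>x. m \<le> x \<Longrightarrow> x < r \<Longrightarrow> V x < V r"
    using leftmost_argmax[OF b1(2), of V] by blast
  have a1l: "V a1 + h \<le> V l" using a1(1) l_max by force
  have b1r: "V b1 + h \<le> V r" using b1(1) r_max by force
  have "a1 \<noteq> l" "b1 \<noteq> r" using a1l b1r h by auto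
  then have a1_less: "a1 < l" and b1_less: "r < b1" using l r by auto
  have l_high: "V m + h \<le> V l"
  proof (cases "a1 \<le> a")
    case True
    then show ?thesis using l_max[of a] ab high by linarith
  next
    case False
    then have "V m \<le> V a1" using left_min[of a1] a1(2) by (cases "a1 = m") auto
    then show ?thesis using a1l by linarith
  qed
  have r_high: "V m + h \<le> V r"
  proof (cases "b \<le> b1")
    case True
    then show ?thesis using r_max[of b] ab high by linarith
  next
    case False
    then have "V m \<le> V b1" using right_min[of b1] b1(2) by simp
    then show ?thesis using b1r by linarith
  qed
  have "l \<noteq> m" "r \<noteq> m" using l_high r_high h by auto
  then have lm: "l < m" and mr: "m < r" using l r by auto
  have climb_l: "V y - V x < h" if "l \<le> x" "x \<le> y" "y \<le> m" for x y
    using a1(3)[of x] that a1_less by force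
  have climb_r: "V x - V y < h" if "m \<le> x" "x \<le> y" "y \<le> r" for x y
    using b1(3)[of y] that b1_less by force
  have min_l: "V m < V x" if "l \<le> x" "x < m" for x
  proof (cases "a \<le> x")
    case True
    then show ?thesis using left_min that by simp
  next
    case False
    then show ?thesis using climb_l[of x a] that ab high by simp
  qed
  have min_r: "V m \<le> V x" if "m \<le> x" "x \<le> r" for x
  proof (cases "x \<le> b")
    case True
    then show ?thesis using right_min that by simp
  next
    case False
    then show ?thesis using climb_r[of b x] that ab high by simp
  qed
  have "valley_shape h (interp V) (of_int l) (of_int m) (of_int r)"
  proof
    show "interp V v - interp V u < h" if "of_int l \<le> u" "u \<le> v" "v \<le> of_int m" for u v
      using interp_climb[OF h climb_l that] .
    show "interp V u - interp V v < h" if "of_int m \<le> u" "u \<le> v" "v \<le> of_int r" for u v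
      using interp_climb[where V = "\<lambda>k. - V k", OF h _ that] climb_r by (simp add: interp_uminus)
    show "interp V u \<le> interp V (of_int l)" if "of_int l \<le> u" "u \<le> of_int m" for u
      unfolding interp_of_int by (rule interp_le[OF that]) (use l_max l in auto)
    show "interp V u < interp V (of_int r)" if "of_int m \<le> u" "u < of_int r" for u
      unfolding interp_of_int by (rule interp_less[OF that]) (use r_first in auto)
    show "\<exists>a<of_int l. interp V a \<le> interp V (of_int l) - h \<and> (\<forall>u. a \<le> u \<and> u < of_int l \<longrightarrow> interp V u < interp V (of_int l))"
    proof (intro exI[of _ "of_int a1"] conjI allI impI)
      show "interp V u < interp V (of_int l)" if "of_int a1 \<le> u \<and> u < of_int l" for u
        unfolding interp_of_int by (rule interp_less[of a1 u l]) (use that l_first in auto)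
    qed (use a1_less a1l in auto)
    show "\<exists>b>of_int r. interp V b \<le> interp V (of_int r) - h \<and> (\<forall>u. of_int r \<le> u \<and> u \<le> b \<longrightarrow> interp V u \<le> interp V (of_int r))"
    proof (intro exI[of _ "of_int b1"] conjI allI impI)
      show "interp V u \<le> interp V (of_int r)" if "of_int r \<le> u \<and> u \<le> of_int b1" for u
        unfolding interp_of_int by (rule interp_le[of r u b1]) (use that r_max mr in auto)
    qed (use b1_less b1r in auto)
    show "interp V (of_int m) < interp V u" if "of_int l \<le> u" "u < of_int m" for u
      using interp_less[where V = "\<lambda>k. - V k" and B = "- V m", OF that] min_l by (simp add: interp_uminus)
    show "interp V (of_int m) \<le> interp V u" if "of_int m \<le> u" "u \<le> of_int r" for u
      using interp_le[where V = "\<lambda>k. - V k" and B = "- V m", OF that] min_r by (simp add: interp_uminus)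
  qed (use h lm mr l_high r_high in auto)
  moreover have "l < 0 \<and> 0 \<le> r"
    using origin
  proof (elim disjE conjE)
    assume m: "0 \<le> m" and climb: "\<forall>x y. a \<le> x \<and> x \<le> y \<and> y \<le> m \<longrightarrow> V y - V x < h"
      and low: "\<forall>x. 0 \<le> x \<and> x \<le> m \<longrightarrow> V x < V a"
    have "a1 < a"
    proof (rule ccontr)
      assume "\<not> a1 < a"
      then show False using a1(1) climb[rule_format, of a1] by (auto simp: not_less) (meson not_le)
    qed
    then have "V a \<le> V l" using l_max[of a] ab by simp
    then have "\<not> 0 \<le> l" using low lm by force
    then show ?thesis using m mr by simp
  next
    assume m: "m \<le> 0" and climb: "\<forall>x y. m \<le> x \<and> x \<le> y \<and> y \<le> b \<longrightarrow> V x - V y < h"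
      and low: "\<forall>x. m \<le> x \<and> x \<le> 0 \<longrightarrow> V x < V b"
    have "b < b1"
    proof (rule ccontr)
      assume "\<not> b < b1"
      then show False using b1(1) climb[rule_format, of _ b1] by (auto simp: not_less) (meson not_le)
    qed
    then have "V b \<le> V r" using r_max[of b] ab by simp
    then have "\<not> r \<le> 0" using low[rule_format, of r] mr by linarith
    then show ?thesis using m lm by simp
  qed
  ultimately show ?thesis
    by (intro exI[of _ "of_int l"] exI[of _ "of_int r"]) simp
qed

section \<open>State machines driven by independent steps\<close>

primrec run :: "('s \<Rightarrow> real \<Rightarrow> 's) \<Rightarrow> 's \<Rightarrow> (nat \<Rightarrow> real) \<Rightarrow> nat \<Rightarrow> 's" where
  "run F s y 0 = s"
| "run F s y (Suc k) = F (run F s y k) (y k)"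

lemma run_cong: "(\<And>i. i < k \<Longrightarrow> y i = z i) \<Longrightarrow> run F s y k = run F s z k"
  by (induction k) auto

lemma run_measurable:
  assumes F: "(\<lambda>(s, y). F s y) \<in> N \<Otimes>\<^sub>M borel \<rightarrow>\<^sub>M N" and s0: "s0 \<in> space N"
    and y: "\<And>k. k < n \<Longrightarrow> y k \<in> borel_measurable S"
  shows "(\<lambda>\<omega>. run F s0 (\<lambda>k. y k \<omega>) n) \<in> S \<rightarrow>\<^sub>M N"
  using y
proof (induction n)
  case (Suc n)
  have "y n \<in> borel_measurable S" "(\<lambda>\<omega>. run F s0 (\<lambda>k. y k \<omega>) n) \<in> S \<rightarrow>\<^sub>M N"
    using Suc by auto
  from measurable_compose[OF measurable_Pair[OF this(2,1)] F] show ?case by simp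
qed (use s0 in simp)

lemma (in prob_space) nn_integral_indep:
  assumes ind: "indep_var S X T Y" and g: "(\<lambda>(x, y). g x y) \<in> borel_measurable (S \<Otimes>\<^sub>M T)"
  shows "(\<integral>\<^sup>+\<omega>. g (X \<omega>) (Y \<omega>) \<partial>M) = (\<integral>\<^sup>+\<omega>. \<integral>\<^sup>+\<omega>'. g (X \<omega>) (Y \<omega>') \<partial>M \<partial>M)"
proof -
  have X [measurable]: "X \<in> M \<rightarrow>\<^sub>M S" and Y [measurable]: "Y \<in> M \<rightarrow>\<^sub>M T"
    and eq: "distr M S X \<Otimes>\<^sub>M distr M T Y = distr M (S \<Otimes>\<^sub>M T) (\<lambda>\<omega>. (X \<omega>, Y \<omega>))"
    using ind by (auto simp: indep_var_distribution_eq)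
  have gm [measurable]: "(\<lambda>x. g (fst x) (snd x)) \<in> borel_measurable (S \<Otimes>\<^sub>M T)"
    using g by (simp add: case_prod_beta')
  interpret D: prob_space "distr M T Y" by (rule prob_space_distr) simp
  have "(\<integral>\<^sup>+\<omega>. g (X \<omega>) (Y \<omega>) \<partial>M) = (\<integral>\<^sup>+x. g (fst x) (snd x) \<partial>distr M (S \<Otimes>\<^sub>M T) (\<lambda>\<omega>. (X \<omega>, Y \<omega>)))"
    by (subst nn_integral_distr) simp_all
  also have "\<dots> = (\<integral>\<^sup>+x. \<integral>\<^sup>+y. g x y \<partial>distr M T Y \<partial>distr M S X)"
    unfolding eq[symmetric]
    by (subst D.nn_integral_fst[symmetric])
      (auto simp: measurable_cong_sets[OF sets_pair_measure_cong[OF sets_distr sets_distr] refl])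
  also have "\<dots> = (\<integral>\<^sup>+x. \<integral>\<^sup>+\<omega>'. g x (Y \<omega>') \<partial>M \<partial>distr M S X)"
  proof (rule nn_integral_cong)
    fix x assume "x \<in> space (distr M S X)"
    then have "(\<lambda>y. g x y) \<in> borel_measurable T"
      using measurable_Pair2[OF gm, of x] by simp
    then show "(\<integral>\<^sup>+y. g x y \<partial>distr M T Y) = (\<integral>\<^sup>+\<omega>'. g x (Y \<omega>') \<partial>M)"
      by (subst nn_integral_distr) auto
  qed
  also have "\<dots> = (\<integral>\<^sup>+\<omega>. \<integral>\<^sup>+\<omega>'. g (X \<omega>) (Y \<omega>') \<partial>M \<partial>M)"
  proof -
    have "(\<lambda>p. (fst p, Y (snd p))) \<in> S \<Otimes>\<^sub>M M \<rightarrow>\<^sub>M S \<Otimes>\<^sub>M T" by measurable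
    from measurable_compose[OF this gm]
    have [measurable]: "(\<lambda>p. g (fst p) (Y (snd p))) \<in> borel_measurable (S \<Otimes>\<^sub>M M)" by simp
    have "(\<lambda>x. \<integral>\<^sup>+\<omega>'. g x (Y \<omega>') \<partial>M) \<in> borel_measurable S" by measurable
    then show ?thesis by (subst nn_integral_distr) simp_all
  qed
  finally show ?thesis .
qed

locale bounded_walk = prob_space M for M :: "'a measure" +
  fixes \<xi> :: "nat \<Rightarrow> 'a \<Rightarrow> real" and L v :: real
  assumes indep: "indep_vars (\<lambda>_. borel) \<xi> UNIV"
    and bounded: "\<And>k \<omega>. \<omega> \<in> space M \<Longrightarrow> \<bar>\<xi> k \<omega>\<bar> \<le> L"
    and mean: "\<And>k. expectation (\<xi> k) = 0"
    and var: "\<And>k. expectation (\<lambda>\<omega>. (\<xi> k \<omega>)\<^sup>2) = v"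
    and v_pos: "v > 0"
begin

lemma step_measurable [measurable]: "\<xi> k \<in> borel_measurable M"
  using indep unfolding indep_vars_def by auto

lemma L_nonneg: "0 \<le> L"
proof -
  obtain \<omega> where "\<omega> \<in> space M" using not_empty by blast
  then show ?thesis using bounded[of \<omega> 0] by linarith
qed

abbreviation steps :: "'a \<Rightarrow> nat \<Rightarrow> real" where "steps \<omega> \<equiv> \<lambda>k. \<xi> k \<omega>"

lemma nn_integral_next_step:
  assumes F: "(\<lambda>(s, y). F s y) \<in> N \<Otimes>\<^sub>M borel \<rightarrow>\<^sub>M N" and s0: "s0 \<in> space N"
    and g: "(\<lambda>(s, y). g s y) \<in> borel_measurable (N \<Otimes>\<^sub>M borel)"
  shows "(\<integral>\<^sup>+\<omega>. g (run F s0 (steps \<omega>) n) (\<xi> n \<omega>) \<partial>M) =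
    (\<integral>\<^sup>+\<omega>. \<integral>\<^sup>+\<omega>'. g (run F s0 (steps \<omega>) n) (\<xi> n \<omega>') \<partial>M \<partial>M)"
proof -
  let ?S = "PiM {..<n} (\<lambda>_. borel :: real measure)" and ?T = "PiM {n} (\<lambda>_. borel :: real measure)"
  have ind: "indep_var ?S (\<lambda>\<omega>. restrict (\<lambda>i. \<xi> i \<omega>) {..<n}) ?T (\<lambda>\<omega>. restrict (\<lambda>i. \<xi> i \<omega>) {n})"
    by (rule indep_var_restrict[OF indep]) auto
  have [measurable]: "(\<lambda>y. run F s0 y n) \<in> ?S \<rightarrow>\<^sub>M N"
    by (rule run_measurable[OF F s0]) (auto intro: measurable_component_singleton)
  have [measurable]: "(\<lambda>y. y n) \<in> ?T \<rightarrow>\<^sub>M borel"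
    by (rule measurable_component_singleton) simp
  have gm [measurable]: "(\<lambda>x. g (fst x) (snd x)) \<in> borel_measurable (N \<Otimes>\<^sub>M borel)"
    using g by (simp add: case_prod_beta')
  have meas: "(\<lambda>(x, y). g (run F s0 x n) (y n)) \<in> borel_measurable (?S \<Otimes>\<^sub>M ?T)"
  proof -
    have "(\<lambda>p. (run F s0 (fst p) n, snd p n)) \<in> ?S \<Otimes>\<^sub>M ?T \<rightarrow>\<^sub>M N \<Otimes>\<^sub>M borel" by measurable
    from measurable_compose[OF this gm] show ?thesis by (simp add: case_prod_beta')
  qed
  have "run F s0 (restrict (\<lambda>i. \<xi> i \<omega>) {..<n}) n = run F s0 (steps \<omega>) n" for \<omega>
    by (rule run_cong) simp
  then show ?thesis
    using nn_integral_indep[OF ind meas] by simp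
qed

text \<open>The expectation of \<open>\<Phi>\<close> along the run does not increase, and \<open>\<Phi>\<close> is at least \<open>1\<close> on \<open>B\<close>. Only mean and variance
of a step are given, so superharmonicity is expressed by a quadratic majorant in the step. The set \<open>I\<close> of legal
states records how far a bounded step can overshoot.\<close>

lemma superharmonic_bound:
  assumes F: "(\<lambda>(s, y). F s y) \<in> N \<Otimes>\<^sub>M borel \<rightarrow>\<^sub>M N" and s0: "s0 \<in> space N" "s0 \<in> I"
    and \<Phi>: "\<Phi> \<in> borel_measurable N" and B: "B \<in> sets N"
    and I: "\<And>s y. s \<in> I \<Longrightarrow> \<bar>y\<bar> \<le> L \<Longrightarrow> F s y \<in> I"
    and nonneg: "\<And>s. s \<in> I \<Longrightarrow> 0 \<le> \<Phi> s" and ge1: "\<And>s. s \<in> I \<Longrightarrow> s \<in> B \<Longrightarrow> 1 \<le> \<Phi> s"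
    and super: "\<And>s. s \<in> I \<Longrightarrow> \<exists>a b d. a + d * v \<le> \<Phi> s \<and> (\<forall>y. \<bar>y\<bar> \<le> L \<longrightarrow> \<Phi> (F s y) \<le> a + b * y + d * y\<^sup>2)"
  shows "prob {\<omega> \<in> space M. run F s0 (steps \<omega>) n \<in> B} \<le> \<Phi> s0"
proof -
  let ?r = "\<lambda>n \<omega>. run F s0 (steps \<omega>) n"
  have legal: "?r n \<omega> \<in> I" if "\<omega> \<in> space M" for n \<omega>
    by (induction n) (use that bounded I s0 in auto)
  have rm [measurable]: "?r n \<in> M \<rightarrow>\<^sub>M N" for n by (rule run_measurable[OF F s0(1)]) simp
  have Fm [measurable]: "(\<lambda>x. F (fst x) (snd x)) \<in> N \<Otimes>\<^sub>M borel \<rightarrow>\<^sub>M N"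
    using F by (simp add: case_prod_beta')
  have one_step: "(\<integral>\<^sup>+\<omega>. ennreal (\<Phi> (F s (\<xi> n \<omega>))) \<partial>M) \<le> ennreal (\<Phi> s)" if s: "s \<in> I" for s n
  proof -
    obtain a b d where d: "a + d * v \<le> \<Phi> s"
      and le: "\<And>y. \<bar>y\<bar> \<le> L \<Longrightarrow> \<Phi> (F s y) \<le> a + b * y + d * y\<^sup>2" using super[OF s] by blast
    have i1: "integrable M (\<xi> n)"
      using bounded by (intro integrable_const_bound[where B = L]) auto
    have i2: "integrable M (\<lambda>\<omega>. (\<xi> n \<omega>)\<^sup>2)"
      using bounded L_nonneg by (intro integrable_const_bound[where B = "L\<^sup>2"])
        (auto intro!: AE_I2 simp: abs_le_square_iff[symmetric] abs_of_nonneg)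
    have "(\<integral>\<^sup>+\<omega>. ennreal (\<Phi> (F s (\<xi> n \<omega>))) \<partial>M) \<le> (\<integral>\<^sup>+\<omega>. ennreal (a + b * \<xi> n \<omega> + d * (\<xi> n \<omega>)\<^sup>2) \<partial>M)"
      using bounded le by (intro nn_integral_mono ennreal_leI) auto
    also have "\<dots> = ennreal (\<integral>\<omega>. a + b * \<xi> n \<omega> + d * (\<xi> n \<omega>)\<^sup>2 \<partial>M)"
    proof (rule nn_integral_eq_integral)
      show "AE \<omega> in M. 0 \<le> a + b * \<xi> n \<omega> + d * (\<xi> n \<omega>)\<^sup>2"
        using bounded le nonneg I[OF s] by (intro AE_I2) (meson order_trans)
    qed (use i1 i2 in auto)
    also have "(\<integral>\<omega>. a + b * \<xi> n \<omega> + d * (\<xi> n \<omega>)\<^sup>2 \<partial>M) = a + d * v"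
      using i1 i2 by (simp add: mean var prob_space)
    finally show ?thesis using d by (meson ennreal_leI order_trans)
  qed
  have mono: "(\<integral>\<^sup>+\<omega>. ennreal (\<Phi> (?r n \<omega>)) \<partial>M) \<le> ennreal (\<Phi> s0)" for n
  proof (induction n)
    case 0
    show ?case by (simp add: emeasure_space_1)
  next
    case (Suc n)
    have "(\<integral>\<^sup>+\<omega>. ennreal (\<Phi> (?r (Suc n) \<omega>)) \<partial>M) =
        (\<integral>\<^sup>+\<omega>. \<integral>\<^sup>+\<omega>'. ennreal (\<Phi> (F (?r n \<omega>) (\<xi> n \<omega>'))) \<partial>M \<partial>M)"
      using nn_integral_next_step[OF F s0(1), of "\<lambda>s y. ennreal (\<Phi> (F s y))" n] \<Phi>
      by (simp add: case_prod_beta')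
    also have "\<dots> \<le> (\<integral>\<^sup>+\<omega>. ennreal (\<Phi> (?r n \<omega>)) \<partial>M)"
      by (intro nn_integral_mono one_step legal)
    finally show ?case using Suc.IH by (rule order_trans)
  qed
  have "emeasure M {\<omega> \<in> space M. ?r n \<omega> \<in> B} = (\<integral>\<^sup>+\<omega>. indicator {\<omega> \<in> space M. ?r n \<omega> \<in> B} \<omega> \<partial>M)"
    using B by (intro nn_integral_indicator[symmetric]) simp
  also have "\<dots> \<le> (\<integral>\<^sup>+\<omega>. ennreal (\<Phi> (?r n \<omega>)) \<partial>M)"
    using ge1 legal by (intro nn_integral_mono) (auto simp: indicator_def ennreal_leI[of 1, simplified])
  also note mono[of n]
  finally show ?thesis using nonneg[OF s0(2)] by (simp add: emeasure_eq_measure)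
qed


text \<open>Functions of position and time whose mean is preserved by one step: the span of \<open>1\<close>, \<open>x\<close> and \<open>v * t - x\<^sup>2\<close>.\<close>

definition space_time_harmonic :: "(real \<Rightarrow> real \<Rightarrow> real) \<Rightarrow> bool" where
  "space_time_harmonic G \<longleftrightarrow> (\<exists>g0 g1 g2. \<forall>x t. G x t = g0 + g1 * x + g2 * (v * t - x\<^sup>2))"

lemma space_time_harmonicI: "(\<And>x t. G x t = g0 + g1 * x + g2 * (v * t - x\<^sup>2)) \<Longrightarrow> space_time_harmonic G"
  unfolding space_time_harmonic_def by blast

lemma harmonic_const: "space_time_harmonic (\<lambda>x t. k)"
  by (rule space_time_harmonicI[of _ k 0 0]) simp

lemma harmonic_affine: "space_time_harmonic (\<lambda>x t. (x + k) / m)" "space_time_harmonic (\<lambda>x t. (k - x) / m)"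
  by (rule space_time_harmonicI[of _ "k / m" "1 / m" 0], simp add: add_divide_distrib)
     (rule space_time_harmonicI[of _ "k / m" "- 1 / m" 0], simp add: diff_divide_distrib)

lemma harmonic_time: "space_time_harmonic (\<lambda>x t. (v * t + k - x\<^sup>2) / m)"
  by (rule space_time_harmonicI[of _ "k / m" 0 "1 / m"]) (simp add: add_divide_distrib diff_divide_distrib)

lemma harmonic_add:
  assumes "space_time_harmonic F" "space_time_harmonic G"
  shows "space_time_harmonic (\<lambda>x t. F x t + G x t)"
proof -
  obtain f0 f1 f2 g0 g1 g2 where "\<And>x t. F x t = f0 + f1 * x + f2 * (v * t - x\<^sup>2)"
    "\<And>x t. G x t = g0 + g1 * x + g2 * (v * t - x\<^sup>2)"
    using assms unfolding space_time_harmonic_def by blast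
  then show ?thesis
    by (intro space_time_harmonicI[of _ "f0 + g0" "f1 + g1" "f2 + g2"]) (simp add: distrib_right)
qed

lemma harmonic_cmult:
  assumes "space_time_harmonic G"
  shows "space_time_harmonic (\<lambda>x t. k * G x t)"
proof -
  obtain g0 g1 g2 where "\<And>x t. G x t = g0 + g1 * x + g2 * (v * t - x\<^sup>2)"
    using assms unfolding space_time_harmonic_def by blast
  then show ?thesis
    by (intro space_time_harmonicI[of _ "k * g0" "k * g1" "k * g2"]) (simp add: distrib_left)
qed

lemma bounded_step:
  fixes f :: "real \<Rightarrow> real"
  assumes "k \<le> \<Phi>s" "\<And>y. \<bar>y\<bar> \<le> L \<Longrightarrow> f y \<le> k"
  shows "\<exists>a b d. a + d * v \<le> \<Phi>s \<and> (\<forall>y. \<bar>y\<bar> \<le> L \<longrightarrow> f y \<le> a + b * y + d * y\<^sup>2)"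
  using assms by (intro exI[of _ k] exI[of _ 0]) simp

lemma harmonic_step:
  assumes G: "space_time_harmonic G" and le: "G x t \<le> \<Phi>s"
    and step: "\<And>y. \<bar>y\<bar> \<le> L \<Longrightarrow> f y \<le> G (x + y) (t + 1)"
  shows "\<exists>a b d. a + d * v \<le> \<Phi>s \<and> (\<forall>y. \<bar>y\<bar> \<le> L \<longrightarrow> f y \<le> a + b * y + d * y\<^sup>2)"
proof -
  obtain g0 g1 g2 where g: "\<And>x t. G x t = g0 + g1 * x + g2 * (v * t - x\<^sup>2)"
    using G unfolding space_time_harmonic_def by blast
  have "G (x + y) (t + 1) = (G x t + g2 * v) + (g1 - 2 * g2 * x) * y + (- g2) * y\<^sup>2" for y
    unfolding g by (simp add: power2_eq_square algebra_simps)
  then show ?thesis using le step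
    by (intro exI[of _ "G x t + g2 * v"] exI[of _ "g1 - 2 * g2 * x"] exI[of _ "- g2"]) simp
qed

end

section \<open>Machines that follow the potential\<close>

definition psum :: "(nat \<Rightarrow> real) \<Rightarrow> nat \<Rightarrow> real" where
  "psum y k = (\<Sum>i<k. y i)"

lemma psum_simps [simp]: "psum y 0 = 0" "psum y (Suc k) = psum y k + y k"
  by (simp_all add: psum_def)

text \<open>The stages of a trial, in which the path is observed from its latest cutting point. A trial is \<open>Fresh\<close> while it is
young and stays near its start, and \<open>Climbing\<close> once it has left upwards in time. It is \<open>Tainted\<close> when it has
lasted too long near its start or has come back down. It is \<open>Near\<close> when a clean climb is about to
succeed, and then ends as \<open>Settled\<close> or \<open>Failed\<close>. \<open>Retry\<close> is a fresh trial whose predecessor was tainted: leaving upwards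
taints it too, but if it falls quickly then the next trial is clean again.\<close>

datatype stage = Fresh | Climbing | Tainted | Near | Retry | Failed | Settled

abbreviation "state_space \<equiv> count_space (UNIV :: stage set) \<Otimes>\<^sub>M (borel :: real measure) \<Otimes>\<^sub>M (borel :: real measure)"

text \<open>Observes whether the level \<open>H\<close> is reached by time \<open>r\<close> and before \<open>- A\<close>. The states of the trial machine are reused, with
position and clock as second and third component.\<close>

definition reach_step :: "real \<Rightarrow> real \<Rightarrow> real \<Rightarrow> stage \<times> real \<times> real \<Rightarrow> real \<Rightarrow> stage \<times> real \<times> real" where
  "reach_step H A r = (\<lambda>(k, x, s) y.
     if k = Fresh then
       if x + y \<ge> H then (Settled, 0, 0)
       else if x + y \<le> - A \<or> s + 1 \<ge> r then (Failed, 0, 0)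
       else (Fresh, x + y, s + 1)
     else (k, x, s))"

lemma reach_step_measurable: "(\<lambda>(s, y). reach_step H A r s y) \<in> state_space \<Otimes>\<^sub>M borel \<rightarrow>\<^sub>M state_space"
  unfolding reach_step_def case_prod_beta' by measurable

text \<open>The first component is the stage, the second the height above the cutting point, the third the clock, which
is of interest in the stages \<open>Fresh\<close> and \<open>Retry\<close> only.\<close>

definition trial_step :: "real \<Rightarrow> real \<Rightarrow> real \<Rightarrow> real \<Rightarrow> stage \<times> real \<times> real \<Rightarrow> real \<Rightarrow> stage \<times> real \<times> real" where
  "trial_step h c u w = (\<lambda>(k, x, s) y.
     if k = Fresh then
       if x + y \<le> - c then (Fresh, 0, 0)
       else if x + y \<ge> u then (Climbing, x + y, 0)
       else if s + 1 \<ge> w then (Tainted, x + y, 0)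
       else (Fresh, x + y, s + 1)
     else if k = Climbing then
       if x + y \<le> c then (Tainted, x + y, 0)
       else if x + y \<ge> h - 2 * c then (Near, x + y, 0)
       else (Climbing, x + y, 0)
     else if k = Tainted then
       if x + y \<le> - c then (Retry, 0, 0)
       else if x + y \<ge> h - 2 * c then (Failed, 0, 0)
       else (Tainted, x + y, 0)
     else if k = Near then
       if x + y \<le> c then (Failed, 0, 0)
       else if x + y \<ge> h + c then (Settled, 0, 0)
       else (Near, x + y, 0)
     else if k = Retry then
       if x + y \<le> - c then (Fresh, 0, 0)
       else if x + y \<ge> u \<or> s + 1 \<ge> w then (Tainted, x + y, 0)
       else (Retry, x + y, s + 1)
     else (k, x, s))"

lemma trial_step_measurable: "(\<lambda>(s, y). trial_step h c u w s y) \<in> state_space \<Otimes>\<^sub>M borel \<rightarrow>\<^sub>M state_space"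
  unfolding trial_step_def case_prod_beta' by measurable

text \<open>Position, running minimum and running maximum, frozen as soon as the position is \<open>h\<close> above the
running minimum.\<close>

definition drawup_step :: "real \<Rightarrow> real \<times> real \<times> real \<Rightarrow> real \<Rightarrow> real \<times> real \<times> real" where
  "drawup_step h = (\<lambda>(x, lo, hi) y.
     if x - lo \<ge> h then (x, lo, hi) else (x + y, min lo (x + y), max hi (x + y)))"

lemma drawup_step_measurable: "(\<lambda>(s, y). drawup_step h s y) \<in> 
   (borel \<Otimes>\<^sub>M borel \<Otimes>\<^sub>M borel) \<Otimes>\<^sub>M borel \<rightarrow>\<^sub>M borel \<Otimes>\<^sub>M borel \<Otimes>\<^sub>M borel"
  unfolding drawup_step_def case_prod_beta' by measurable

section \<open>Reaching a level, and the maximum before a large rise\<close>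

lemma elapsed_nonneg:
  assumes "\<bar>x\<bar> \<le> W" "0 \<le> s" "v > 0" "r > (0::real)"
  shows "0 \<le> (v * s + W\<^sup>2 - x\<^sup>2) / (v * r)"
proof -
  have "x\<^sup>2 \<le> W\<^sup>2" using assms(1) abs_le_square_iff[of x W] by simp
  moreover have "0 \<le> v * s" using assms by simp
  ultimately have "0 \<le> v * s + W\<^sup>2 - x\<^sup>2" by linarith
  then show ?thesis using assms by (intro divide_nonneg_pos) simp_all
qed

lemma elapsed_ge_1:
  assumes "\<bar>x\<bar> \<le> W" "r \<le> s" "v > 0" "r > (0::real)"
  shows "1 \<le> (v * s + W\<^sup>2 - x\<^sup>2) / (v * r)"
proof -
  have "x\<^sup>2 \<le> W\<^sup>2" using assms(1) abs_le_square_iff[of x W] by simp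
  moreover have "v * r \<le> v * s" using assms by simp
  ultimately have "v * r \<le> v * s + W\<^sup>2 - x\<^sup>2" by linarith
  then show ?thesis using assms by (subst le_divide_eq_1_pos) simp_all
qed

lemma run_reach_step:
  assumes "run (reach_step H A (real r)) (Fresh, 0, 0) y n = (k, x, s)" "r > 0"
  shows "(k = Fresh \<longrightarrow> x = psum y n \<and> s = real n \<and> n < r) \<and> k \<in> {Fresh, Failed, Settled} \<and>
    (k = Settled \<longrightarrow> (\<exists>j\<le>n. psum y j \<ge> H))"
  using assms(1)
proof (induction n arbitrary: k x s)
  case 0
  then show ?case using assms(2) by auto
next
  case (Suc n)
  obtain k' x' s' where st: "run (reach_step H A (real r)) (Fresh, 0, 0) y n = (k', x', s')"
    by (metis prod_cases3)
  have eq: "reach_step H A (real r) (k', x', s') (y n) = (k, x, s)" using Suc.prems st by simp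
  show ?case
  proof (cases "k' = Fresh")
    case True
    then have "x' = psum y n" "s' = real n" using Suc.IH[OF st] by auto
    then have fs: "x' + y n = psum y (Suc n)" "s' + 1 = real (Suc n)" by auto
    show ?thesis
      using eq True fs unfolding reach_step_def by (auto split: if_splits intro: exI[of _ "Suc n"])
  next
    case False
    then have "k = k'" using eq by (simp add: reach_step_def)
    then show ?thesis using Suc.IH[OF st] False le_SucI by blast
  qed
qed

context bounded_walk begin

text \<open>Gambler's ruin against the level \<open>- A\<close>, plus Markov's inequality for the exit time from the interval between \<open>- A\<close> and \<open>H\<close>. A
large \<open>A\<close> makes the first summand small, and then a larger \<open>r\<close> the second.\<close>

lemma reach_bound:
  assumes HA: "0 < H" "H \<le> A" and r: "r > 0"
  shows "prob {\<omega> \<in> space M. \<forall>j\<le>r. psum (steps \<omega>) j < H} \<le> (H + L) / (A + H + L) + (A + L)\<^sup>2 / (v * real r)"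
proof -
  define F where "F = reach_step H A (real r)"
  define G where "G x s = (H + L - x) / (A + H + L) + (v * s + (A + L)\<^sup>2 - x\<^sup>2) / (v * real r)" for x s
  define \<Phi> :: "stage \<times> real \<times> real \<Rightarrow> real" where "\<Phi> = (\<lambda>(k, x, s).
    if k = Fresh then G x s else if k = Failed then 1 else 0)"
  define I :: "(stage \<times> real \<times> real) set" where
    "I = {(k, x, s). k = Fresh \<longrightarrow> - A < x \<and> x < H \<and> 0 \<le> s \<and> s < r}"
  define B :: "(stage \<times> real \<times> real) set" where "B = {Failed} \<times> UNIV \<times> UNIV"
  note r' = \<open>r > 0\<close>[folded of_nat_0_less_iff[where 'a = real]]
  have G: "space_time_harmonic G"
    unfolding G_def by (intro harmonic_add harmonic_affine harmonic_time)
  have G0: "0 \<le> G x s" if "- A - L \<le> x" "x \<le> H + L" "0 \<le> s" for x s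
    unfolding G_def using that HA L_nonneg v_pos r'
    by (intro add_nonneg_nonneg divide_nonneg_pos elapsed_nonneg) auto
  have "prob {\<omega> \<in> space M. run F (Fresh, 0, 0) (steps \<omega>) r \<in> B} \<le> \<Phi> (Fresh, 0, 0)"
  proof (rule superharmonic_bound)
    show "(\<lambda>(s, y). F s y) \<in> state_space \<Otimes>\<^sub>M borel \<rightarrow>\<^sub>M state_space"
      unfolding F_def by (rule reach_step_measurable)
    show "\<Phi> \<in> borel_measurable state_space"
      unfolding \<Phi>_def G_def case_prod_beta' by measurable
    show "(Fresh, 0, 0) \<in> space state_space" by (simp add: space_pair_measure)
    show "(Fresh, 0, 0) \<in> I" using HA r' by (simp add: I_def)
    show "B \<in> sets state_space" unfolding B_def by (intro pair_measureI) auto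
    show "F s y \<in> I" if "s \<in> I" for s y
      using that r' by (auto simp: F_def reach_step_def I_def split: if_splits)
    show "0 \<le> \<Phi> s" if "s \<in> I" for s
      using that L_nonneg by (auto simp: \<Phi>_def I_def intro!: G0)
    show "1 \<le> \<Phi> s" if "s \<in> I" "s \<in> B" for s
      using that by (auto simp: \<Phi>_def B_def)
    show "\<exists>a b d. a + d * v \<le> \<Phi> s \<and> (\<forall>y. \<bar>y\<bar> \<le> L \<longrightarrow> \<Phi> (F s y) \<le> a + b * y + d * y\<^sup>2)" if s: "s \<in> I" for s
    proof -
      obtain k x t where st: "s = (k, x, t)" by (metis prod_cases3)
      show ?thesis
      proof (cases "k = Fresh")
        case True
        then have xt: "- A < x" "x < H" "0 \<le> t" "t < r" using s by (auto simp: I_def st)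
        show ?thesis
        proof (rule harmonic_step[OF G])
          show "G x t \<le> \<Phi> s" by (simp add: \<Phi>_def st True)
          fix y assume y: "\<bar>y\<bar> \<le> L"
          have nn: "0 \<le> G (x + y) (t + 1)" using xt y by (intro G0) linarith+
          consider "x + y \<ge> H" | "x + y < H" "x + y \<le> - A" | "- A < x + y" "x + y < H" "t + 1 \<ge> r"
            | "- A < x + y" "x + y < H" "t + 1 < r" by linarith
          then show "\<Phi> (F s y) \<le> G (x + y) (t + 1)"
          proof cases
            case 2
            have "1 \<le> (H + L - (x + y)) / (A + H + L)"
              using 2 HA L_nonneg by (subst le_divide_eq_1_pos) auto
            moreover have "0 \<le> (v * (t + 1) + (A + L)\<^sup>2 - (x + y)\<^sup>2) / (v * real r)"
              using xt y HA r' v_pos by (intro elapsed_nonneg) auto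
            ultimately show ?thesis using 2 by (simp add: \<Phi>_def F_def reach_step_def st True G_def)
          next
            case 3
            have "0 \<le> (H + L - (x + y)) / (A + H + L)"
              using 3 HA L_nonneg by (intro divide_nonneg_pos) auto
            moreover have "1 \<le> (v * (t + 1) + (A + L)\<^sup>2 - (x + y)\<^sup>2) / (v * real r)"
              using xt y 3 HA r' v_pos by (intro elapsed_ge_1) auto
            ultimately show ?thesis using 3 by (simp add: \<Phi>_def F_def reach_step_def st True G_def)
          qed (use nn in \<open>simp_all add: \<Phi>_def F_def reach_step_def st True\<close>)
        qed
      next
        case False
        show ?thesis
          by (rule bounded_step[OF order_refl])
            (use False in \<open>auto simp: \<Phi>_def F_def reach_step_def st\<close>)
      qed
    qed
  qed
  moreover have "{\<omega> \<in> space M. \<forall>j\<le>r. psum (steps \<omega>) j < H} \<subseteq> {\<omega> \<in> space M. run F (Fresh, 0, 0) (steps \<omega>) r \<in> B}"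
  proof safe
    fix \<omega> assume \<omega>: "\<forall>j\<le>r. psum (steps \<omega>) j < H"
    obtain k x s where st: "run F (Fresh, 0, 0) (steps \<omega>) r = (k, x, s)" by (metis prod_cases3)
    have "k = Failed" using run_reach_step[OF st[unfolded F_def] r] \<omega> by (auto simp: not_less[symmetric])
    then show "run F (Fresh, 0, 0) (steps \<omega>) r \<in> B" by (simp add: st B_def)
  qed
  moreover have "{\<omega> \<in> space M. run F (Fresh, 0, 0) (steps \<omega>) r \<in> B} \<in> events"
  proof -
    have [measurable]: "(\<lambda>\<omega>. run F (Fresh, 0, 0) (steps \<omega>) r) \<in> M \<rightarrow>\<^sub>M state_space"
      unfolding F_def by (rule run_measurable[OF reach_step_measurable]) (simp_all add: space_pair_measure)
    have [measurable]: "B \<in> sets state_space" unfolding B_def by (intro pair_measureI) auto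
    show ?thesis by measurable
  qed
  ultimately show ?thesis
    using finite_measure_mono[of "{\<omega> \<in> space M. \<forall>j\<le>r. psum (steps \<omega>) j < H}" "{\<omega> \<in> space M. run F (Fresh, 0, 0) (steps \<omega>) r \<in> B}"]
    by (simp add: \<Phi>_def G_def)
qed

text \<open>The maximum up to the first rise by \<open>h\<close> is spread out over the scale \<open>h\<close>. For it to fall between \<open>z\<close> and
\<open>z + \<eta>\<close> one of two unlikely things must happen. Either the running minimum is already below
\<open>z + \<eta> - h\<close> when the path reaches \<open>z\<close>, so the path came back from there to \<open>z\<close> without going down by a further \<open>\<eta> + L\<close>; or
after reaching \<open>z\<close> the path falls by nearly \<open>h\<close> before it gains another \<open>\<eta>\<close>.\<close>

lemma drawup_bound:
  assumes h: "0 < \<eta>" "\<eta> < h"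
  shows "prob {\<omega> \<in> space M. case run (drawup_step h) (0, 0, 0) (steps \<omega>) n of (x, lo, hi) \<Rightarrow> x - lo \<ge> h \<and> z \<le> hi \<and> hi < z + \<eta>}
    \<le> (\<eta> + 2 * L) / (h + L)"
proof -
  define q where "q = (\<eta> + 2 * L) / (h + L)"
  have hL: "0 < h + L" using h L_nonneg by linarith
  have q0: "0 \<le> q" unfolding q_def using h L_nonneg by simp
  let ?N = "borel \<Otimes>\<^sub>M borel \<Otimes>\<^sub>M borel :: (real \<times> real \<times> real) measure"
  \<comment> \<open>The cases, in order: \<open>z + \<eta>\<close> has been passed; the path is frozen; \<open>z\<close> has been reached and the minimum is high or
    low; \<open>z\<close> is ahead and the minimum is too low for harm, dangerously low, or high.\<close>
  define \<Phi> :: "real \<times> real \<times> real \<Rightarrow> real" where "\<Phi> = (\<lambda>(x, lo, hi).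
    if hi \<ge> z + \<eta> then 0
    else if x - lo \<ge> h then (if z \<le> hi then 1 else 0)
    else if z \<le> hi then (if lo > z + \<eta> - h then (z + \<eta> + L - x) / (h + L) else 1)
    else if lo \<le> z - h - L then 0
    else if lo \<le> z + \<eta> - h then (x + (2 * L + h - z)) / (h + L)
    else q)"
  define I :: "(real \<times> real \<times> real) set" where "I = {(x, lo, hi). lo \<le> x \<and> x \<le> hi}"
  define B :: "(real \<times> real \<times> real) set" where "B = {s. fst s - fst (snd s) \<ge> h \<and> z \<le> snd (snd s) \<and> snd (snd s) < z + \<eta>}"
  have "prob {\<omega> \<in> space M. run (drawup_step h) (0, 0, 0) (steps \<omega>) n \<in> B} \<le> \<Phi> (0, 0, 0)"
  proof (rule superharmonic_bound)
    show "(\<lambda>(s, y). drawup_step h s y) \<in> ?N \<Otimes>\<^sub>M borel \<rightarrow>\<^sub>M ?N" by (rule drawup_step_measurable)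
    show "\<Phi> \<in> borel_measurable ?N" unfolding \<Phi>_def case_prod_beta' by measurable
    show "B \<in> sets ?N"
    proof -
      have "{s \<in> space ?N. fst s - fst (snd s) \<ge> h \<and> z \<le> snd (snd s) \<and> snd (snd s) < z + \<eta>} \<in> sets ?N" by measurable
      then show ?thesis by (simp add: B_def space_pair_measure)
    qed
    show "(0, 0, 0) \<in> space ?N" by (simp add: space_pair_measure)
    show "(0, 0, 0) \<in> I" by (simp add: I_def)
    show "drawup_step h s y \<in> I" if "s \<in> I" for s y
      using that by (auto simp: I_def drawup_step_def split: if_splits)
    show "0 \<le> \<Phi> s" if "s \<in> I" for s
      using that hL q0 L_nonneg by (auto simp: \<Phi>_def I_def)
    show "1 \<le> \<Phi> s" if "s \<in> I" "s \<in> B" for s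
      using that by (auto simp: \<Phi>_def B_def split_beta)
    show "\<exists>a b d. a + d * v \<le> \<Phi> s \<and> (\<forall>y. \<bar>y\<bar> \<le> L \<longrightarrow> \<Phi> (drawup_step h s y) \<le> a + b * y + d * y\<^sup>2)" if s: "s \<in> I" for s
    proof -
      obtain x lo hi where st: "s = (x, lo, hi)" by (metis prod_cases3)
      have xs: "lo \<le> x" "x \<le> hi" using s by (auto simp: I_def st)
      note frac = le_divide_eq_1_pos[OF hL] divide_right_mono[OF _ less_imp_le[OF hL]] divide_nonneg_pos[OF _ hL]
      consider "x - lo \<ge> h" | "x - lo < h" "hi \<ge> z + \<eta>" | "x - lo < h" "z \<le> hi" "hi < z + \<eta>" "lo > z + \<eta> - h"
        | "x - lo < h" "z \<le> hi" "hi < z + \<eta>" "lo \<le> z + \<eta> - h"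
        | "x - lo < h" "hi < z" "lo \<le> z - h - L"
        | "x - lo < h" "hi < z" "z - h - L < lo" "lo \<le> z + \<eta> - h"
        | "x - lo < h" "hi < z" "lo > z + \<eta> - h" "z - h - L < lo" 
        using h L_nonneg by linarith
      then show ?thesis
      proof cases
        case 1
        show ?thesis
          by (rule bounded_step[OF order_refl])
            (use 1 in \<open>auto simp: drawup_step_def st\<close>)
      next
        case 2
        show ?thesis
          by (rule bounded_step[OF order_refl])
            (use 2 h in \<open>auto simp: drawup_step_def st \<Phi>_def max_def\<close>)
      next
        case 3
        show ?thesis
        proof (rule harmonic_step[OF harmonic_affine(2)[of "z + \<eta> + L" "h + L"], where x = x])
          show "(z + \<eta> + L - x) / (h + L) \<le> \<Phi> s" using 3 by (simp add: \<Phi>_def st)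
          fix y assume y: "\<bar>y\<bar> \<le> L"
          have 0: "0 \<le> (z + \<eta> + L - (x + y)) / (h + L)" using y xs 3 by (intro frac) linarith
          have 1: "x + y \<le> z + \<eta> - h \<Longrightarrow> 1 \<le> (z + \<eta> + L - (x + y)) / (h + L)" unfolding frac(1) by linarith
          show "\<Phi> (drawup_step h s y) \<le> (z + \<eta> + L - (x + y)) / (h + L)"
            using 3 h 0 1 by (auto simp: drawup_step_def st \<Phi>_def min_def max_def not_le)
        qed
      next
        case 4
        show ?thesis
          by (rule bounded_step[OF order_refl])
            (use 4 h in \<open>auto simp: drawup_step_def st \<Phi>_def min_def max_def\<close>)
      next
        case 5
        show ?thesis
          by (rule bounded_step[OF order_refl])
            (use 5 h in \<open>auto simp: drawup_step_def st \<Phi>_def min_def max_def\<close>)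
      next
        case 6
        show ?thesis
        proof (rule harmonic_step[OF harmonic_affine(1)[of "2 * L + h - z" "h + L"], where x = x])
          show "(x + (2 * L + h - z)) / (h + L) \<le> \<Phi> s" using 6 h by (simp add: \<Phi>_def st)
          fix y assume y: "\<bar>y\<bar> \<le> L"
          have 0: "0 \<le> (x + y + (2 * L + h - z)) / (h + L)" using y xs 6 by (intro frac) linarith
          have 1: "z \<le> x + y \<Longrightarrow> 1 \<le> (x + y + (2 * L + h - z)) / (h + L)" unfolding frac(1) using L_nonneg by linarith
          show "\<Phi> (drawup_step h s y) \<le> (x + y + (2 * L + h - z)) / (h + L)"
            using 6 h 0 1 by (auto simp: drawup_step_def st \<Phi>_def min_def max_def not_le)
        qed
      next
        case 7
        show ?thesis
        proof (rule bounded_step[where k = q and f = "\<lambda>y. \<Phi> (drawup_step h s y)"])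
          show "q \<le> \<Phi> s" using 7 h by (simp add: \<Phi>_def st)
          fix y assume y: "\<bar>y\<bar> \<le> L"
          have 1: "z \<le> x + y \<Longrightarrow> (z + \<eta> + L - (x + y)) / (h + L) \<le> q"
            unfolding q_def using L_nonneg by (intro frac) linarith
          have 2: "x + y \<le> z + \<eta> - h \<Longrightarrow> (x + y + (2 * L + h - z)) / (h + L) \<le> q"
            unfolding q_def by (intro frac) linarith
          show "\<Phi> (drawup_step h s y) \<le> q"
            using 7 h 1 2 q0 by (auto simp: drawup_step_def st \<Phi>_def min_def max_def not_le)
        qed
      qed
    qed
  qed
  also have "\<Phi> (0, 0, 0) \<le> q"
    unfolding \<Phi>_def q_def using h L_nonneg by (auto intro!: divide_right_mono)
  finally show ?thesis unfolding q_def B_def by (simp add: case_prod_beta')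
qed

end

section \<open>The cost of an unstable trial\<close>

context bounded_walk begin

text \<open>The superharmonic function has the value \<open>p\<close> at the start of a clean trial and \<open>p + \<delta>\<close> at the start of a
retry. Its pieces use bounds on the following probabilities, seen from height \<open>x\<close>: \<open>ell\<close> for a rise to
\<open>h - 2 * c\<close>, \<open>fail\<close> for another fall to \<open>- c\<close>, \<open>top\<close> for a rise to \<open>u\<close>, \<open>T\<close> for exceeding the time \<open>w\<close>, and \<open>near\<close> for a
relapse of an almost successful trial. The last inequality on \<open>p\<close> is the geometric series: the cost
\<open>q * top + 3 * lm * T\<close> of a single trial is at most \<open>p\<close> times \<open>c / (h + 2 * c + L)\<close>, a lower bound for its probability of success.\<close>

lemma trial_bound_abstract:
  fixes h c u \<delta> q p :: real and w :: nat
  assumes c: "L \<le> c" "0 < c" and u: "2 * c \<le> u" "u + 2 * c + L \<le> h" and w: "w > 0"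
  defines "lm \<equiv> (u + c + 2 * L) / (h - c + L)" and "T0 \<equiv> (u + L)\<^sup>2 / (v * real w)"
  assumes \<delta>: "0 \<le> \<delta>" "\<delta> \<le> lm" "(lm + \<delta>) * ((c + L) / (u + c + L) + T0) \<le> \<delta>"
    and q: "2 * ((2 * c + L) / (h - c + L)) + \<delta> \<le> q" "(3 * c + L) / (h + L) \<le> q"
    and p: "0 \<le> p" "p \<le> 1" "q * ((c + L) / (u + c + L)) + 3 * lm * T0 \<le> p * (c / (h + 2 * c + L))"
  shows "prob {\<omega> \<in> space M. fst (run (trial_step h c u (real w)) (Fresh, 0, 0) (steps \<omega>) n) = Failed} \<le> p"
proof -
  note r' = \<open>w > 0\<close>[folded of_nat_0_less_iff[where 'a = real]]
  have pos: "0 < h - c + L" "0 < u + c + L" "0 < h + 2 * c + L" "0 < h + L" using c u L_nonneg by linarith+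
  define ell where "ell x = (x + (c + L)) / (h - c + L)" for x
  define fail where "fail x = ((h + c + L) - x) / (h + 2 * c + L)" for x
  define T where "T x s = (v * s + (u + L)\<^sup>2 - x\<^sup>2) / (v * real w)" for x s
  define top where "top x = (x + (c + L)) / (u + c + L)" for x
  define near where "near x = ((h + c + L) - x) / (h + L)" for x
  define fresh where "fresh x s = q * top x + 3 * lm * T x s + p * fail x" for x s
  define retry where "retry x s = (p + (lm + \<delta>) * top x) + (lm + \<delta>) * T x s" for x s
  have hT: "space_time_harmonic T" unfolding T_def by (rule harmonic_time)
  have haff: "space_time_harmonic (\<lambda>x s. ell x)" "space_time_harmonic (\<lambda>x s. fail x)"
    "space_time_harmonic (\<lambda>x s. top x)" "space_time_harmonic (\<lambda>x s. near x)"
    unfolding ell_def fail_def top_def near_def by (rule harmonic_affine)+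
  have lm: "0 \<le> lm" unfolding lm_def using c u L_nonneg pos by (intro divide_nonneg_pos) auto
  have q0: "0 \<le> q" using q(2) c L_nonneg pos by (meson divide_nonneg_pos order_trans add_nonneg_nonneg less_imp_le mult_nonneg_nonneg zero_le_numeral)
  have ell_nonneg: "0 \<le> ell x" if "- c - L \<le> x" for x
    unfolding ell_def using that pos by (intro divide_nonneg_pos) auto
  have ell_ge1: "1 \<le> ell x" if "h - 2 * c \<le> x" for x
    unfolding ell_def using that pos by (subst le_divide_eq_1_pos) auto
  have ell_le: "ell x \<le> lm" if "x \<le> u + L" for x
    unfolding ell_def lm_def using that pos by (intro divide_right_mono) auto
  define e1 where "e1 = (2 * c + L) / (h - c + L)"
  have e1: "0 \<le> e1" unfolding e1_def using c pos L_nonneg by (intro divide_nonneg_pos) auto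
  have q1: "2 * e1 + \<delta> \<le> q" using q(1) by (simp only: e1_def)
  have ell_c: "ell x \<le> e1" if "x \<le> c" for x
    unfolding ell_def e1_def using that pos by (intro divide_right_mono) auto
  have fail_nonneg: "0 \<le> fail x" if "x \<le> h + c + L" for x
    unfolding fail_def using that pos by (intro divide_nonneg_pos) auto
  have fail_ge1: "1 \<le> fail x" if "x \<le> - c" for x
    unfolding fail_def using that pos by (subst le_divide_eq_1_pos) auto
  have fail_eq: "1 - fail x = (x + c) / (h + 2 * c + L)" for x
    unfolding fail_def using pos by (simp add: field_simps)
  have fail_ell: "1 - fail x \<le> ell x" if "- c \<le> x" for x
    unfolding fail_eq ell_def using that c L_nonneg pos by (intro frac_le) auto
  have p_fail: "p - k \<le> p * fail x" if "1 - fail x \<le> k" "0 \<le> k" for x k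
  proof -
    have "p * (1 - fail x) \<le> p * k" using that p by (intro mult_left_mono) auto
    also have "\<dots> \<le> 1 * k" using that p by (intro mult_right_mono) auto
    finally show ?thesis by (simp add: algebra_simps)
  qed
  have top_nonneg: "0 \<le> top x" if "- c - L \<le> x" for x
    unfolding top_def using that pos by (intro divide_nonneg_pos) auto
  have top_ge1: "1 \<le> top x" if "u \<le> x" for x
    unfolding top_def using that pos by (subst le_divide_eq_1_pos) auto
  have T_nonneg: "0 \<le> T x s" if "- c - L \<le> x" "x \<le> u + L" "0 \<le> s" for x s
    unfolding T_def using that c u v_pos r' by (intro elapsed_nonneg) auto
  have T_ge1: "1 \<le> T x s" if "- c - L \<le> x" "x \<le> u + L" "real w \<le> s" for x s
    unfolding T_def using that c u v_pos r' by (intro elapsed_ge_1) auto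
  have near_nonneg: "0 \<le> near x" if "x \<le> h + c + L" for x
    unfolding near_def using that pos by (intro divide_nonneg_pos) auto
  have near_ge1: "1 \<le> near x" if "x \<le> c" for x
    unfolding near_def using that pos by (subst le_divide_eq_1_pos) auto
  have near_le: "near x \<le> q" if "h - 2 * c \<le> x" for x
    by (rule order_trans[OF _ q(2)]) (unfold near_def, use that pos in \<open>intro divide_right_mono, auto\<close>)
  have fresh_start: "fresh 0 0 \<le> p"
  proof -
    have "fail 0 = 1 - c / (h + 2 * c + L)" using fail_eq[of 0] by simp
    then have "p * fail 0 = p - p * (c / (h + 2 * c + L))" by (simp only: right_diff_distrib mult_1_right)
    then show ?thesis using p(3) by (simp add: fresh_def top_def T_def T0_def)
  qed
  have retry_start: "retry 0 0 \<le> p + \<delta>"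
    using \<delta>(3) by (simp add: retry_def top_def T_def T0_def distrib_left)
  define \<Phi> :: "stage \<times> real \<times> real \<Rightarrow> real" where "\<Phi> = (\<lambda>(k, x, s).
    if k = Fresh then fresh x s
    else if k = Climbing then q + p * fail x
    else if k = Tainted then ell x + (p + \<delta>)
    else if k = Near then near x
    else if k = Retry then retry x s
    else if k = Failed then 1 else 0)"
  define I :: "(stage \<times> real \<times> real) set" where
    "I = {(k, x, s). (k = Fresh \<or> k = Retry \<longrightarrow> - c < x \<and> x < u \<and> 0 \<le> s) \<and>
      (k = Climbing \<longrightarrow> c < x \<and> x < h - 2 * c) \<and> (k = Tainted \<longrightarrow> - c < x \<and> x < h - 2 * c) \<and>
      (k = Near \<longrightarrow> c < x \<and> x < h + c)}"
  let ?F = "trial_step h c u (real w)"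
  have "prob {\<omega> \<in> space M. run ?F (Fresh, 0, 0) (steps \<omega>) n \<in> {Failed} \<times> UNIV \<times> UNIV} \<le> \<Phi> (Fresh, 0, 0)"
  proof (rule superharmonic_bound)
    show "(\<lambda>(s, y). ?F s y) \<in> state_space \<Otimes>\<^sub>M borel \<rightarrow>\<^sub>M state_space" by (rule trial_step_measurable)
    show "\<Phi> \<in> borel_measurable state_space"
      unfolding \<Phi>_def fresh_def retry_def ell_def fail_def top_def T_def near_def case_prod_beta' by measurable
    show "(Fresh, 0, 0) \<in> space state_space" by (simp add: space_pair_measure)
    show "(Fresh, 0, 0) \<in> I" using c u by (simp add: I_def)
    show "{Failed} \<times> UNIV \<times> UNIV \<in> sets state_space" by (intro pair_measureI) auto
    show "?F s y \<in> I" if "s \<in> I" "\<bar>y\<bar> \<le> L" for s y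
    proof -
      obtain k x t where st: "s = (k, x, t)" by (metis prod_cases3)
      show ?thesis using that c u L_nonneg
        by (cases k) (auto simp: trial_step_def I_def st)
    qed
    show "0 \<le> \<Phi> s" if s: "s \<in> I" for s
    proof -
      obtain k x t where st: "s = (k, x, t)" by (metis prod_cases3)
      show ?thesis
      proof (cases k)
        case Fresh
        then show ?thesis using s c u L_nonneg q0 lm p
          by (auto simp: \<Phi>_def st I_def fresh_def intro!: add_nonneg_nonneg mult_nonneg_nonneg top_nonneg T_nonneg fail_nonneg)
      next
        case Climbing
        then show ?thesis using s c u L_nonneg q0 p
          by (auto simp: \<Phi>_def st I_def intro!: add_nonneg_nonneg mult_nonneg_nonneg fail_nonneg)
      next
        case Tainted
        then show ?thesis using s c u L_nonneg \<delta> p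
          by (auto simp: \<Phi>_def st I_def intro!: add_nonneg_nonneg ell_nonneg)
      next
        case Near
        then show ?thesis using s c u L_nonneg
          by (auto simp: \<Phi>_def st I_def intro!: near_nonneg)
      next
        case Retry
        then show ?thesis using s c u L_nonneg lm \<delta> p
          by (auto simp: \<Phi>_def st I_def retry_def intro!: add_nonneg_nonneg mult_nonneg_nonneg top_nonneg T_nonneg)
      qed (simp_all add: \<Phi>_def st)
    qed
    show "1 \<le> \<Phi> s" if "s \<in> I" "s \<in> {Failed} \<times> UNIV \<times> UNIV" for s
      using that by (auto simp: \<Phi>_def)
    show "\<exists>a b d. a + d * v \<le> \<Phi> s \<and> (\<forall>y. \<bar>y\<bar> \<le> L \<longrightarrow> \<Phi> (?F s y) \<le> a + b * y + d * y\<^sup>2)" if s: "s \<in> I" for s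
    proof -
      obtain k x t where st: "s = (k, x, t)" by (metis prod_cases3)
      show ?thesis
      proof (cases k)
        case k: Fresh
        have xt: "- c < x" "x < u" "0 \<le> t" using s by (auto simp: I_def st k)
        have G: "space_time_harmonic fresh"
          unfolding fresh_def by (intro harmonic_add harmonic_cmult hT haff)
        show ?thesis
        proof (rule harmonic_step[OF G])
          show "fresh x t \<le> \<Phi> s" by (simp add: \<Phi>_def st k)
          fix y assume y: "\<bar>y\<bar> \<le> L"
          define x' where "x' = x + y"
          have x': "- c - L \<le> x'" "x' \<le> u + L" unfolding x'_def using xt y by linarith+
          have tn: "0 \<le> q * top x'" "0 \<le> 3 * lm * T x' (t + 1)"
            using x' xt q0 lm by (auto intro!: mult_nonneg_nonneg top_nonneg T_nonneg)
          consider "x' \<le> - c" | "- c < x'" "u \<le> x'" | "- c < x'" "x' < u" "t + 1 \<ge> w" | "- c < x'" "x' < u" "t + 1 < w" by linarith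
          then show "\<Phi> (?F s y) \<le> fresh (x + y) (t + 1)"
          proof cases
            case 1
            have "p * 1 \<le> p * fail x'" using fail_ge1[OF 1] p by (intro mult_left_mono) auto
            then show ?thesis using 1 fresh_start tn
              by (simp add: \<Phi>_def st k trial_step_def x'_def[symmetric] fresh_def)
          next
            case 2
            have "q * 1 \<le> q * top x'" using top_ge1[OF 2(2)] q0 by (intro mult_left_mono) auto
            then show ?thesis using 2 tn
              by (simp add: \<Phi>_def st k trial_step_def x'_def[symmetric] fresh_def)
          next
            case 3
            have "3 * lm * 1 \<le> 3 * lm * T x' (t + 1)"
              using T_ge1[OF x', of "t + 1"] 3 lm by (intro mult_left_mono) auto
            moreover have "p - lm \<le> p * fail x'"
              using fail_ell[of x'] ell_le[of x'] 3 x' lm by (intro p_fail) auto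
            ultimately show ?thesis using 3 tn ell_le[OF x'(2)] \<delta>
              by (simp add: \<Phi>_def st k trial_step_def x'_def[symmetric] fresh_def)
          next
            case 4
            then show ?thesis by (simp add: \<Phi>_def st k trial_step_def x'_def[symmetric])
          qed
        qed
      next
        case k: Climbing
        have xt: "c < x" "x < h - 2 * c" using s by (auto simp: I_def st k)
        have G: "space_time_harmonic (\<lambda>x s. q + p * fail x)"
          by (intro harmonic_add harmonic_cmult harmonic_const haff)
        show ?thesis
        proof (rule harmonic_step[OF G])
          show "q + p * fail x \<le> \<Phi> s" by (simp add: \<Phi>_def st k)
          fix y assume y: "\<bar>y\<bar> \<le> L"
          define x' where "x' = x + y"
          have x': "c - L \<le> x'" "x' \<le> h + c + L" unfolding x'_def using xt y c by linarith+
          consider "x' \<le> c" | "c < x'" "h - 2 * c \<le> x'" | "c < x'" "x' < h - 2 * c" by linarith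
          then show "\<Phi> (?F s y) \<le> q + p * fail (x + y)"
          proof cases
            case 1
            have "p - e1 \<le> p * fail x'"
              using fail_ell[of x'] ell_c[OF 1] x' c e1 by (intro p_fail) auto
            then show ?thesis using 1 ell_c[OF 1] q1
              by (simp add: \<Phi>_def st k trial_step_def x'_def[symmetric])
          next
            case 2
            have "0 \<le> p * fail x'" using p fail_nonneg x' by simp
            then show ?thesis using 2 near_le[of x']
              by (simp add: \<Phi>_def st k trial_step_def x'_def[symmetric])
          next
            case 3
            then show ?thesis by (simp add: \<Phi>_def st k trial_step_def x'_def[symmetric])
          qed
        qed
      next
        case k: Tainted
        have xt: "- c < x" "x < h - 2 * c" using s by (auto simp: I_def st k)
        have G: "space_time_harmonic (\<lambda>x s. ell x + (p + \<delta>))"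
          by (intro harmonic_add harmonic_const haff)
        show ?thesis
        proof (rule harmonic_step[OF G])
          show "ell x + (p + \<delta>) \<le> \<Phi> s" by (simp add: \<Phi>_def st k)
          fix y assume y: "\<bar>y\<bar> \<le> L"
          then have n: "0 \<le> ell (x + y)" using xt by (intro ell_nonneg) linarith
          show "\<Phi> (?F s y) \<le> ell (x + y) + (p + \<delta>)"
            using n retry_start ell_ge1[of "x + y"] p \<delta>
            by (auto simp: \<Phi>_def st k trial_step_def)
        qed
      next
        case k: Near
        have xt: "c < x" "x < h + c" using s by (auto simp: I_def st k)
        show ?thesis
        proof (rule harmonic_step[OF haff(4)])
          show "near x \<le> \<Phi> s" by (simp add: \<Phi>_def st k)
          fix y assume y: "\<bar>y\<bar> \<le> L"
          then have n: "0 \<le> near (x + y)" using xt by (intro near_nonneg) linarith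
          show "\<Phi> (?F s y) \<le> near (x + y)"
            using n near_ge1[of "x + y"] by (auto simp: \<Phi>_def st k trial_step_def)
        qed
      next
        case k: Retry
        have xt: "- c < x" "x < u" "0 \<le> t" using s by (auto simp: I_def st k)
        have G: "space_time_harmonic retry"
          unfolding retry_def by (intro harmonic_add harmonic_cmult harmonic_const hT haff)
        show ?thesis
        proof (rule harmonic_step[OF G])
          show "retry x t \<le> \<Phi> s" by (simp add: \<Phi>_def st k)
          fix y assume y: "\<bar>y\<bar> \<le> L"
          define x' where "x' = x + y"
          have x': "- c - L \<le> x'" "x' \<le> u + L" unfolding x'_def using xt y by linarith+
          have tn: "0 \<le> (lm + \<delta>) * top x'" "0 \<le> (lm + \<delta>) * T x' (t + 1)"
            using x' xt lm \<delta> by (auto intro!: mult_nonneg_nonneg top_nonneg T_nonneg)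
          consider "x' \<le> - c" | "- c < x'" "u \<le> x' \<or> t + 1 \<ge> w" | "- c < x'" "x' < u" "t + 1 < w" by linarith
          then show "\<Phi> (?F s y) \<le> retry (x + y) (t + 1)"
          proof cases
            case 1
            then show ?thesis using fresh_start tn
              by (simp add: \<Phi>_def st k trial_step_def x'_def[symmetric] retry_def)
          next
            case 2
            have "lm + \<delta> \<le> (lm + \<delta>) * top x' + (lm + \<delta>) * T x' (t + 1)"
            proof (cases "u \<le> x'")
              case True
              then have "(lm + \<delta>) * 1 \<le> (lm + \<delta>) * top x'" using top_ge1 lm \<delta> by (intro mult_left_mono) auto
              then show ?thesis using tn by simp
            next
              case False
              then have "(lm + \<delta>) * 1 \<le> (lm + \<delta>) * T x' (t + 1)"
                using T_ge1[OF x', of "t + 1"] 2 lm \<delta> by (intro mult_left_mono) auto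
              then show ?thesis using tn by simp
            qed
            then show ?thesis using 2 ell_le[OF x'(2)]
              by (auto simp: \<Phi>_def st k trial_step_def x'_def[symmetric] retry_def)
          next
            case 3
            then show ?thesis by (simp add: \<Phi>_def st k trial_step_def x'_def[symmetric])
          qed
        qed
      next
        case Failed
        then show ?thesis by (intro bounded_step[OF order_refl]) (simp add: \<Phi>_def st trial_step_def)
      next
        case Settled
        then show ?thesis by (intro bounded_step[OF order_refl]) (simp add: \<Phi>_def st trial_step_def)
      qed
    qed
  qed
  also have "\<Phi> (Fresh, 0, 0) \<le> p" using fresh_start by (simp add: \<Phi>_def)
  finally show ?thesis by (simp add: mem_Times_iff)
qed

text \<open>With \<open>u = A * c\<close> and \<open>w\<close> of order \<open>A ^ 4 * c\<^sup>2\<close>, the expected cost of a trial is at most \<open>92 * \<theta> / A\<close>, where \<open>\<theta> = c / h\<close>,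
and its probability of success is at least \<open>\<theta> / 2\<close>.\<close>

lemma trial_bound:
  fixes h c A :: real and w :: nat
  assumes A: "184 \<le> A" and c: "L \<le> c" "0 < c" and h: "(A + 4) * c \<le> h" and w: "4 * A ^ 4 * c\<^sup>2 \<le> v * real w"
  shows "prob {\<omega> \<in> space M. fst (run (trial_step h c (A * c) (real w)) (Fresh, 0, 0) (steps \<omega>) n) = Failed} \<le> 184 / A"
proof -
  define \<theta> where "\<theta> = c / h"
  define lm where "lm = (A * c + c + 2 * L) / (h - c + L)"
  define T0 where "T0 = (A * c + L)\<^sup>2 / (v * real w)"
  define s0 where "s0 = (c + L) / (A * c + c + L) + T0"
  have A0: "0 < A" using A by simp
  have Ac: "184 * c \<le> A * c" using A c by simp
  have hA: "A * c + 4 * c \<le> h" using h by (simp add: algebra_simps)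
  have h0: "0 < h" using hA Ac c by linarith
  have th: "0 < \<theta>" unfolding \<theta>_def using c h0 by simp
  have vw: "0 < v * real w"
    by (rule less_le_trans[OF _ w]) (use A0 c in simp)
  have w0: "w > 0" using vw v_pos by (cases w) auto
  have T0: "0 \<le> T0" "T0 \<le> 1 / A\<^sup>2"
  proof -
    show "0 \<le> T0" unfolding T0_def using vw by simp
    have "(A * c + L)\<^sup>2 \<le> (2 * (A * c))\<^sup>2"
      using c L_nonneg A0 Ac by (intro power_mono) linarith+
    also have "\<dots> * A\<^sup>2 \<le> v * real w" using w by (simp add: power_mult_distrib power4_eq_xxxx power2_eq_square algebra_simps)
    finally have "(A * c + L)\<^sup>2 * A\<^sup>2 \<le> v * real w" using A0 by (simp add: mult_right_mono)
    then show "T0 \<le> 1 / A\<^sup>2" unfolding T0_def using vw A0 by (simp add: field_simps)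
  qed
  have T0A: "T0 \<le> 1 / A"
  proof -
    have "1 / A\<^sup>2 \<le> 1 / A" using A by (intro divide_left_mono) (auto simp: power2_eq_square)
    then show ?thesis using T0 by linarith
  qed
  have top: "0 \<le> (c + L) / (A * c + c + L)" "(c + L) / (A * c + c + L) \<le> 2 / A"
  proof -
    show "0 \<le> (c + L) / (A * c + c + L)" using c L_nonneg A0 by (intro divide_nonneg_nonneg) auto
    have "(c + L) / (A * c + c + L) \<le> (2 * c) / (A * c)"
      using c L_nonneg A0 Ac by (intro frac_le) auto
    then show "(c + L) / (A * c + c + L) \<le> 2 / A" using c by simp
  qed
  have s0: "0 \<le> s0" "s0 \<le> 3 / A" unfolding s0_def using top T0 T0A A0 by (auto simp: add_divide_distrib[symmetric] field_simps)
  have s0': "s0 \<le> 1 / 2"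
  proof -
    have "3 / A \<le> 1 / 2" using A by (simp add: field_simps)
    then show ?thesis using s0 by linarith
  qed
  have frac: "x / (h - c + L) \<le> 2 * k * \<theta>" if "x \<le> k * c" "0 \<le> k" for x k
  proof -
    have "h / 2 \<le> h - c + L" using hA Ac c L_nonneg h0 by linarith
    then have "x / (h - c + L) \<le> (k * c) / (h / 2)"
      using that c h0 by (intro frac_le) auto
    then show ?thesis by (simp add: \<theta>_def mult_ac)
  qed
  have lm: "0 \<le> lm" "lm \<le> 4 * A * \<theta>"
  proof -
    show "0 \<le> lm" unfolding lm_def using hA Ac c L_nonneg by (intro divide_nonneg_nonneg) linarith+
    have "A * c + c + 2 * L \<le> (2 * A) * c" using Ac c L_nonneg by (simp only: mult.assoc)
    from frac[OF this] A0 show "lm \<le> 4 * A * \<theta>" unfolding lm_def by simp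
  qed
  define \<delta> where "\<delta> = 2 * lm * s0"
  define q where "q = 2 * ((2 * c + L) / (h - c + L)) + \<delta> + (3 * c + L) / (h + L)"
  have d: "0 \<le> \<delta>" "\<delta> \<le> lm" "(lm + \<delta>) * s0 \<le> \<delta>" "\<delta> \<le> 24 * \<theta>"
  proof -
    show "0 \<le> \<delta>" unfolding \<delta>_def using lm s0 by simp
    have "lm * (2 * s0) \<le> lm * 1" using lm s0' by (intro mult_left_mono) auto
    then show d1: "\<delta> \<le> lm" unfolding \<delta>_def by simp
    have "(lm + \<delta>) * s0 \<le> (lm + lm) * s0" using d1 s0 by (intro mult_right_mono) auto
    then show "(lm + \<delta>) * s0 \<le> \<delta>" unfolding \<delta>_def by simp
    have "lm * s0 \<le> (4 * A * \<theta>) * (3 / A)" using lm s0 th A0 by (intro mult_mono) auto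
    then show "\<delta> \<le> 24 * \<theta>" unfolding \<delta>_def using A0 by simp
  qed
  have three: "0 \<le> (3 * c + L) / (h + L)" "(3 * c + L) / (h + L) \<le> 4 * \<theta>"
  proof -
    show "0 \<le> (3 * c + L) / (h + L)" using c L_nonneg h0 by simp
    have "(3 * c + L) / (h + L) \<le> (4 * c) / h" using c L_nonneg h0 by (intro frac_le) auto
    then show "(3 * c + L) / (h + L) \<le> 4 * \<theta>" by (simp add: \<theta>_def)
  qed
  have two: "0 \<le> (2 * c + L) / (h - c + L)" using hA Ac c L_nonneg by (intro divide_nonneg_nonneg) linarith+
  have qb: "0 \<le> q" "q \<le> 40 * \<theta>"
  proof -
    define e2 e3 where "e2 = (2 * c + L) / (h - c + L)" and "e3 = (3 * c + L) / (h + L)"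
    have "e2 \<le> 2 * 3 * \<theta>" unfolding e2_def by (rule frac) (use c in auto)
    moreover have "0 \<le> e2" "0 \<le> e3" "e3 \<le> 4 * \<theta>" using two three by (simp_all add: e2_def e3_def)
    ultimately show "0 \<le> q" "q \<le> 40 * \<theta>" unfolding q_def e2_def[symmetric] e3_def[symmetric] using d by linarith+
  qed
  show ?thesis
  proof (rule trial_bound_abstract[of c "A * c" h w \<delta> q])
    show "(A * c + c + 2 * L) / (h - c + L) \<ge> \<delta>" using d(2) by (simp add: lm_def)
    show "((A * c + c + 2 * L) / (h - c + L) + \<delta>) * ((c + L) / (A * c + c + L) + (A * c + L)\<^sup>2 / (v * real w)) \<le> \<delta>"
      using d(3) by (simp add: lm_def s0_def T0_def)
    show "2 * ((2 * c + L) / (h - c + L)) + \<delta> \<le> q" "(3 * c + L) / (h + L) \<le> q"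
      unfolding q_def using three(1) two d(1) by linarith+
    have "q * ((c + L) / (A * c + c + L)) \<le> (40 * \<theta>) * (2 / A)"
      using qb top th by (intro mult_mono) auto
    moreover have "3 * lm * T0 \<le> 3 * (4 * A * \<theta>) * (1 / A\<^sup>2)"
      using lm T0 th A0 by (intro mult_mono) auto
    moreover have "3 * (4 * A * \<theta>) * (1 / A\<^sup>2) = 12 * \<theta> / A" using A0 by (simp add: power2_eq_square)
    ultimately have "q * ((c + L) / (A * c + c + L)) + 3 * lm * T0 \<le> 92 * \<theta> / A"
      by (simp add: add_divide_distrib[symmetric])
    also have "\<dots> = 184 / A * (c / (2 * h))" by (simp add: \<theta>_def)
    also have "\<dots> \<le> 184 / A * (c / (h + 2 * c + L))"
    proof (intro mult_left_mono divide_left_mono mult_pos_pos)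
      show "h + 2 * c + L \<le> 2 * h" using c L_nonneg hA Ac by linarith
    qed (use A0 c L_nonneg h0 in auto)
    finally show "q * ((c + L) / (A * c + c + L)) + 3 * ((A * c + c + 2 * L) / (h - c + L)) * ((A * c + L)\<^sup>2 / (v * real w))
        \<le> 184 / A * (c / (h + 2 * c + L))" by (simp add: lm_def T0_def)
  qed (use c Ac hA A A0 w0 d in auto)
qed

end

section \<open>The path of a successful trial\<close>

text \<open>The stable one-sided picture around the minimum at time \<open>k\<close> of the path up to time \<open>t\<close>: a wall with a margin
\<open>c\<close> behind it, rises with a margin \<open>c\<close> before it, and all low points close to it.\<close>

definition bottom_at :: "(nat \<Rightarrow> real) \<Rightarrow> real \<Rightarrow> real \<Rightarrow> nat \<Rightarrow> nat \<Rightarrow> nat \<Rightarrow> bool" where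
  "bottom_at f h c w t k \<longleftrightarrow> k \<le> t \<and> (\<forall>i\<le>t. f k \<le> f i) \<and> f k + h + c \<le> f t \<and>
     (\<forall>i j. i \<le> j \<and> j \<le> k \<longrightarrow> f j - f i \<le> h - c) \<and>
     (\<forall>i\<le>t. i + w < k \<or> k + w < i \<longrightarrow> f k + c \<le> f i)"

text \<open>What the machine knows at time \<open>n\<close> about a path \<open>f\<close> whose latest cutting point is \<open>\<sigma>\<close>. The path is
lower at \<open>\<sigma>\<close> than ever before. In a clean trial the earlier low points are recent (\<open>clean\<close>). In a climbing one the later low
points are recent as well (\<open>climb\<close>), and all rises so far have the margin required of the bottom (\<open>draw\<close>); in
the stage \<open>Near\<close> this holds up to the last low point only (\<open>near\<close>).\<close>

locale trial_inv =
  fixes h c u :: real and w :: nat and f :: "nat \<Rightarrow> real" and n :: nat and k :: stage and x s :: real and \<sigma> :: nat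
  assumes running: "k \<noteq> Failed" "k \<noteq> Settled"
    and start: "\<sigma> \<le> n"
    and height: "x = f n - f \<sigma>"
    and below: "\<And>i. i < \<sigma> \<Longrightarrow> f \<sigma> < f i"
    and above: "\<And>i. \<sigma> \<le> i \<Longrightarrow> i \<le> n \<Longrightarrow> f \<sigma> - c < f i"
    and clean: "\<And>i. k \<in> {Fresh, Climbing, Near} \<Longrightarrow> i < \<sigma> \<Longrightarrow> f i \<le> f \<sigma> + c \<Longrightarrow> \<sigma> \<le> i + w"
    and clock: "k \<in> {Fresh, Retry} \<Longrightarrow> s = real (n - \<sigma>) \<and> n < \<sigma> + w \<and> x < u"
    and climb: "k \<in> {Climbing, Near} \<Longrightarrow> c < x"
      "\<And>i. k \<in> {Climbing, Near} \<Longrightarrow> \<sigma> \<le> i \<Longrightarrow> i \<le> n \<Longrightarrow> f i \<le> f \<sigma> + c \<Longrightarrow> i \<le> \<sigma> + w"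
    and draw: "\<And>i j. k \<noteq> Near \<Longrightarrow> i \<le> j \<Longrightarrow> j \<le> n \<Longrightarrow> f j - f i < h - c"
      "\<And>j. k \<noteq> Near \<Longrightarrow> \<sigma> \<le> j \<Longrightarrow> j \<le> n \<Longrightarrow> f j < f \<sigma> + h - 2 * c"
    and near: "\<And>i j e. k = Near \<Longrightarrow> i \<le> j \<Longrightarrow> j \<le> e \<Longrightarrow> e \<le> n \<Longrightarrow> f e \<le> f \<sigma> + c \<Longrightarrow> f j - f i < h - c"
      "\<And>j. k = Near \<Longrightarrow> \<sigma> \<le> j \<Longrightarrow> j \<le> n \<Longrightarrow> f j < f \<sigma> + h + c"

text \<open>All points before the new cutting point are higher than it by \<open>c\<close>, except for those of the trial that has just ended; if that
one was quick, they are recent.\<close>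

lemma trial_inv_restart:
  assumes inv: "trial_inv h c u w f n k x s \<sigma>" and k: "k \<noteq> Near" and c: "0 < c" "2 * c \<le> u" "u + 3 * c \<le> h" and w: "0 < w"
    and drop: "f (Suc n) - f \<sigma> \<le> - c" and k': "k' = Retry \<or> k' = Fresh \<and> n < \<sigma> + w"
  shows "trial_inv h c u w f (Suc n) k' 0 0 (Suc n)"
proof -
  interpret trial_inv h c u w f n k x s \<sigma> by (rule inv)
  have new: "f (Suc n) < f i" if "i < Suc n" for i
    using below[of i] above[of i] that drop c by (cases "i < \<sigma>") auto
  have quick: "Suc n \<le> i + w" if "n < \<sigma> + w" "i < Suc n" "f i \<le> f (Suc n) + c" for i
    using that below[of i] drop by (cases "i < \<sigma>") auto
  have rise: "f j - f i < h - c" if "i \<le> j" "j \<le> Suc n" for i j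
  proof (cases "j = Suc n")
    case True
    then have "f j \<le> f i" using new[of i] that by (cases "i = Suc n") auto
    then show ?thesis using c by linarith
  next
    case False
    then show ?thesis using draw(1)[of i j] k that by simp
  qed
  show ?thesis
    by unfold_locales (use new quick rise k' c w in auto)
qed

text \<open>On success the minimum lies between \<open>\<sigma>\<close> and the time of the last low point, which are at most \<open>w\<close> apart, and the low
points before \<open>\<sigma>\<close> are at most \<open>w\<close> away as well. This gives the window \<open>2 * w\<close>, for whichever minimum is chosen among ties.\<close>

lemma trial_inv_step:
  assumes inv: "trial_inv h c u w f n k x s \<sigma>"
    and step: "trial_step h c u (real w) (k, x, s) y = (k', x', s')"
    and f: "f (Suc n) = f n + y" "\<bar>y\<bar> \<le> L"
    and c: "0 < c" "L \<le> c" "2 * c \<le> u" "u + 4 * c \<le> h" and w: "0 < w"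
  shows "k' = Failed \<or> (k' = Settled \<and> (\<forall>k\<le>Suc n. (\<forall>i\<le>Suc n. f k \<le> f i) \<longrightarrow> bottom_at f h c (2 * w) (Suc n) k)) \<or>
    (\<exists>\<sigma>'. trial_inv h c u w f (Suc n) k' x' s' \<sigma>')"
proof -
  define z where "z = x + y"
  interpret trial_inv h c u w f n k x s \<sigma> by (rule inv)
  note x = height and \<sigma> = start
  have z: "f (Suc n) = f \<sigma> + z" using x f by (simp add: z_def)
  have above': "f \<sigma> - c < f i" if "- c < z" "\<sigma> \<le> i" "i \<le> Suc n" for i
    using above[of i] that z by (cases "i = Suc n") auto
  \<comment> \<open>a new point that is still below the upper level of the trial ends no large rise\<close>
  have draw': "f j - f i < h - c" if "k \<noteq> Near" "z < h - 2 * c" "- c < z" "i \<le> j" "j \<le> Suc n" for i j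
  proof (cases "j = Suc n")
    case True
    show ?thesis
    proof (cases "i < \<sigma>")
      case True
      then show ?thesis using below[of i] z that \<open>j = Suc n\<close> c by simp
    next
      case False
      then show ?thesis using above'[of i] z that True by simp
    qed
  next
    case False
    then show ?thesis using draw(1)[of i j] that by simp
  qed
  have draw'': "f j < f \<sigma> + h - 2 * c" if "k \<noteq> Near" "z < h - 2 * c" "\<sigma> \<le> j" "j \<le> Suc n" for j
    using draw(2)[of j] that z by (cases "j = Suc n") auto
  have keep: "trial_inv h c u w f (Suc n) K z S \<sigma>"
    if "k \<noteq> Near" "z < h - 2 * c" "- c < z" "K \<in> {Fresh, Climbing, Tainted, Retry}" "k \<in> {Fresh, Climbing} \<or> K \<in> {Tainted, Retry}"
      and timed: "K \<in> {Fresh, Retry} \<Longrightarrow> S = real (Suc n - \<sigma>) \<and> Suc n < \<sigma> + w \<and> z < u"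
      and climbing: "K = Climbing \<Longrightarrow> c < z \<and> (\<forall>i. \<sigma> \<le> i \<and> i \<le> n \<and> f i \<le> f \<sigma> + c \<longrightarrow> i \<le> \<sigma> + w)" for K S
  proof
    show "K \<noteq> Failed" "K \<noteq> Settled" using that by auto
    show "\<sigma> \<le> Suc n" "z = f (Suc n) - f \<sigma>" using \<sigma> z by auto
    show "f \<sigma> < f i" if "i < \<sigma>" for i using below that .
    show "f \<sigma> - c < f i" if "\<sigma> \<le> i" "i \<le> Suc n" for i using above' that \<open>- c < z\<close> by blast
    show "\<sigma> \<le> i + w" if "K \<in> {Fresh, Climbing, Near}" "i < \<sigma>" "f i \<le> f \<sigma> + c" for i
      using clean[of i] that \<open>K \<in> {Fresh, Climbing, Tainted, Retry}\<close> \<open>k \<in> {Fresh, Climbing} \<or> K \<in> {Tainted, Retry}\<close> by auto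
    show "S = real (Suc n - \<sigma>) \<and> Suc n < \<sigma> + w \<and> z < u" if "K \<in> {Fresh, Retry}"
      using that timed by blast
    show "c < z" if "K \<in> {Climbing, Near}"
      using that climbing \<open>K \<in> {Fresh, Climbing, Tainted, Retry}\<close> by auto
    show "i \<le> \<sigma> + w" if "K \<in> {Climbing, Near}" "\<sigma> \<le> i" "i \<le> Suc n" "f i \<le> f \<sigma> + c" for i
    proof -
      have "K = Climbing" using that \<open>K \<in> {Fresh, Climbing, Tainted, Retry}\<close> by auto
      then have *: "c < z" "\<forall>i. \<sigma> \<le> i \<and> i \<le> n \<and> f i \<le> f \<sigma> + c \<longrightarrow> i \<le> \<sigma> + w" using climbing by auto
      then have "i \<noteq> Suc n" using that z by auto
      then show ?thesis using * that by auto
    qed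
    show "f j - f i < h - c" if "i \<le> j" "j \<le> Suc n" for i j using draw' that \<open>k \<noteq> Near\<close> \<open>z < h - 2 * c\<close> \<open>- c < z\<close> by blast
    show "f j < f \<sigma> + h - 2 * c" if "\<sigma> \<le> j" "j \<le> Suc n" for j using draw'' that \<open>k \<noteq> Near\<close> \<open>z < h - 2 * c\<close> by blast
    show "f j - f i < h - c" if "K = Near" for i j using that \<open>K \<in> {Fresh, Climbing, Tainted, Retry}\<close> by auto
    show "f j < f \<sigma> + h + c" if "K = Near" for j using that \<open>K \<in> {Fresh, Climbing, Tainted, Retry}\<close> by auto
  qed
  have restart: "trial_inv h c u w f (Suc n) K 0 0 (Suc n)" if "k \<noteq> Near" "z \<le> - c" "K = Retry \<or> K = Fresh \<and> n < \<sigma> + w" for K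
    by (rule trial_inv_restart[OF inv that(1) c(1,3) _ w _ that(3)]) (use c z that in auto)
  have ux: "z < h - 2 * c" if "x < u" using that f c by (simp add: z_def)
  show ?thesis
  proof (cases k)
    case k: Fresh
    have ck: "s = real (n - \<sigma>)" "n < \<sigma> + w" "x < u" using clock k by auto
    have s1: "s + 1 = real (Suc n - \<sigma>)" using ck \<sigma> by (simp add: Suc_diff_le)
    consider "z \<le> - c" | "- c < z" "u \<le> z" | "- c < z" "z < u" "s + 1 \<ge> w" | "- c < z" "z < u" "s + 1 < w" by linarith
    then show ?thesis
    proof cases
      case 1
      then have "k' = Fresh \<and> x' = 0 \<and> s' = 0" using step k by (simp add: trial_step_def z_def)
      then show ?thesis using restart[of Fresh] 1 k ck by auto
    next
      case 2
      then have "k' = Climbing \<and> x' = z" using step k c by (auto simp: trial_step_def z_def)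
      then show ?thesis using keep[of Climbing s'] 2 k ux ck c by auto
    next
      case 3
      then have "k' = Tainted \<and> x' = z" using step k by (auto simp: trial_step_def z_def)
      then show ?thesis using keep[of Tainted s'] 3 k ux ck by auto
    next
      case 4
      then have e: "k' = Fresh \<and> x' = z \<and> s' = s + 1" using step k by (auto simp: trial_step_def z_def)
      have "Suc n < \<sigma> + w" using s1 4 \<sigma> by linarith
      then show ?thesis using keep[of Fresh s'] 4 k ux ck s1 e by auto
    qed
  next
    case k: Retry
    have ck: "s = real (n - \<sigma>)" "n < \<sigma> + w" "x < u" using clock k by auto
    have s1: "s + 1 = real (Suc n - \<sigma>)" using ck \<sigma> by (simp add: Suc_diff_le)
    consider "z \<le> - c" | "- c < z" "u \<le> z \<or> s + 1 \<ge> w" | "- c < z" "z < u" "s + 1 < w" by linarith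
    then show ?thesis
    proof cases
      case 1
      then have "k' = Fresh \<and> x' = 0 \<and> s' = 0" using step k by (simp add: trial_step_def z_def)
      then show ?thesis using restart[of Fresh] 1 k ck by auto
    next
      case 2
      then have "k' = Tainted \<and> x' = z" using step k by (auto simp: trial_step_def z_def)
      then show ?thesis using keep[of Tainted s'] 2 k ux ck by auto
    next
      case 3
      then have e: "k' = Retry \<and> x' = z \<and> s' = s + 1" using step k by (auto simp: trial_step_def z_def)
      have "Suc n < \<sigma> + w" using s1 3 \<sigma> by linarith
      then show ?thesis using keep[of Retry s'] 3 k ux ck s1 e by auto
    qed
  next
    case k: Tainted
    consider "z \<le> - c" | "- c < z" "h - 2 * c \<le> z" | "- c < z" "z < h - 2 * c" by linarith
    then show ?thesis
    proof cases
      case 1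
      then have "k' = Retry \<and> x' = 0 \<and> s' = 0" using step k by (simp add: trial_step_def z_def)
      then show ?thesis using restart[of Retry] 1 k by auto
    next
      case 2
      then show ?thesis using step k by (auto simp: trial_step_def z_def)
    next
      case 3
      then have "k' = Tainted \<and> x' = z" using step k by (auto simp: trial_step_def z_def)
      then show ?thesis using keep[of Tainted s'] 3 k by auto
    qed
  next
    case k: Climbing
    have xc: "c < x" using climb k by auto
    then have zc: "- c < z" using f c by (auto simp: z_def)
    have xh: "x < h - 2 * c" using draw(2)[of n] k \<sigma> x by auto
    consider "z \<le> c" | "c < z" "h - 2 * c \<le> z" | "c < z" "z < h - 2 * c" by linarith
    then show ?thesis
    proof cases
      case 1
      then have "k' = Tainted \<and> x' = z" using step k by (auto simp: trial_step_def z_def)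
      then show ?thesis using keep[of Tainted s'] 1 k zc c by auto
    next
      case 2
      then have e: "k' = Near" "x' = z" using step k by (auto simp: trial_step_def z_def)
      have "trial_inv h c u w f (Suc n) Near z s' \<sigma>"
      proof
        show "f \<sigma> - c < f i" if "\<sigma> \<le> i" "i \<le> Suc n" for i using above' that zc by blast
        show "\<sigma> \<le> i + w" if "i < \<sigma>" "f i \<le> f \<sigma> + c" for i using clean[of i] that k by auto
        show "i \<le> \<sigma> + w" if "\<sigma> \<le> i" "i \<le> Suc n" "f i \<le> f \<sigma> + c" for i
          using climb(2)[of i] that k 2 z by (cases "i = Suc n") auto
        show "f j - f i < h - c" if "i \<le> j" "j \<le> e" "e \<le> Suc n" "f e \<le> f \<sigma> + c" for i j e
        proof -
          have "e \<noteq> Suc n" using that 2 z by auto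
          then show ?thesis using draw(1)[of i j] that k by auto
        qed
        show "f j < f \<sigma> + h + c" if "\<sigma> \<le> j" "j \<le> Suc n" for j
        proof (cases "j = Suc n")
          case True
          then show ?thesis using z xh f c by (simp add: z_def)
        next
          case False
          then show ?thesis using draw(2)[of j] that k c by auto
        qed
      qed (use z \<sigma> below 2 in auto)
      then show ?thesis using e by auto
    next
      case 3
      then have "k' = Climbing \<and> x' = z" using step k by (auto simp: trial_step_def z_def)
      then show ?thesis using keep[of Climbing s'] 3 k zc climb by auto
    qed
  next
    case k: Near
    have xc: "c < x" using climb k by auto
    then have zc: "- c < z" using f c by (auto simp: z_def)
    consider "z \<le> c" | "c < z" "h + c \<le> z" | "c < z" "z < h + c" by linarith
    then show ?thesis
    proof cases
      case 1
      then show ?thesis using step k by (auto simp: trial_step_def z_def)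
    next
      case 2
      then have e: "k' = Settled" using step k by (auto simp: trial_step_def z_def)
      have "bottom_at f h c (2 * w) (Suc n) l" if l: "l \<le> Suc n" "\<forall>i\<le>Suc n. f l \<le> f i" for l
      proof -
        have l\<sigma>: "f l \<le> f \<sigma>" using l \<sigma> by simp
        have ln: "l \<noteq> Suc n" using l\<sigma> z 2 c by auto
        have "\<not> l < \<sigma>" using below[of l] l\<sigma> by auto
        then have l2: "\<sigma> \<le> l" "l \<le> n" using ln l by auto
        have lw: "l \<le> \<sigma> + w" using climb(2)[of l] k l2 l\<sigma> c by auto
        have win: "f l + c \<le> f i" if "i \<le> Suc n" "i + 2 * w < l \<or> l + 2 * w < i" for i
        proof (rule ccontr)
          assume "\<not> f l + c \<le> f i"
          then have fi: "f i \<le> f \<sigma> + c" using l\<sigma> by linarith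
          have "i \<noteq> Suc n" using fi z 2 c by auto
          then have "\<sigma> \<le> i + w \<and> i \<le> \<sigma> + w"
            using clean[of i] climb(2)[of i] fi that k by (cases "i < \<sigma>") auto
          then show False using that lw l2 by auto
        qed
        show ?thesis
          unfolding bottom_at_def
        proof (intro conjI impI allI)
          show "f j - f i \<le> h - c" if "i \<le> j \<and> j \<le> l" for i j
            using near(1)[of i j l] that k l2 l\<sigma> c by auto
        qed (use l l\<sigma> z 2 win in auto)
      qed
      then show ?thesis using e by auto
    next
      case 3
      then have e: "k' = Near" "x' = z" using step k by (auto simp: trial_step_def z_def)
      have "trial_inv h c u w f (Suc n) Near z s' \<sigma>"
      proof
        show "f \<sigma> - c < f i" if "\<sigma> \<le> i" "i \<le> Suc n" for i using above' that zc by blast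
        show "\<sigma> \<le> i + w" if "i < \<sigma>" "f i \<le> f \<sigma> + c" for i using clean[of i] that k by auto
        show "i \<le> \<sigma> + w" if "\<sigma> \<le> i" "i \<le> Suc n" "f i \<le> f \<sigma> + c" for i
          using climb(2)[of i] that k 3 z by (cases "i = Suc n") auto
        show "f j - f i < h - c" if "i \<le> j" "j \<le> e" "e \<le> Suc n" "f e \<le> f \<sigma> + c" for i j e
        proof -
          have "e \<noteq> Suc n" using that 3 z by auto
          then show ?thesis using near(1)[of i j e] that k by auto
        qed
        show "f j < f \<sigma> + h + c" if "\<sigma> \<le> j" "j \<le> Suc n" for j
          using near(2)[of j] that k 3 z by (cases "j = Suc n") auto
      qed (use z \<sigma> below 3 in auto)
      then show ?thesis using e by auto
    qed
  qed (use running in auto)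
qed

lemma trial_run:
  assumes y: "\<And>i. \<bar>y i\<bar> \<le> L"
    and c: "0 < c" "L \<le> c" "2 * c \<le> u" "u + 4 * c \<le> h" and w: "0 < w"
    and run: "run (trial_step h c u (real w)) (Fresh, 0, 0) y n = (k, x, s)"
  shows "k = Failed \<or> (k = Settled \<and> (\<exists>t\<le>n. \<forall>k\<le>t. (\<forall>i\<le>t. psum y k \<le> psum y i) \<longrightarrow> bottom_at (psum y) h c (2 * w) t k)) \<or>
    (\<exists>\<sigma>. trial_inv h c u w (psum y) n k x s \<sigma>)"
  using run
proof (induction n arbitrary: k x s)
  case 0
  then have "trial_inv h c u w (psum y) 0 k x s 0" using c w by unfold_locales auto
  then show ?case by blast
next
  case (Suc n)
  obtain k' x' s' where st: "run (trial_step h c u (real w)) (Fresh, 0, 0) y n = (k', x', s')"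
    by (metis prod_cases3)
  have eq: "trial_step h c u (real w) (k', x', s') (y n) = (k, x, s)" using Suc.prems st by simp
  consider "k' = Failed" | "k' = Settled" "\<exists>t\<le>n. \<forall>k\<le>t. (\<forall>i\<le>t. psum y k \<le> psum y i) \<longrightarrow> bottom_at (psum y) h c (2 * w) t k"
    | \<sigma> where "trial_inv h c u w (psum y) n k' x' s' \<sigma>" using Suc.IH[OF st] by blast
  then show ?case
  proof cases
    case 1
    then show ?thesis using eq by (simp add: trial_step_def)
  next
    case 2
    then show ?thesis using eq by (auto simp: trial_step_def intro: le_SucI)
  next
    case 3
    from trial_inv_step[OF 3 eq _ y c w] show ?thesis by auto
  qed
qed

text \<open>An unfinished run means that the path has stayed low; \<open>reach_bound\<close> makes this unlikely.\<close>

lemma trial_inv_height: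
  assumes inv: "trial_inv h c u w f n k x s \<sigma>" and j: "j \<le> n" and c: "0 < c" and f0: "f 0 = 0"
  shows "f j < h + 2 * c"
proof -
  interpret trial_inv h c u w f n k x s \<sigma> by (rule inv)
  have s0: "f \<sigma> \<le> 0" using below[of 0] f0 by (cases "\<sigma> = 0") auto
  show ?thesis
  proof (cases "k = Near")
    case True
    show ?thesis
    proof (cases "\<sigma> \<le> j")
      case True
      then show ?thesis using near(2)[of j] \<open>k = Near\<close> j s0 c by linarith
    next
      case False
      then have "f j - f 0 < h - c" using start c \<open>k = Near\<close> by (intro near(1)[of 0 j \<sigma>]) auto
      then show ?thesis using f0 c by linarith
    qed
  next
    case False
    then show ?thesis using draw(1)[of 0 j] j f0 c by linarith
  qed
qed

text \<open>The three components of the state are the position, minimum and maximum of the path at the time \<open>m\<close> when it is frozen.\<close>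

lemma drawup_run:
  assumes h: "h > 0" and run: "run (drawup_step h) (0, 0, 0) y n = (x, lo, hi)"
  shows "\<exists>m\<le>n. x = psum y m \<and> (\<forall>i\<le>m. lo \<le> psum y i \<and> psum y i \<le> hi) \<and> (\<exists>i\<le>m. psum y i = lo) \<and>
    (\<exists>i\<le>m. psum y i = hi) \<and> (\<forall>i j. i \<le> j \<and> j < m \<longrightarrow> psum y j - psum y i < h) \<and> (x - lo < h \<longrightarrow> m = n)"
  using run
proof (induction n arbitrary: x lo hi)
  case 0
  then show ?case by auto
next
  case (Suc n)
  obtain x' lo' hi' where st: "run (drawup_step h) (0, 0, 0) y n = (x', lo', hi')"
    by (metis prod_cases3)
  have eq: "drawup_step h (x', lo', hi') (y n) = (x, lo, hi)" using Suc.prems st by simp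
  obtain m where m: "m \<le> n" "x' = psum y m" "\<forall>i\<le>m. lo' \<le> psum y i \<and> psum y i \<le> hi'" "\<exists>i\<le>m. psum y i = lo'"
    "\<exists>i\<le>m. psum y i = hi'" "\<forall>i j. i \<le> j \<and> j < m \<longrightarrow> psum y j - psum y i < h" "x' - lo' < h \<longrightarrow> m = n"
    using Suc.IH[OF st] by blast
  show ?case
  proof (cases "x' - lo' \<ge> h")
    case True
    then have "x = x'" "lo = lo'" "hi = hi'" using eq by (auto simp: drawup_step_def)
    then show ?thesis using m True by (intro exI[of _ m]) auto
  next
    case False
    then have mn: "m = n" using m by auto
    have e: "x = psum y (Suc n)" "lo = min lo' x" "hi = max hi' x"
      using eq False m(2) mn by (auto simp: drawup_step_def)
    show ?thesis
    proof (rule exI[of _ "Suc n"], intro conjI allI impI)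
      show "lo \<le> psum y i" "psum y i \<le> hi" if "i \<le> Suc n" for i
        using that m(3) mn e by (auto simp: le_Suc_eq min_le_iff_disj le_max_iff_disj simp del: psum_simps)
      show "\<exists>i\<le>Suc n. psum y i = lo"
        using m(4) mn e by (cases "lo' \<le> x") (auto simp: min_def intro: le_SucI)
      show "\<exists>i\<le>Suc n. psum y i = hi"
        using m(5) mn e by (cases "hi' \<le> x") (auto simp: max_def intro: le_SucI)
      show "psum y j - psum y i < h" if "i \<le> j \<and> j < Suc n" for i j
      proof (cases "j = n")
        case True
        have "lo' \<le> psum y i" using m(3) mn that True by auto
        then show ?thesis using False m(2) mn True by auto
      next
        case False
        then show ?thesis using m(6) mn that by auto
      qed
    qed (use e in auto)
  qed
qed

lemma drawup_run_stopped:
  assumes h: "h > 0" and run: "run (drawup_step h) (0, 0, 0) y n = (x, lo, hi)"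
    and ij: "i \<le> j" "j \<le> n" "psum y j - psum y i \<ge> h"
  shows "x - lo \<ge> h"
proof (rule ccontr)
  assume no: "\<not> x - lo \<ge> h"
  obtain m where m: "x = psum y m" "\<forall>i\<le>m. lo \<le> psum y i"
    "\<forall>i j. i \<le> j \<and> j < m \<longrightarrow> psum y j - psum y i < h" "x - lo < h \<longrightarrow> m = n"
    using drawup_run[OF h run] by blast
  have "m = n" using m no by auto
  then show False using m ij no by (cases "j = n") force+
qed

text \<open>If the maximum on the side of \<open>z\<close> is larger by \<open>4 * c\<close>, then \<open>z\<close> passes the level \<open>hif + 2 * c\<close> before it
has risen by \<open>h\<close>. Up to that time it has therefore stayed above \<open>hif + 3 * c - h\<close>, which is higher than the
bottom on the side of \<open>y\<close>.\<close>

lemma opposite_barrier: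
  fixes y z :: "nat \<Rightarrow> real"
  defines "f \<equiv> psum y" and "g \<equiv> psum z"
  assumes c: "0 < c" "L \<le> c" "c < h" and z: "\<And>i. \<bar>z i\<bar> \<le> L"
    and bot: "bottom_at f h c w t k" "t \<le> n"
    and run_y: "run (drawup_step h) (0, 0, 0) y n = (xf, lof, hif)"
    and run_z: "run (drawup_step h) (0, 0, 0) z n = (xg, lo_g, hig)"
    and gap: "hif + 4 * c \<le> hig"
  shows "\<exists>j. 1 \<le> j \<and> j \<le> n \<and> hif + 2 * c \<le> g j \<and> (\<forall>i<j. g i < hif + 2 * c) \<and> (\<forall>i\<le>j. hif + 3 * c - h < g i) \<and>
    (\<forall>i\<le>k. f i \<le> hif) \<and> f k + h \<le> hif"
proof -
  have h: "h > 0" using c by linarith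
  have k: "k \<le> t" "\<And>i. i \<le> t \<Longrightarrow> f k \<le> f i" "f k + h + c \<le> f t" "\<And>i j. i \<le> j \<Longrightarrow> j \<le> k \<Longrightarrow> f j - f i \<le> h - c"
    using bot(1) unfolding bottom_at_def by blast+
  have stopped: "xf - lof \<ge> h"
    using k c bot(2) by (intro drawup_run_stopped[OF h run_y, of k t]) (auto simp: f_def)
  obtain m where m: "m \<le> n" "xf = f m" "\<forall>i\<le>m. lof \<le> f i \<and> f i \<le> hif" "\<exists>i\<le>m. f i = lof"
    "\<forall>i j. i \<le> j \<and> j < m \<longrightarrow> f j - f i < h"
    using drawup_run[OF h run_y] unfolding f_def by blast
  obtain i0 where i0: "i0 \<le> m" "f i0 = lof" using m(4) by blast
  \<comment> \<open>The path \<open>f\<close> is frozen on the wall behind its bottom, so the bottom is seen by \<open>lof\<close> and the wall by \<open>hif\<close>.\<close>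
  have km: "k < m"
  proof (rule ccontr)
    assume "\<not> k < m"
    then show False using k(4)[of i0 m] i0 stopped m(2) c by auto
  qed
  have mt: "m \<le> t"
  proof (rule ccontr)
    assume "\<not> m \<le> t"
    then have "f t - f k < h" using m(5) k(1) by auto
    then show False using k(3) c by auto
  qed
  have "f k \<le> lof" using k(2)[of i0] i0 mt by auto
  then have f_hi: "f k + h \<le> hif" using stopped m(2,3) by force
  have f_le: "\<forall>i\<le>k. f i \<le> hif" using m(3) km by auto
  have hif0: "0 \<le> hif" using f_le by (auto simp: f_def dest: spec[of _ 0])
  obtain q where q: "\<exists>i\<le>q. g i = hig" "\<forall>i j. i \<le> j \<and> j < q \<longrightarrow> g j - g i < h" "q \<le> n"
    using drawup_run[OF h run_z] unfolding g_def by blast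
  define j where "j = (LEAST j. hif + 2 * c \<le> g j)"
  define j4 where "j4 = (LEAST j. hif + 4 * c \<le> g j)"
  obtain i1 where i1: "i1 \<le> q" "g i1 = hig" using q by blast
  have j4: "hif + 4 * c \<le> g j4" "j4 \<le> q"
  proof -
    show "hif + 4 * c \<le> g j4" unfolding j4_def by (rule LeastI[of _ i1]) (use gap i1 in simp)
    have "j4 \<le> i1" unfolding j4_def by (rule Least_le) (use gap i1 in simp)
    then show "j4 \<le> q" using i1 by simp
  qed
  have j: "hif + 2 * c \<le> g j" "j \<le> j4"
  proof -
    show "hif + 2 * c \<le> g j" unfolding j_def by (rule LeastI[of _ j4]) (use j4 c in simp)
    show "j \<le> j4" unfolding j_def by (rule Least_le) (use j4 c in simp)
  qed
  have before: "g i < hif + 2 * c" if "i < j" for i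
    using not_less_Least[of i "\<lambda>j. hif + 2 * c \<le> g j"] that by (auto simp: j_def not_le)
  have "g 0 = 0" by (simp add: g_def)
  then have j1: "1 \<le> j" using j hif0 c by (cases j) auto
  have step: "\<bar>g (Suc i) - g i\<bar> \<le> L" for i using z[of i] by (simp add: g_def)
  \<comment> \<open>A step is at most \<open>L\<close>, so a path cannot jump over the gap between the two levels.\<close>
  have "j \<noteq> j4"
  proof
    assume e: "j = j4"
    have "g (j - 1) < hif + 2 * c" using before j1 by auto
    then show False using step[of "j - 1"] j1 j4 e c by auto
  qed
  then have j4': "j < j4" "j4 - 1 < q" "Suc (j4 - 1) = j4" using j j4 by auto
  have low: "hif + 3 * c - h < g i" if "i \<le> j" for i
  proof -
    have "g (j4 - 1) - g i < h" using q(2) that j4' by auto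
    then show ?thesis using step[of "j4 - 1"] j4' j4 c by auto
  qed
  show ?thesis
    using j1 j j4 q(3) before low f_le f_hi by (intro exI[of _ j]) auto
qed

section \<open>From two half-lines to one valley\<close>

lemma first_argmin:
  fixes f :: "nat \<Rightarrow> real"
  shows "\<exists>k\<le>t. (\<forall>i\<le>t. f k \<le> f i) \<and> (\<forall>i<k. f k < f i)"
proof (induction t)
  case (Suc t)
  then obtain k where k: "k \<le> t" "\<forall>i\<le>t. f k \<le> f i" "\<forall>i<k. f k < f i" by blast
  show ?case
  proof (cases "f (Suc t) < f k")
    case True
    then show ?thesis using k by (intro exI[of _ "Suc t"]) (force simp: le_Suc_eq less_Suc_eq_le)
  next
    case False
    then show ?thesis using k by (intro exI[of _ k]) (auto simp: le_Suc_eq)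
  qed
qed simp

lemma last_argmin:
  fixes f :: "nat \<Rightarrow> real"
  shows "\<exists>k\<le>t. (\<forall>i\<le>t. f k \<le> f i) \<and> (\<forall>i. k < i \<and> i \<le> t \<longrightarrow> f k < f i)"
proof (induction t)
  case (Suc t)
  then obtain k where k: "k \<le> t" "\<forall>i\<le>t. f k \<le> f i" "\<forall>i. k < i \<and> i \<le> t \<longrightarrow> f k < f i" by blast
  show ?case
  proof (cases "f (Suc t) \<le> f k")
    case True
    then show ?thesis using k by (intro exI[of _ "Suc t"]) (force simp: le_Suc_eq)
  next
    case False
    then show ?thesis using k by (intro exI[of _ k]) (auto simp: le_Suc_eq)
  qed
qed simp

text \<open>Demanded of every minimum, because ties are broken towards the left: this means the first minimum of the path
on the positive half-line and the last one of the reversed path on the negative half-line.\<close>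

definition has_bottom :: "(nat \<Rightarrow> real) \<Rightarrow> real \<Rightarrow> real \<Rightarrow> nat \<Rightarrow> nat \<Rightarrow> bool" where
  "has_bottom f h c w R \<longleftrightarrow> (\<exists>t\<le>R. \<forall>k\<le>t. (\<forall>i\<le>t. f k \<le> f i) \<longrightarrow> bottom_at f h c w t k)"

definition localised_at :: "(int \<Rightarrow> real) \<Rightarrow> nat \<Rightarrow> real \<Rightarrow> nat \<Rightarrow> real \<Rightarrow> int \<Rightarrow> bool" where
  "localised_at V n h w \<epsilon> m \<longleftrightarrow>
     (walk_op (pot_walk V) ^^ n) (indicator (- {y. \<bar>real_of_int (y - m)\<bar> \<le> real w})) 0 \<le> \<epsilon> \<and>
     (\<exists>l r. valley_shape h (interp V) l (of_int m) r \<and> l < 0 \<and> 0 \<le> r)"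

text \<open>The bottom is on the right when the maximum on the left is the larger one: the walk then
finds the bottom before it crosses the left barrier. The potential on the left up to this barrier is confined between \<open>hif + 3 * c - h\<close> and
\<open>hif + 2 * c\<close>, which bounds all climbs there by \<open>h - c\<close>.\<close>

lemma localised_right:
  fixes V :: "int \<Rightarrow> real" and y z :: "nat \<Rightarrow> real"
  assumes V: "\<And>i. V (int i) = psum y i" "\<And>i. V (- int i) = psum z i" "\<And>x. \<bar>V x - V (x - 1)\<bar> \<le> L"
    and n: "n > 0" "real n = exp h" and c: "0 < c" "L \<le> c" "c < h"
    and bot: "has_bottom (psum y) h c w R"
    and run_y: "run (drawup_step h) (0, 0, 0) y R = (xf, lof, hif)"
    and run_z: "run (drawup_step h) (0, 0, 0) z R = (xg, lo_g, hig)"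
    and gap: "hif + 4 * c \<le> hig"
    and unbounded: "\<And>B. \<exists>i. psum y i \<le> B" "\<And>B. \<exists>i. psum z i \<le> B"
  shows "\<exists>m. localised_at V n h w (9 * (1 + exp L) * (2 * real R)\<^sup>2 * exp (- (c - L))) m"
proof -
  let ?f = "psum y" and ?g = "psum z"
  have h: "0 < h" using c by linarith
  have L0: "0 \<le> L" using V(3)[of 0] by linarith
  obtain t where t: "t \<le> R" "\<And>k. k \<le> t \<Longrightarrow> (\<forall>i\<le>t. ?f k \<le> ?f i) \<Longrightarrow> bottom_at ?f h c w t k"
    using bot unfolding has_bottom_def by blast
  obtain k where k: "k \<le> t" "\<forall>i\<le>t. ?f k \<le> ?f i" "\<forall>i<k. ?f k < ?f i"
    using first_argmin[of t ?f] by blast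
  have bk: "bottom_at ?f h c w t k" using t(2)[OF k(1,2)] .
  then have high: "?f k + h + c \<le> ?f t" and rise: "\<And>i j. i \<le> j \<Longrightarrow> j \<le> k \<Longrightarrow> ?f j - ?f i \<le> h - c"
    and window: "\<And>i. i \<le> t \<Longrightarrow> i + w < k \<or> k + w < i \<Longrightarrow> ?f k + c \<le> ?f i"
    unfolding bottom_at_def by blast+
  have zL: "\<bar>z i\<bar> \<le> L" for i
  proof -
    have e: "- int (Suc i) = - int i - 1" by simp
    have "z i = V (- int (Suc i)) - V (- int i)" by (simp only: V(2) psum_simps)
    then show ?thesis using V(3)[of "- int i"] unfolding e by (simp only: abs_minus_commute)
  qed
  obtain j where j: "1 \<le> j" "j \<le> R" "hif + 2 * c \<le> ?g j" "\<And>i. i < j \<Longrightarrow> ?g i < hif + 2 * c"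
    "\<And>i. i \<le> j \<Longrightarrow> hif + 3 * c - h < ?g i" "\<And>i. i \<le> k \<Longrightarrow> ?f i \<le> hif" "?f k + h \<le> hif"
    using opposite_barrier[OF c zL bk t(1) run_y run_z gap] by blast
  define a m b where "a = - int j" and "m = int k" and "b = int t"
  have Va: "V a = ?g j" and Vm: "V m = ?f k" and Vb: "V b = ?f t"
    by (simp_all only: a_def m_def b_def V)
  have tk: "k < t" using high h c k(1) by (cases "k = t") auto
  have left: "\<exists>i\<le>j. x = - int i" if "a \<le> x" "x \<le> 0" for x
    using that by (intro exI[of _ "nat (- x)"]) (auto simp: a_def)
  have right: "\<exists>i. x = int i" if "0 \<le> x" for x
    using that by (intro exI[of _ "nat x"]) auto
  have left_low: "hif + 3 * c - h < V x" if "a \<le> x" "x \<le> 0" for x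
    using left[OF that] j(5) V(2) by auto
  have left_high: "V x \<le> V a \<and> (x \<noteq> a \<longrightarrow> V x < hif + 2 * c)" if x: "a \<le> x" "x \<le> 0" for x
  proof -
    obtain i where i: "i \<le> j" "x = - int i" using left[OF x] by blast
    show ?thesis
    proof (cases "i = j")
      case True
      then show ?thesis using i by (simp add: a_def)
    next
      case False
      then have "?g i < hif + 2 * c" using i j(4) by simp
      then show ?thesis using i j(3) Va V(2) by auto
    qed
  qed
  have right_high: "V x \<le> hif" if "0 \<le> x" "x \<le> m" for x
    using right[OF that(1)] that j(6) V(1) by (auto simp: m_def)
  have rise': "V x' - V x \<le> h - c" if x: "a \<le> x" "x \<le> x'" "x' \<le> m" for x x'
  proof -
    consider "0 \<le> x" | "x < 0" "0 \<le> x'" | "x < 0" "x' < 0" "x = x'" | "x' < 0" "x < x'" using x by linarith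
    then show ?thesis
    proof cases
      case 1
      then obtain i i' where "x = int i" "x' = int i'" using right[of x] right[of x'] x by force
      then show ?thesis using rise[of i i'] x V(1) by (auto simp: m_def)
    next
      case 2
      then show ?thesis using left_low[of x] right_high[of x'] x c by simp
    next
      case 3
      then show ?thesis using c by simp
    next
      case 4
      then show ?thesis using left_low[of x] left_high[of x'] x c by simp
    qed
  qed
  have far: "V m + c \<le> V x" if x: "a \<le> x" "x \<le> b" "real w < \<bar>real_of_int (x - m)\<bar>" for x
  proof (cases "0 \<le> x")
    case True
    then obtain i where i: "x = int i" using right by blast
    have "i + w < k \<or> k + w < i" using x(3) unfolding i m_def by linarith
    then show ?thesis using window[of i] x i V(1) Vm by (auto simp: b_def)
  next
    case False
    then show ?thesis using left_low[of x] x j(7) Vm c by simp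
  qed
  have "(walk_op (pot_walk V) ^^ n) (indicator (- {y. \<bar>real_of_int (y - m)\<bar> \<le> real w})) 0
      \<le> 9 * (1 + exp L) * (2 * real R)\<^sup>2 * exp (- (c - L))"
  proof (rule localisation_right[where V = V and L = L and a = a and b = b and c = c, OF V(3) n])
    show "a < 0" "0 \<le> m" "m \<le> b" using j(1) tk by (auto simp: a_def m_def b_def)
    show "real_of_int (b - a) \<le> 2 * real R" using t(1) j(2) by (simp add: a_def b_def)
    show "c - L \<le> c" using L0 by simp
    show "V m + h + c \<le> V a" "V m + h + c \<le> V b" using Va Vm Vb j(3,7) high c by linarith+
    show "V m + c \<le> V x" if "a \<le> x" "x \<le> b" "real w < \<bar>real_of_int (x - m)\<bar>" for x using far that .
    show "V x' - V x \<le> h - (c - L)" if "a \<le> x" "x \<le> x'" "x' \<le> m" for x x'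
      using rise'[OF that] L0 by linarith
    show "V x + c \<le> V a" if "0 \<le> x" "x \<le> m" for x
      using right_high[OF that] Va j(3) c by linarith
  qed
  moreover have "\<exists>l r. valley_shape h (interp V) l (of_int m) r \<and> l < 0 \<and> 0 \<le> r"
  proof (rule valley_shape_exists[OF h, where a = a and b = b])
    show "a < m" "m < b" using j(1) tk by (auto simp: a_def m_def b_def)
    show "V m < V x" if "a \<le> x" "x < m" for x
    proof (cases "0 \<le> x")
      case True
      then obtain i where "x = int i" using right by blast
      then show ?thesis using k(3) that V(1) Vm by (auto simp: m_def)
    next
      case False
      then show ?thesis using left_low[of x] that j(7) Vm c by simp
    qed
    show "V m \<le> V x" if "m \<le> x" "x \<le> b" for x
    proof -
      have "0 \<le> x" using that by (simp add: m_def)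
      then obtain i where "x = int i" using right by blast
      then show ?thesis using k(2) that V(1) Vm by (auto simp: b_def)
    qed
    show "V m + h \<le> V a" "V m + h \<le> V b" using Va Vm Vb j(3,7) high c by linarith+
    show "\<exists>x\<le>a. V x \<le> B" for B
    proof -
      obtain i where i: "?g i \<le> min B (Min (?g ` {..j}) - 1)" using unbounded(2) by blast
      have "\<not> i \<le> j"
      proof
        assume "i \<le> j"
        then have "Min (?g ` {..j}) \<le> ?g i" by (intro Min_le) auto
        then show False using i by linarith
      qed
      then show ?thesis using i V(2) by (intro exI[of _ "- int i"]) (auto simp: a_def)
    qed
    show "\<exists>x\<ge>b. V x \<le> B" for B
    proof -
      obtain i where i: "?f i \<le> min B (Min (?f ` {..t}) - 1)" using unbounded(1) by blast
      have "\<not> i \<le> t"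
      proof
        assume "i \<le> t"
        then have "Min (?f ` {..t}) \<le> ?f i" by (intro Min_le) auto
        then show False using i by linarith
      qed
      then show ?thesis using i V(1) by (intro exI[of _ "int i"]) (auto simp: b_def)
    qed
    show "(0 \<le> m \<and> (\<forall>x x'. a \<le> x \<and> x \<le> x' \<and> x' \<le> m \<longrightarrow> V x' - V x < h) \<and> (\<forall>x. 0 \<le> x \<and> x \<le> m \<longrightarrow> V x < V a)) \<or>
      (m \<le> 0 \<and> (\<forall>x x'. m \<le> x \<and> x \<le> x' \<and> x' \<le> b \<longrightarrow> V x - V x' < h) \<and> (\<forall>x. m \<le> x \<and> x \<le> 0 \<longrightarrow> V x < V b))"
    proof (intro disjI1 conjI allI impI)
      show "0 \<le> m" by (simp add: m_def)
      show "V x' - V x < h" if "a \<le> x \<and> x \<le> x' \<and> x' \<le> m" for x x'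
        using rise'[of x x'] that c by linarith
      show "V x < V a" if "0 \<le> x \<and> x \<le> m" for x
        using right_high[of x] that Va j(3) c by linarith
    qed
  qed
  ultimately show ?thesis unfolding localised_at_def by blast
qed

lemma localised_left:
  fixes V :: "int \<Rightarrow> real" and y z :: "nat \<Rightarrow> real"
  assumes V: "\<And>i. V (- int i) = psum y i" "\<And>i. V (int i) = psum z i" "\<And>x. \<bar>V x - V (x - 1)\<bar> \<le> L"
    and n: "n > 0" "real n = exp h" and c: "0 < c" "L \<le> c" "c < h"
    and bot: "has_bottom (psum y) h c w R"
    and run_y: "run (drawup_step h) (0, 0, 0) y R = (xf, lof, hif)"
    and run_z: "run (drawup_step h) (0, 0, 0) z R = (xg, lo_g, hig)"
    and gap: "hif + 4 * c \<le> hig"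
    and unbounded: "\<And>B. \<exists>i. psum y i \<le> B" "\<And>B. \<exists>i. psum z i \<le> B"
  shows "\<exists>m. localised_at V n h w (9 * (1 + exp L) * (2 * real R)\<^sup>2 * exp (- (c - L))) m"
proof -
  let ?f = "psum y" and ?g = "psum z"
  have h: "0 < h" using c by linarith
  have L0: "0 \<le> L" using V(3)[of 0] by linarith
  obtain t where t: "t \<le> R" "\<And>k. k \<le> t \<Longrightarrow> (\<forall>i\<le>t. ?f k \<le> ?f i) \<Longrightarrow> bottom_at ?f h c w t k"
    using bot unfolding has_bottom_def by blast
  obtain k where k: "k \<le> t" "\<forall>i\<le>t. ?f k \<le> ?f i" "\<forall>i. k < i \<and> i \<le> t \<longrightarrow> ?f k < ?f i"
    using last_argmin[of t ?f] by blast
  have bk: "bottom_at ?f h c w t k" using t(2)[OF k(1,2)] .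
  then have high: "?f k + h + c \<le> ?f t" and rise: "\<And>i j. i \<le> j \<Longrightarrow> j \<le> k \<Longrightarrow> ?f j - ?f i \<le> h - c"
    and window: "\<And>i. i \<le> t \<Longrightarrow> i + w < k \<or> k + w < i \<Longrightarrow> ?f k + c \<le> ?f i"
    unfolding bottom_at_def by blast+
  have zL: "\<bar>z i\<bar> \<le> L" for i
  proof -
    have e: "int (Suc i) = int i + 1" by simp
    have "z i = V (int (Suc i)) - V (int i)" by (simp only: V(2) psum_simps)
    then show ?thesis using V(3)[of "int i + 1"] unfolding e by simp
  qed
  obtain j where j: "1 \<le> j" "j \<le> R" "hif + 2 * c \<le> ?g j" "\<And>i. i < j \<Longrightarrow> ?g i < hif + 2 * c"
    "\<And>i. i \<le> j \<Longrightarrow> hif + 3 * c - h < ?g i" "\<And>i. i \<le> k \<Longrightarrow> ?f i \<le> hif" "?f k + h \<le> hif"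
    using opposite_barrier[OF c zL bk t(1) run_y run_z gap] by blast
  define a m b where "a = - int t" and "m = - int k" and "b = int j"
  have Va: "V a = ?f t" and Vm: "V m = ?f k" and Vb: "V b = ?g j"
    by (simp_all only: a_def m_def b_def V)
  have tk: "k < t" using high h c k(1) by (cases "k = t") auto
  have right: "\<exists>i\<le>j. x = int i" if "0 \<le> x" "x \<le> b" for x
    using that by (intro exI[of _ "nat x"]) (auto simp: b_def)
  have left: "\<exists>i. x = - int i" if "x \<le> 0" for x
    using that by (intro exI[of _ "nat (- x)"]) auto
  have right_low: "hif + 3 * c - h < V x" if "0 \<le> x" "x \<le> b" for x
    using right[OF that] j(5) V(2) by auto
  have right_high: "V x \<le> V b \<and> (x \<noteq> b \<longrightarrow> V x < hif + 2 * c)" if x: "0 \<le> x" "x \<le> b" for x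
  proof -
    obtain i where i: "i \<le> j" "x = int i" using right[OF x] by blast
    show ?thesis
    proof (cases "i = j")
      case True
      then show ?thesis using i by (simp add: b_def)
    next
      case False
      then have "?g i < hif + 2 * c" using i j(4) by simp
      then show ?thesis using i j(3) Vb V(2) by auto
    qed
  qed
  have left_high: "V x \<le> hif" if "m \<le> x" "x \<le> 0" for x
    using left[OF that(2)] that j(6) V(1) by (auto simp: m_def)
  have rise': "V x - V x' \<le> h - c" if x: "m \<le> x" "x \<le> x'" "x' \<le> b" for x x'
  proof -
    consider "x' \<le> 0" | "x \<le> 0" "0 < x'" | "0 < x" "x = x'" | "0 < x" "x < x'" using x by linarith
    then show ?thesis
    proof cases
      case 1
      then obtain i i' where "x = - int i" "x' = - int i'" using left[of x] left[of x'] x by force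
      then show ?thesis using rise[of i' i] x V(1) by (auto simp: m_def)
    next
      case 2
      then show ?thesis using right_low[of x'] left_high[of x] x c by simp
    next
      case 3
      then show ?thesis using c by simp
    next
      case 4
      then show ?thesis using right_low[of x'] right_high[of x] x c by simp
    qed
  qed
  have far: "V m + c \<le> V x" if x: "a \<le> x" "x \<le> b" "real w < \<bar>real_of_int (x - m)\<bar>" for x
  proof (cases "x \<le> 0")
    case True
    then obtain i where i: "x = - int i" using left by blast
    have "i + w < k \<or> k + w < i" using x(3) unfolding i m_def by linarith
    then show ?thesis using window[of i] x i V(1) Vm by (auto simp: a_def)
  next
    case False
    then show ?thesis using right_low[of x] x j(7) Vm c by simp
  qed
  have "(walk_op (pot_walk V) ^^ n) (indicator (- {y. \<bar>real_of_int (y - m)\<bar> \<le> real w})) 0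
      \<le> 9 * (1 + exp L) * (2 * real R)\<^sup>2 * exp (- (c - L))"
  proof (rule localisation_left[where V = V and L = L and a = a and b = b and c = c, OF V(3) n])
    show "a \<le> m" "m \<le> 0" "0 < b" using j(1) tk by (auto simp: a_def m_def b_def)
    show "real_of_int (b - a) \<le> 2 * real R" using t(1) j(2) by (simp add: a_def b_def)
    show "c - L \<le> c - L" by simp
    show "V m + h + c \<le> V a" "V m + h + c \<le> V b" using Va Vm Vb j(3,7) high c by linarith+
    show "V m + c \<le> V x" if "a \<le> x" "x \<le> b" "real w < \<bar>real_of_int (x - m)\<bar>" for x using far that .
    show "V x - V x' \<le> h - (c - L)" if "m \<le> x" "x \<le> x'" "x' \<le> b" for x x'
      using rise'[OF that] L0 by linarith
    show "V x + c \<le> V b" if "m \<le> x" "x \<le> 0" for x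
      using left_high[OF that] Vb j(3) c by linarith
  qed
  moreover have "\<exists>l r. valley_shape h (interp V) l (of_int m) r \<and> l < 0 \<and> 0 \<le> r"
  proof (rule valley_shape_exists[OF h, where a = a and b = b])
    show "a < m" "m < b" using j(1) tk by (auto simp: a_def m_def b_def)
    show "V m < V x" if "a \<le> x" "x < m" for x
    proof -
      have "x \<le> 0" using that by (simp add: m_def)
      then obtain i where "x = - int i" using left by blast
      then show ?thesis using k(3) that V(1) Vm by (auto simp: m_def a_def)
    qed
    show "V m \<le> V x" if "m \<le> x" "x \<le> b" for x
    proof (cases "x \<le> 0")
      case True
      then obtain i where "x = - int i" using left by blast
      then show ?thesis using k(1,2) that V(1) Vm by (auto simp: m_def)
    next
      case False
      then show ?thesis using right_low[of x] that j(7) Vm c by simp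
    qed
    show "V m + h \<le> V a" "V m + h \<le> V b" using Va Vm Vb j(3,7) high c by linarith+
    show "\<exists>x\<le>a. V x \<le> B" for B
    proof -
      obtain i where i: "?f i \<le> min B (Min (?f ` {..t}) - 1)" using unbounded(1) by blast
      have "\<not> i \<le> t"
      proof
        assume "i \<le> t"
        then have "Min (?f ` {..t}) \<le> ?f i" by (intro Min_le) auto
        then show False using i by linarith
      qed
      then show ?thesis using i V(1) by (intro exI[of _ "- int i"]) (auto simp: a_def)
    qed
    show "\<exists>x\<ge>b. V x \<le> B" for B
    proof -
      obtain i where i: "?g i \<le> min B (Min (?g ` {..j}) - 1)" using unbounded(2) by blast
      have "\<not> i \<le> j"
      proof
        assume "i \<le> j"
        then have "Min (?g ` {..j}) \<le> ?g i" by (intro Min_le) auto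
        then show False using i by linarith
      qed
      then show ?thesis using i V(2) by (intro exI[of _ "int i"]) (auto simp: b_def)
    qed
    show "(0 \<le> m \<and> (\<forall>x x'. a \<le> x \<and> x \<le> x' \<and> x' \<le> m \<longrightarrow> V x' - V x < h) \<and> (\<forall>x. 0 \<le> x \<and> x \<le> m \<longrightarrow> V x < V a)) \<or>
      (m \<le> 0 \<and> (\<forall>x x'. m \<le> x \<and> x \<le> x' \<and> x' \<le> b \<longrightarrow> V x - V x' < h) \<and> (\<forall>x. m \<le> x \<and> x \<le> 0 \<longrightarrow> V x < V b))"
    proof (intro disjI2 conjI allI impI)
      show "m \<le> 0" by (simp add: m_def)
      show "V x - V x' < h" if "m \<le> x \<and> x \<le> x' \<and> x' \<le> b" for x x'
        using rise'[of x x'] that c by linarith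
      show "V x < V b" if "m \<le> x \<and> x \<le> 0" for x
        using left_high[of x] that Vb j(3) c by linarith
    qed
  qed
  ultimately show ?thesis unfolding localised_at_def by blast
qed

definition log_odds :: "env \<Rightarrow> int \<Rightarrow> real" where
  "log_odds \<omega> x = ln ((1 - \<omega> x) / \<omega> x)"

definition right_steps :: "env \<Rightarrow> nat \<Rightarrow> real" where
  "right_steps \<omega> k = log_odds \<omega> (1 + int k)"

definition left_steps :: "env \<Rightarrow> nat \<Rightarrow> real" where
  "left_steps \<omega> k = - log_odds \<omega> (- int k)"

lemma pot_step: "pot \<omega> x = pot \<omega> (x - 1) + log_odds \<omega> x"
proof -
  consider "x \<ge> 1" | "x = 0" | "x < 0" by linarith
  then show ?thesis
  proof cases
    case 1
    then have "{1..x} = insert x {1..x - 1}" by auto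
    then show ?thesis using 1 by (simp add: pot_def log_odds_def)
  next
    case 2
    then show ?thesis by (simp add: pot_def log_odds_def)
  next
    case 3
    then have "{x..0} = insert x {x + 1..0}" by auto
    then show ?thesis using 3 by (simp add: pot_def log_odds_def)
  qed
qed

lemma pot_right: "pot \<omega> (int i) = psum (right_steps \<omega>) i"
proof (induction i)
  case (Suc i)
  then show ?case using pot_step[of \<omega> "int (Suc i)"] by (simp add: right_steps_def algebra_simps)
qed (simp add: pot_def)

lemma pot_left: "pot \<omega> (- int i) = psum (left_steps \<omega>) i"
proof (induction i)
  case (Suc i)
  have e: "- int (Suc i) = - int i - 1" by simp
  show ?case using pot_step[of \<omega> "- int i"] Suc.IH unfolding e by (simp add: left_steps_def)
qed (simp add: pot_def)

lemma pot_walk_pot: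
  assumes "\<And>x. 0 < \<omega> x \<and> \<omega> x < 1"
  shows "pot_walk (pot \<omega>) = \<omega>"
proof
  fix x
  have p: "0 < \<omega> x" "0 < 1 - \<omega> x" using assms[of x] by auto
  have "- pot \<omega> (x - 1) = - pot \<omega> x + log_odds \<omega> x" using pot_step[of \<omega> x] by simp
  then have "exp (- pot \<omega> (x - 1)) = exp (- pot \<omega> x) * exp (log_odds \<omega> x)" by (simp only: exp_add)
  also have "exp (log_odds \<omega> x) = (1 - \<omega> x) / \<omega> x" using p by (simp add: log_odds_def)
  finally have "exp (- pot \<omega> (x - 1)) = exp (- pot \<omega> x) * ((1 - \<omega> x) / \<omega> x)" .
  moreover have "0 < exp (- pot \<omega> x) + exp (- pot \<omega> (x - 1))" by (intro add_pos_pos) simp_all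
  ultimately show "pot_walk (pot \<omega>) x = \<omega> x"
    using p by (simp add: pot_walk_def edge_prob_def field_simps)
qed

lemma log_odds_bounded:
  assumes "0 < \<kappa>" "\<kappa> \<le> \<omega> x" "\<omega> x \<le> 1 - \<kappa>"
  shows "\<bar>log_odds \<omega> x\<bar> \<le> ln ((1 - \<kappa>) / \<kappa>)"
proof -
  have p: "0 < \<omega> x" "0 < 1 - \<omega> x" "0 < 1 - \<kappa>" using assms by linarith+
  have "ln ((1 - \<omega> x) / \<omega> x) \<le> ln ((1 - \<kappa>) / \<kappa>)"
    using p assms by (subst ln_le_cancel_iff) (auto intro!: frac_le)
  moreover have "ln (\<omega> x / (1 - \<omega> x)) \<le> ln ((1 - \<kappa>) / \<kappa>)"
    using p assms by (subst ln_le_cancel_iff) (auto intro!: frac_le)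
  moreover have "ln (\<omega> x / (1 - \<omega> x)) = - log_odds \<omega> x"
    using p by (simp add: log_odds_def ln_div)
  ultimately show ?thesis by (simp add: log_odds_def[symmetric] abs_le_iff)
qed

text \<open>The machines on the two half-lines together describe one valley, whose bottom is on the side with the smaller
maximum.\<close>

lemma environment_localised:
  assumes \<omega>: "0 < \<kappa>" "\<And>x. \<kappa> \<le> \<omega> x \<and> \<omega> x \<le> 1 - \<kappa>" and L: "L = ln ((1 - \<kappa>) / \<kappa>)"
    and n: "n > 1" and h: "h = ln (real n)" and c: "0 < c" "L \<le> c" "c < h"
    and bot: "has_bottom (psum (right_steps \<omega>)) h c w R" "has_bottom (psum (left_steps \<omega>)) h c w R"
    and run: "run (drawup_step h) (0, 0, 0) (right_steps \<omega>) R = (x1, lo1, hi1)"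
      "run (drawup_step h) (0, 0, 0) (left_steps \<omega>) R = (x2, lo2, hi2)"
    and gap: "4 * c \<le> \<bar>hi1 - hi2\<bar>"
    and unbounded: "\<And>B. \<exists>i. psum (right_steps \<omega>) i \<le> B" "\<And>B. \<exists>i. psum (left_steps \<omega>) i \<le> B"
    and B: "\<And>x. \<bar>real_of_int x - valley_bottom n \<omega>\<bar> \<le> real w \<Longrightarrow> x \<in> B"
  shows "1 - 9 * (1 + exp L) * (2 * real R)\<^sup>2 * exp (- (c - L)) \<le> \<P>(X in quenched_law \<omega> 0. X n \<in> B)"
proof -
  let ?V = "pot \<omega>" and ?\<epsilon> = "9 * (1 + exp L) * (2 * real R)\<^sup>2 * exp (- (c - L))"
  have p: "0 < \<omega> x \<and> \<omega> x < 1" for x using \<omega>(1) \<omega>(2)[of x] by linarith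
  then have p': "0 \<le> \<omega> x \<and> \<omega> x \<le> 1" for x by (meson less_imp_le)
  have V3: "\<bar>?V x - ?V (x - 1)\<bar> \<le> L" for x
    using pot_step[of \<omega> x] log_odds_bounded[of \<kappa> \<omega> x] \<omega> L by simp
  have n': "n > 0" "real n = exp h" using n h by auto
  have "hi1 + 4 * c \<le> hi2 \<or> hi2 + 4 * c \<le> hi1" using gap by linarith
  then obtain m where m: "localised_at ?V n h w ?\<epsilon> m"
    using localised_right[OF pot_right pot_left V3 n' c bot(1) run _ unbounded]
      localised_left[OF pot_left pot_right V3 n' c bot(2) run(2,1) _ unbounded(2,1)] by blast
  then obtain l r where "valley_shape h (interp ?V) l (of_int m) r" "l < 0" "0 \<le> r"
    unfolding localised_at_def by blast
  then have vb: "valley_bottom n \<omega> = of_int m"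
    using valley_bottom_eqI[of n \<omega> l "of_int m" r] by (simp add: pot_interp_eq_interp h)
  let ?W = "{y. \<bar>real_of_int (y - m)\<bar> \<le> real w}"
  have "1 = (walk_op \<omega> ^^ n) (\<lambda>_. 1) 0"
  proof -
    have "(walk_op \<omega> ^^ k) (\<lambda>_. 1) = (\<lambda>_. 1)" for k
      by (induction k) (simp_all add: walk_op_def fun_eq_iff)
    then show ?thesis by simp
  qed
  also have "\<dots> \<le> (walk_op \<omega> ^^ n) (\<lambda>x. indicator B x + indicator (- ?W) x) 0"
    using B vb by (intro walk_op_funpow_mono p') (auto simp: indicator_def)
  also have "\<dots> = (walk_op \<omega> ^^ n) (indicator B) 0 + (walk_op \<omega> ^^ n) (indicator (- ?W)) 0"
    by (simp add: walk_op_funpow_add)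
  also have "(walk_op \<omega> ^^ n) (indicator (- ?W)) 0 \<le> ?\<epsilon>"
    using m unfolding localised_at_def pot_walk_pot[where \<omega> = \<omega>, OF p] by blast
  finally show ?thesis
    unfolding quenched_law_eq_walk_op[where \<omega> = \<omega>, OF p'] by simp
qed

section \<open>The random environment\<close>

context bounded_walk begin

lemma negated: "bounded_walk M (\<lambda>k \<omega>. - \<xi> k \<omega>) L v"
proof
  show "indep_vars (\<lambda>_. borel) (\<lambda>k \<omega>. - \<xi> k \<omega>) UNIV"
    by (rule indep_vars_compose2[OF indep]) simp
qed (use bounded mean var v_pos in auto)

lemma AE_reach:
  assumes H: "0 < H"
  shows "AE \<omega> in M. \<exists>j. H \<le> psum (steps \<omega>) j"
proof -
  let ?N = "{\<omega> \<in> space M. \<forall>j. psum (steps \<omega>) j < H}"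
  have [measurable]: "(\<lambda>\<omega>. psum (steps \<omega>) j) \<in> borel_measurable M" for j
    unfolding psum_def by measurable
  have le: "prob ?N \<le> \<epsilon>" if e: "\<epsilon> > 0" for \<epsilon>
  proof -
    define A where "A = max H (2 * (H + L) / \<epsilon>)"
    define r where "r = nat \<lceil>2 * (A + L)\<^sup>2 / (v * \<epsilon>)\<rceil> + 1"
    have A: "H \<le> A" "2 * (H + L) / \<epsilon> \<le> A" by (auto simp: A_def)
    have r: "2 * (A + L)\<^sup>2 / (v * \<epsilon>) \<le> real r" "r > 0" unfolding r_def by linarith+
    have "prob ?N \<le> prob {\<omega> \<in> space M. \<forall>j\<le>r. psum (steps \<omega>) j < H}"
      by (intro finite_measure_mono) auto
    also have "\<dots> \<le> (H + L) / (A + H + L) + (A + L)\<^sup>2 / (v * real r)"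
      by (rule reach_bound[OF H A(1) r(2)])
    also have "(H + L) / (A + H + L) \<le> \<epsilon> / 2"
    proof -
      have "2 * (H + L) \<le> A * \<epsilon>" using A(2) e by (simp add: pos_divide_le_eq)
      also have "\<dots> \<le> (A + H + L) * \<epsilon>" using e H L_nonneg by simp
      finally show ?thesis using A(1) H L_nonneg by (simp add: pos_divide_le_eq mult.commute)
    qed
    also have "(A + L)\<^sup>2 / (v * real r) \<le> \<epsilon> / 2"
    proof -
      have "2 * (A + L)\<^sup>2 \<le> real r * (v * \<epsilon>)" using r(1) e v_pos by (simp add: pos_divide_le_eq)
      then show ?thesis using r(2) v_pos by (simp add: pos_divide_le_eq mult_ac)
    qed
    finally show ?thesis by simp
  qed
  have "prob ?N \<le> 0" by (rule field_le_epsilon) (use le in simp)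
  then have "prob ?N = 0" using measure_nonneg[of M ?N] by linarith
  moreover have "?N \<in> events" by measurable
  ultimately have "AE \<omega> in M. \<omega> \<notin> ?N" by (simp add: prob_eq_0)
  then show ?thesis using AE_space by eventually_elim (auto simp: not_less)
qed

text \<open>Each side of the valley ends where the potential has fallen by \<open>h\<close> behind its highest point, so it has to
come down again; this is where it does.\<close>

lemma AE_unbounded_below: "AE \<omega> in M. \<forall>m::nat. \<exists>j. psum (steps \<omega>) j \<le> - real m"
proof -
  interpret N: bounded_walk M "\<lambda>k \<omega>. - \<xi> k \<omega>" L v by (rule negated)
  have "AE \<omega> in M. \<exists>j. psum (steps \<omega>) j \<le> - real m" for m
  proof -
    have neg: "psum (\<lambda>k. - \<xi> k \<omega>) j = - psum (steps \<omega>) j" for \<omega> j by (simp add: psum_def sum_negf)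
    have "AE \<omega> in M. \<exists>j. real m + 1 \<le> psum (\<lambda>k. - \<xi> k \<omega>) j" by (rule N.AE_reach) simp
    then show ?thesis
    proof eventually_elim
      case (elim \<omega>)
      then obtain j where "real m + 1 \<le> - psum (steps \<omega>) j" unfolding neg by blast
      then show ?case by (intro exI[of _ j]) linarith
    qed
  qed
  then show ?thesis by (simp add: AE_all_countable)
qed

text \<open>A run that is not settled has failed or is unfinished.\<close>

lemma not_settled_bound:
  assumes A: "184 \<le> A" and c: "L \<le> c" "0 < c" and h: "(A + 4) * c \<le> h" and w: "4 * A ^ 4 * c\<^sup>2 \<le> v * real w"
    and B: "h + 2 * c \<le> B" and R: "R > 0"
  shows "prob {\<omega> \<in> space M. fst (run (trial_step h c (A * c) (real w)) (Fresh, 0, 0) (steps \<omega>) R) \<noteq> Settled}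
    \<le> 184 / A + (h + 2 * c + L) / (B + h + 2 * c + L) + (B + L)\<^sup>2 / (v * real R)"
proof -
  let ?r = "\<lambda>\<omega>. run (trial_step h c (A * c) (real w)) (Fresh, 0, 0) (steps \<omega>) R"
  have [measurable]: "?r \<in> M \<rightarrow>\<^sub>M state_space"
    by (rule run_measurable[OF trial_step_measurable]) (simp_all add: space_pair_measure)
  have [measurable]: "(\<lambda>\<omega>. psum (steps \<omega>) j) \<in> borel_measurable M" for j
    unfolding psum_def by measurable
  have Ac: "184 * c \<le> A * c" using A c by simp
  have hA: "A * c + 4 * c \<le> h" using h by (simp add: algebra_simps)
  have "0 < 4 * A ^ 4 * c\<^sup>2" using A c by simp
  then have w0: "w > 0" using w by (cases w) auto
  have sub: "{\<omega> \<in> space M. fst (?r \<omega>) \<noteq> Settled} \<subseteq>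
      {\<omega> \<in> space M. fst (?r \<omega>) = Failed} \<union> {\<omega> \<in> space M. \<forall>j\<le>R. psum (steps \<omega>) j < h + 2 * c}"
  proof
    fix \<omega> assume "\<omega> \<in> {\<omega> \<in> space M. fst (?r \<omega>) \<noteq> Settled}"
    then have \<omega>: "\<omega> \<in> space M" "fst (?r \<omega>) \<noteq> Settled" by auto
    obtain k x s where st: "?r \<omega> = (k, x, s)" by (metis prod_cases3)
    show "\<omega> \<in> {\<omega> \<in> space M. fst (?r \<omega>) = Failed} \<union> {\<omega> \<in> space M. \<forall>j\<le>R. psum (steps \<omega>) j < h + 2 * c}"
    proof (cases "k = Failed")
      case True
      then show ?thesis using \<omega> st by simp
    next
      case False
      obtain \<sigma> where inv: "trial_inv h c (A * c) w (psum (steps \<omega>)) R k x s \<sigma>"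
        using trial_run[where y = "steps \<omega>" and L = L, OF _ c(2,1) _ _ w0 st] bounded[OF \<omega>(1)] \<omega> False st hA Ac c by force
      have "psum (steps \<omega>) j < h + 2 * c" if "j \<le> R" for j
        by (rule trial_inv_height[OF inv that c(2)]) simp
      then show ?thesis using \<omega> by simp
    qed
  qed
  have "prob {\<omega> \<in> space M. fst (?r \<omega>) \<noteq> Settled} \<le>
      prob ({\<omega> \<in> space M. fst (?r \<omega>) = Failed} \<union> {\<omega> \<in> space M. \<forall>j\<le>R. psum (steps \<omega>) j < h + 2 * c})"
    by (rule finite_measure_mono[OF sub]) measurable
  also have "\<dots> \<le> prob {\<omega> \<in> space M. fst (?r \<omega>) = Failed} + prob {\<omega> \<in> space M. \<forall>j\<le>R. psum (steps \<omega>) j < h + 2 * c}"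
    by (rule measure_Un_le) measurable
  also have "\<dots> \<le> 184 / A + ((h + 2 * c + L) / (B + (h + 2 * c) + L) + (B + L)\<^sup>2 / (v * real R))"
    using hA Ac c by (intro add_mono trial_bound[OF A c h w] reach_bound B R) linarith
  finally show ?thesis by (simp add: algebra_simps)
qed

end

lemma settled_has_bottom:
  assumes y: "\<And>i. \<bar>y i\<bar> \<le> L" and c: "0 < c" "L \<le> c" "2 * c \<le> u" "u + 4 * c \<le> h" and w: "0 < w"
    and settled: "fst (run (trial_step h c u (real w)) (Fresh, 0, 0) y R) = Settled"
  shows "has_bottom (psum y) h c (2 * w) R"
proof -
  obtain k x s where st: "run (trial_step h c u (real w)) (Fresh, 0, 0) y R = (k, x, s)" by (metis prod_cases3)
  have "\<not> trial_inv h c u w (psum y) R Settled x s \<sigma>" for \<sigma> by (auto dest: trial_inv.running)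
  then show ?thesis using trial_run[where y = y and L = L, OF y c w st] settled st unfolding has_bottom_def by auto
qed

lemma has_bottom_stopped:
  assumes bot: "has_bottom (psum y) h c w R" and h: "0 < h" "0 \<le> c"
    and run: "run (drawup_step h) (0, 0, 0) y R = (x, lo, hi)"
  shows "h \<le> x - lo"
proof -
  obtain t where t: "t \<le> R" "\<forall>k\<le>t. (\<forall>i\<le>t. psum y k \<le> psum y i) \<longrightarrow> bottom_at (psum y) h c w t k"
    using bot unfolding has_bottom_def by blast
  obtain k where k: "k \<le> t" "\<forall>i\<le>t. psum y k \<le> psum y i" using first_argmin[of t "psum y"] by blast
  then have "bottom_at (psum y) h c w t k" using t(2) by blast
  then have "psum y k + h + c \<le> psum y t" unfolding bottom_at_def by blast
  then show ?thesis using h k t by (intro drawup_run_stopped[OF h(1) run, of k t]) auto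
qed

locale random_environment = prob_space P for P :: "env measure" +
  fixes \<kappa> :: real
  assumes kappa: "\<kappa> > 0"
    and sets_P: "sets P = sets (PiM UNIV (\<lambda>_. restrict_space borel {\<kappa>..1 - \<kappa>}))"
    and indep_coord: "indep_vars (\<lambda>_. borel) (\<lambda>x \<omega>. \<omega> x) UNIV"
    and ident: "\<And>x y. distr P borel (\<lambda>\<omega>. \<omega> x) = distr P borel (\<lambda>\<omega>. \<omega> y)"
    and mean_zero: "\<And>x. expectation (\<lambda>\<omega>. ln (\<omega> x / (1 - \<omega> x))) = 0"
    and var_pos: "\<And>x. expectation (\<lambda>\<omega>. (ln (\<omega> x / (1 - \<omega> x)))\<^sup>2) > 0"
begin

definition L :: real where "L = ln ((1 - \<kappa>) / \<kappa>)"

definition v :: real where "v = expectation (\<lambda>\<omega>. (ln (\<omega> 0 / (1 - \<omega> 0)))\<^sup>2)"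

lemma coord_bounds:
  assumes "\<omega> \<in> space P"
  shows "\<kappa> \<le> \<omega> x \<and> \<omega> x \<le> 1 - \<kappa>"
proof -
  have "space P = space (PiM UNIV (\<lambda>_. restrict_space borel {\<kappa>..1 - \<kappa>}))"
    by (rule sets_eq_imp_space_eq[OF sets_P])
  then show ?thesis using assms by (auto simp: space_PiM space_restrict_space PiE_iff)
qed

lemma coord_measurable [measurable]: "(\<lambda>\<omega>. \<omega> x) \<in> borel_measurable P"
  using indep_coord unfolding indep_vars_def by auto

lemma log_odds_measurable [measurable]: "(\<lambda>\<omega>. log_odds \<omega> x) \<in> borel_measurable P"
  unfolding log_odds_def by measurable

lemma right_steps_measurable [measurable]: "(\<lambda>\<omega>. right_steps \<omega> k) \<in> borel_measurable P"
  unfolding right_steps_def by measurable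

lemma left_steps_measurable [measurable]: "(\<lambda>\<omega>. left_steps \<omega> k) \<in> borel_measurable P"
  unfolding left_steps_def by measurable

lemma log_odds_eq: "\<omega> \<in> space P \<Longrightarrow> log_odds \<omega> x = - ln (\<omega> x / (1 - \<omega> x))"
  using coord_bounds[of \<omega> x] kappa by (simp add: log_odds_def ln_div)

lemma log_odds_le: "\<omega> \<in> space P \<Longrightarrow> \<bar>log_odds \<omega> x\<bar> \<le> L"
  using log_odds_bounded[OF kappa, of \<omega> x] coord_bounds[of \<omega> x] by (simp add: L_def)

lemma log_odds_mean: "expectation (\<lambda>\<omega>. log_odds \<omega> x) = 0"
proof -
  have "expectation (\<lambda>\<omega>. log_odds \<omega> x) = expectation (\<lambda>\<omega>. - ln (\<omega> x / (1 - \<omega> x)))"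
    by (intro Bochner_Integration.integral_cong log_odds_eq) auto
  then show ?thesis using mean_zero[of x] by simp
qed

lemma log_odds_var: "expectation (\<lambda>\<omega>. (log_odds \<omega> x)\<^sup>2) = v"
proof -
  have "expectation (\<lambda>\<omega>. (log_odds \<omega> x)\<^sup>2) = expectation (\<lambda>\<omega>. (ln (\<omega> x / (1 - \<omega> x)))\<^sup>2)"
    by (intro Bochner_Integration.integral_cong) (auto simp: log_odds_eq)
  also have "\<dots> = (\<integral>t. (ln (t / (1 - t)))\<^sup>2 \<partial>distr P borel (\<lambda>\<omega>. \<omega> x))"
    by (subst integral_distr) auto
  also have "\<dots> = (\<integral>t. (ln (t / (1 - t)))\<^sup>2 \<partial>distr P borel (\<lambda>\<omega>. \<omega> 0))"
    by (simp only: ident[of x 0])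
  also have "\<dots> = v" unfolding v_def by (subst integral_distr) auto
  finally show ?thesis .
qed

lemma indep_steps:
  assumes inj: "inj f" and g: "\<And>k. g k \<in> borel_measurable borel"
  shows "indep_vars (\<lambda>_. borel) (\<lambda>k::nat. \<lambda>\<omega>. g k (\<omega> (f k)) :: real) UNIV"
proof -
  have "indep_vars (\<lambda>k. PiM {f k} (\<lambda>_. borel)) (\<lambda>k \<omega>. restrict (\<lambda>i. \<omega> i) {f k}) UNIV"
    by (rule indep_vars_restrict[OF indep_coord]) (use inj in \<open>auto simp: disjoint_family_on_def inj_def\<close>)
  then have "indep_vars (\<lambda>_. borel) (\<lambda>k \<omega>. g k (restrict (\<lambda>i. \<omega> i) {f k} (f k))) UNIV"
  proof (rule indep_vars_compose2)
    fix k
    have "(\<lambda>x. x (f k)) \<in> PiM {f k} (\<lambda>_. borel) \<rightarrow>\<^sub>M (borel :: real measure)"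
      by (rule measurable_component_singleton) simp
    from measurable_compose[OF this g[of k]]
    show "(\<lambda>x. g k (x (f k))) \<in> PiM {f k} (\<lambda>_. borel) \<rightarrow>\<^sub>M borel" .
  qed
  then show ?thesis by simp
qed

sublocale right: bounded_walk P "\<lambda>k \<omega>. right_steps \<omega> k" L v
proof
  show "indep_vars (\<lambda>_. borel) (\<lambda>k \<omega>. right_steps \<omega> k) UNIV"
    unfolding right_steps_def log_odds_def
    by (rule indep_steps[of "\<lambda>k. 1 + int k" "\<lambda>k t. ln ((1 - t) / t)"]) (auto simp: inj_def)
qed (use log_odds_le log_odds_mean log_odds_var var_pos[of 0] in \<open>auto simp: right_steps_def v_def\<close>)

sublocale left: bounded_walk P "\<lambda>k \<omega>. left_steps \<omega> k" L v
proof
  show "indep_vars (\<lambda>_. borel) (\<lambda>k \<omega>. left_steps \<omega> k) UNIV"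
    unfolding left_steps_def log_odds_def
    by (rule indep_steps[of "\<lambda>k. - int k" "\<lambda>k t. - ln ((1 - t) / t)"]) (auto simp: inj_def)
qed (use log_odds_le log_odds_mean log_odds_var var_pos[of 0] in \<open>auto simp: left_steps_def v_def\<close>)

lemma machines_measurable [measurable]:
  "(\<lambda>\<omega>. run (trial_step h c u (real w)) (Fresh, 0, 0) (right_steps \<omega>) R) \<in> P \<rightarrow>\<^sub>M state_space"
  "(\<lambda>\<omega>. run (trial_step h c u (real w)) (Fresh, 0, 0) (left_steps \<omega>) R) \<in> P \<rightarrow>\<^sub>M state_space"
  "(\<lambda>\<omega>. run (drawup_step h) (0, 0, 0) (right_steps \<omega>) R) \<in> P \<rightarrow>\<^sub>M borel \<Otimes>\<^sub>M borel \<Otimes>\<^sub>M borel"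
  "(\<lambda>\<omega>. run (drawup_step h) (0, 0, 0) (left_steps \<omega>) R) \<in> P \<rightarrow>\<^sub>M borel \<Otimes>\<^sub>M borel \<Otimes>\<^sub>M borel"
  by (rule run_measurable[OF trial_step_measurable] run_measurable[OF drawup_step_measurable]; simp add: space_pair_measure)+

lemma psum_measurable [measurable]:
  "(\<lambda>\<omega>. psum (right_steps \<omega>) j) \<in> borel_measurable P" "(\<lambda>\<omega>. psum (left_steps \<omega>) j) \<in> borel_measurable P"
  unfolding psum_def by measurable

text \<open>The potential on the left is a function of \<open>\<omega> x\<close> with \<open>x \<le> 0\<close>, the one on the right of those with
\<open>x \<ge> 1\<close>. Given the maximum on the left, \<open>drawup_bound\<close> applies to the right with a window of length
\<open>8 * c\<close> around it.\<close>

lemma near_tie_bound: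
  fixes R :: nat
  assumes c: "0 < c" "8 * c < h"
  defines "dr \<equiv> \<lambda>\<omega>. run (drawup_step h) (0, 0, 0) (right_steps \<omega>) R"
    and "dl \<equiv> \<lambda>\<omega>. run (drawup_step h) (0, 0, 0) (left_steps \<omega>) R"
  shows "prob {\<omega> \<in> space P. h \<le> fst (dr \<omega>) - fst (snd (dr \<omega>)) \<and> \<bar>snd (snd (dr \<omega>)) - snd (snd (dl \<omega>))\<bar> < 4 * c}
    \<le> (8 * c + 2 * L) / (h + L)"
proof -
  let ?N = "borel \<Otimes>\<^sub>M borel \<Otimes>\<^sub>M borel :: (real \<times> real \<times> real) measure"
  let ?S = "PiM {..0::int} (\<lambda>_. borel :: real measure)" and ?T = "PiM {1::int..} (\<lambda>_. borel :: real measure)"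
  define tie where "tie s t \<longleftrightarrow> h \<le> fst t - fst (snd t) \<and> \<bar>snd (snd t) - snd (snd s)\<bar> < 4 * c"
    for s t :: "real \<times> real \<times> real"
  have ind: "indep_var ?S (\<lambda>\<omega>. restrict (\<lambda>i. \<omega> i) {..0}) ?T (\<lambda>\<omega>. restrict (\<lambda>i. \<omega> i) {1..})"
    by (rule indep_var_restrict[OF indep_coord]) auto
  have dl_m [measurable]: "dl \<in> ?S \<rightarrow>\<^sub>M ?N"
    unfolding dl_def
  proof (rule run_measurable[OF drawup_step_measurable])
    fix k
    have [measurable]: "(\<lambda>x. x (- int k)) \<in> borel_measurable ?S" by (rule measurable_component_singleton) simp
    show "(\<lambda>\<omega>. left_steps \<omega> k) \<in> borel_measurable ?S" unfolding left_steps_def log_odds_def by measurable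
  qed (simp add: space_pair_measure)
  have dr_m [measurable]: "dr \<in> ?T \<rightarrow>\<^sub>M ?N"
    unfolding dr_def
  proof (rule run_measurable[OF drawup_step_measurable])
    fix k
    have [measurable]: "(\<lambda>x. x (1 + int k)) \<in> borel_measurable ?T" by (rule measurable_component_singleton) simp
    show "(\<lambda>\<omega>. right_steps \<omega> k) \<in> borel_measurable ?T" unfolding right_steps_def log_odds_def by measurable
  qed (simp add: space_pair_measure)
  have dr_P [measurable]: "dr \<in> P \<rightarrow>\<^sub>M ?N" and dl_P [measurable]: "dl \<in> P \<rightarrow>\<^sub>M ?N"
    unfolding dr_def dl_def by measurable
  have tie_m [measurable]: "Measurable.pred (?N \<Otimes>\<^sub>M ?N) (\<lambda>p. tie (fst p) (snd p))"
    unfolding tie_def by measurable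
  define g :: "env \<Rightarrow> env \<Rightarrow> ennreal" where "g x y = (if tie (dl x) (dr y) then 1 else 0)" for x y
  have gm: "(\<lambda>(x, y). g x y) \<in> borel_measurable (?S \<Otimes>\<^sub>M ?T)"
  proof -
    have [measurable]: "(\<lambda>p. (dl (fst p), dr (snd p))) \<in> ?S \<Otimes>\<^sub>M ?T \<rightarrow>\<^sub>M ?N \<Otimes>\<^sub>M ?N" by measurable
    have "Measurable.pred (?S \<Otimes>\<^sub>M ?T) (\<lambda>p. tie (dl (fst p)) (dr (snd p)))"
      using measurable_compose[OF \<open>(\<lambda>p. (dl (fst p), dr (snd p))) \<in> _\<close> tie_m] by simp
    then show ?thesis unfolding g_def case_prod_beta' by measurable
  qed
  have res: "dl (restrict (\<lambda>i. \<omega> i) {..0}) = dl \<omega>" "dr (restrict (\<lambda>i. \<omega> i) {1..}) = dr \<omega>" for \<omega>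
    unfolding dl_def dr_def by (rule run_cong; simp add: left_steps_def right_steps_def log_odds_def)+
  have inner: "(\<integral>\<^sup>+\<omega>'. g \<omega> \<omega>' \<partial>P) \<le> ennreal ((8 * c + 2 * L) / (h + L))" for \<omega>
  proof -
    define z where "z = snd (snd (dl \<omega>)) - 4 * c"
    let ?E = "{\<omega>' \<in> space P. case dr \<omega>' of (x, lo, hi) \<Rightarrow> x - lo \<ge> h \<and> z \<le> hi \<and> hi < z + 8 * c}"
    have E: "?E \<in> events" unfolding case_prod_beta' by measurable
    have le: "g \<omega> \<omega>' \<le> indicator ?E \<omega>'" if "\<omega>' \<in> space P" for \<omega>'
      using that by (auto simp: g_def tie_def z_def indicator_def split: prod.splits)
    have "(\<integral>\<^sup>+\<omega>'. g \<omega> \<omega>' \<partial>P) \<le> (\<integral>\<^sup>+\<omega>'. indicator ?E \<omega>' \<partial>P)"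
      by (rule nn_integral_mono[OF le])
    also have "\<dots> = emeasure P ?E" by (rule nn_integral_indicator[OF E])
    also have "\<dots> \<le> ennreal ((8 * c + 2 * L) / (h + L))"
      unfolding emeasure_eq_measure dr_def using right.drawup_bound[where \<eta> = "8 * c" and h = h and n = R and z = z] c
      by (intro ennreal_leI) simp
    finally show ?thesis .
  qed
  let ?E = "{\<omega> \<in> space P. tie (dl \<omega>) (dr \<omega>)}"
  have E: "?E \<in> events"
  proof -
    have "Measurable.pred P (\<lambda>\<omega>. tie (dl \<omega>) (dr \<omega>))"
      using measurable_compose[OF measurable_Pair[OF dl_P dr_P] tie_m] by simp
    then show ?thesis by measurable
  qed
  have "emeasure P ?E = (\<integral>\<^sup>+\<omega>. indicator ?E \<omega> \<partial>P)" using E by simp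
  also have "\<dots> = (\<integral>\<^sup>+\<omega>. g \<omega> \<omega> \<partial>P)"
    by (intro nn_integral_cong) (auto simp: g_def indicator_def)
  also have "\<dots> = (\<integral>\<^sup>+\<omega>. \<integral>\<^sup>+\<omega>'. g \<omega> \<omega>' \<partial>P \<partial>P)"
    using nn_integral_indep[OF ind gm] by (simp add: g_def res)
  also have "\<dots> \<le> (\<integral>\<^sup>+\<omega>. ennreal ((8 * c + 2 * L) / (h + L)) \<partial>P)"
    by (intro nn_integral_mono inner)
  also have "\<dots> = ennreal ((8 * c + 2 * L) / (h + L))" by (simp add: emeasure_space_1)
  finally show ?thesis
    using c right.L_nonneg unfolding emeasure_eq_measure tie_def by (subst (asm) ennreal_le_iff) auto
qed

text \<open>Stability of the valley around the origin, expressed through the machines because these are measurable by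
construction.\<close>

definition good_env :: "real \<Rightarrow> real \<Rightarrow> real \<Rightarrow> nat \<Rightarrow> nat \<Rightarrow> env set" where
  "good_env h c u w R = {\<omega> \<in> space P.
     fst (run (trial_step h c u (real w)) (Fresh, 0, 0) (right_steps \<omega>) R) = Settled \<and>
     fst (run (trial_step h c u (real w)) (Fresh, 0, 0) (left_steps \<omega>) R) = Settled \<and>
     4 * c \<le> \<bar>snd (snd (run (drawup_step h) (0, 0, 0) (right_steps \<omega>) R)) -
       snd (snd (run (drawup_step h) (0, 0, 0) (left_steps \<omega>) R))\<bar> \<and>
     (\<forall>m::nat. \<exists>j. psum (right_steps \<omega>) j \<le> - real m) \<and>
     (\<forall>m::nat. \<exists>j. psum (left_steps \<omega>) j \<le> - real m)}"

lemma good_env_measurable: "good_env h c u w R \<in> events"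
  unfolding good_env_def by measurable

lemma good_env_prob:
  assumes A: "184 \<le> A" and c: "L \<le> c" "0 < c" and h: "(A + 4) * c \<le> h" and w: "4 * A ^ 4 * c\<^sup>2 \<le> v * real w"
    and B: "h + 2 * c \<le> B" and R: "R > 0"
  shows "1 - (2 * (184 / A + (h + 2 * c + L) / (B + h + 2 * c + L) + (B + L)\<^sup>2 / (v * real R)) + (8 * c + 2 * L) / (h + L))
    \<le> prob (good_env h c (A * c) w R)"
proof -
  let ?tr = "\<lambda>\<omega>. run (trial_step h c (A * c) (real w)) (Fresh, 0, 0) (right_steps \<omega>) R"
  let ?tl = "\<lambda>\<omega>. run (trial_step h c (A * c) (real w)) (Fresh, 0, 0) (left_steps \<omega>) R"
  let ?dr = "\<lambda>\<omega>. run (drawup_step h) (0, 0, 0) (right_steps \<omega>) R"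
  let ?dl = "\<lambda>\<omega>. run (drawup_step h) (0, 0, 0) (left_steps \<omega>) R"
  let ?q = "184 / A + (h + 2 * c + L) / (B + h + 2 * c + L) + (B + L)\<^sup>2 / (v * real R)"
  define E1 where "E1 = {\<omega> \<in> space P. fst (?tr \<omega>) \<noteq> Settled}"
  define E2 where "E2 = {\<omega> \<in> space P. fst (?tl \<omega>) \<noteq> Settled}"
  define E3 where "E3 = {\<omega> \<in> space P. h \<le> fst (?dr \<omega>) - fst (snd (?dr \<omega>)) \<and> \<bar>snd (snd (?dr \<omega>)) - snd (snd (?dl \<omega>))\<bar> < 4 * c}"
  define E4 where "E4 = {\<omega> \<in> space P. \<not> ((\<forall>m::nat. \<exists>j. psum (right_steps \<omega>) j \<le> - real m) \<and>
     (\<forall>m::nat. \<exists>j. psum (left_steps \<omega>) j \<le> - real m))}"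
  have [measurable]: "E1 \<in> events" "E2 \<in> events" "E3 \<in> events" "E4 \<in> events"
    unfolding E1_def E2_def E3_def E4_def by measurable
  have Ac: "184 * c \<le> A * c" using A c by simp
  have hA: "A * c + 4 * c \<le> h" using h by (simp add: algebra_simps)
  have "0 < 4 * A ^ 4 * c\<^sup>2" using A c by simp
  then have w0: "w > 0" using w by (cases w) auto
  have sub: "space P - good_env h c (A * c) w R \<subseteq> E1 \<union> E2 \<union> E3 \<union> E4"
  proof
    fix \<omega> assume \<omega>: "\<omega> \<in> space P - good_env h c (A * c) w R"
    have "h \<le> fst (?dr \<omega>) - fst (snd (?dr \<omega>))" if "fst (?tr \<omega>) = Settled"
    proof -
      have "has_bottom (psum (right_steps \<omega>)) h c (2 * w) R"
        using right.bounded[of \<omega>] \<omega> hA Ac c w0 that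
        by (intro settled_has_bottom[where L = L and u = "A * c"]) auto
      then have "h \<le> fst (?dr \<omega>) - fst (snd (?dr \<omega>))" if "0 < h" "0 \<le> c"
        using has_bottom_stopped[OF _ that, of "right_steps \<omega>" "2 * w" R "fst (?dr \<omega>)" "fst (snd (?dr \<omega>))" "snd (snd (?dr \<omega>))"] by simp
      then show ?thesis using hA Ac c by linarith
    qed
    then show "\<omega> \<in> E1 \<union> E2 \<union> E3 \<union> E4"
      using \<omega> unfolding good_env_def E1_def E2_def E3_def E4_def by (auto simp: not_le)
  qed
  have p1: "prob E1 \<le> ?q" unfolding E1_def by (rule right.not_settled_bound[OF A c h w B R])
  have p2: "prob E2 \<le> ?q" unfolding E2_def by (rule left.not_settled_bound[OF A c h w B R])
  have p3: "prob E3 \<le> (8 * c + 2 * L) / (h + L)"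
    unfolding E3_def by (rule near_tie_bound) (use c hA Ac in linarith)+
  have p4: "prob E4 = 0"
  proof -
    have "AE \<omega> in P. \<omega> \<notin> E4"
      using right.AE_unbounded_below left.AE_unbounded_below by eventually_elim (auto simp: E4_def)
    then show ?thesis by (simp add: prob_eq_0)
  qed
  have "1 - prob (good_env h c (A * c) w R) = prob (space P - good_env h c (A * c) w R)"
    by (simp add: prob_compl good_env_measurable)
  also have "\<dots> \<le> prob (E1 \<union> E2 \<union> E3 \<union> E4)" by (rule finite_measure_mono[OF sub]) measurable
  finally have "1 - prob (good_env h c (A * c) w R) \<le> prob (E1 \<union> E2 \<union> E3 \<union> E4)" .
  moreover have "prob (E1 \<union> E2 \<union> E3 \<union> E4) \<le> prob (E1 \<union> E2 \<union> E3) + prob E4" by (rule measure_Un_le) measurable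
  moreover have "prob (E1 \<union> E2 \<union> E3) \<le> prob (E1 \<union> E2) + prob E3" by (rule measure_Un_le) measurable
  moreover have "prob (E1 \<union> E2) \<le> prob E1 + prob E2" by (rule measure_Un_le) measurable
  ultimately show ?thesis using p1 p2 p3 p4 by argo
qed

lemma good_env_localised:
  assumes \<omega>: "\<omega> \<in> good_env h c u w R" and n: "n > 1" and h: "h = ln (real n)"
    and c: "0 < c" "L \<le> c" "2 * c \<le> u" "u + 4 * c \<le> h" and w: "0 < w"
    and B: "\<And>x. \<bar>real_of_int x - valley_bottom n \<omega>\<bar> \<le> real (2 * w) \<Longrightarrow> x \<in> B"
  shows "1 - 9 * (1 + exp L) * (2 * real R)\<^sup>2 * exp (- (c - L)) \<le> \<P>(X in quenched_law \<omega> 0. X n \<in> B)"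
proof (rule environment_localised[OF kappa, where \<omega> = \<omega> and h = h and w = "2 * w"])
  have sp: "\<omega> \<in> space P" using \<omega> by (simp add: good_env_def)
  show "\<kappa> \<le> \<omega> x \<and> \<omega> x \<le> 1 - \<kappa>" for x by (rule coord_bounds[OF sp])
  show "has_bottom (psum (right_steps \<omega>)) h c (2 * w) R"
    using right.bounded[OF sp] c w \<omega> by (intro settled_has_bottom[where L = L and u = u]) (auto simp: good_env_def)
  show "has_bottom (psum (left_steps \<omega>)) h c (2 * w) R"
    using left.bounded[OF sp] c w \<omega> by (intro settled_has_bottom[where L = L and u = u]) (auto simp: good_env_def)
  have low: "\<exists>i. s i \<le> b" if "\<forall>m::nat. \<exists>j. s j \<le> - real m" for s :: "nat \<Rightarrow> real" and b
  proof -
    obtain m :: nat where "- b \<le> real m" using real_arch_simple by blast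
    then show ?thesis using that by (metis minus_le_iff order_trans)
  qed
  have down: "\<forall>m::nat. \<exists>j. psum (right_steps \<omega>) j \<le> - real m" "\<forall>m::nat. \<exists>j. psum (left_steps \<omega>) j \<le> - real m"
    using \<omega> unfolding good_env_def by blast+
  show "\<exists>i. psum (right_steps \<omega>) i \<le> b" "\<exists>i. psum (left_steps \<omega>) i \<le> b" for b
    by (rule low[OF down(1)], rule low[OF down(2)])
  show "run (drawup_step h) (0, 0, 0) (right_steps \<omega>) R =
      (fst (run (drawup_step h) (0, 0, 0) (right_steps \<omega>) R), fst (snd (run (drawup_step h) (0, 0, 0) (right_steps \<omega>) R)),
       snd (snd (run (drawup_step h) (0, 0, 0) (right_steps \<omega>) R)))"
    "run (drawup_step h) (0, 0, 0) (left_steps \<omega>) R =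
      (fst (run (drawup_step h) (0, 0, 0) (left_steps \<omega>) R), fst (snd (run (drawup_step h) (0, 0, 0) (left_steps \<omega>) R)),
       snd (snd (run (drawup_step h) (0, 0, 0) (left_steps \<omega>) R)))" by simp_all
  show "4 * c \<le> \<bar>snd (snd (run (drawup_step h) (0, 0, 0) (right_steps \<omega>) R)) -
       snd (snd (run (drawup_step h) (0, 0, 0) (left_steps \<omega>) R))\<bar>" using \<omega> by (simp add: good_env_def)
qed (use n h c L_def B in auto)

end

section \<open>The asymptotic choice of scales\<close>

lemma nat_ceiling_le: "0 \<le> r \<Longrightarrow> real (nat \<lceil>r\<rceil>) \<le> r + 1" and le_nat_ceiling: "r \<le> real (nat \<lceil>r\<rceil>)"
  by linarith+

text \<open>The width \<open>R\<close> of the valley is of order \<open>h ^ 3\<close>, so \<open>R\<^sup>2 * exp (- c)\<close> is of order \<open>h powr (-4)\<close>.\<close>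

lemma error_tendsto_0:
  fixes L :: real and R :: "nat \<Rightarrow> nat"
  assumes R: "\<And>n. R n = nat \<lceil>(ln (real n)) ^ 3\<rceil>"
  shows "(\<lambda>n. 9 * (1 + exp L) * (2 * real (R n))\<^sup>2 * exp (- (10 * ln (ln (real n)) - L))) \<longlonglongrightarrow> 0"
proof (rule tendsto_sandwich[OF _ _ tendsto_const])
  have lim: "(\<lambda>n. (2 * (ln (real n) ^ 3 + 1))\<^sup>2 * exp (- (10 * ln (ln (real n))))) \<longlonglongrightarrow> 0"
    by real_asymp
  show "(\<lambda>n. (9 * (1 + exp L) * exp L) * ((2 * (ln (real n) ^ 3 + 1))\<^sup>2 * exp (- (10 * ln (ln (real n)))))) \<longlonglongrightarrow> 0"
    using tendsto_mult_left[OF lim, of "9 * (1 + exp L) * exp L"] by simp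
  show "\<forall>\<^sub>F n in sequentially. 0 \<le> 9 * (1 + exp L) * (2 * real (R n))\<^sup>2 * exp (- (10 * ln (ln (real n)) - L))"
    by (intro always_eventually allI mult_nonneg_nonneg) (auto intro: add_nonneg_nonneg)
  show "\<forall>\<^sub>F n in sequentially. 9 * (1 + exp L) * (2 * real (R n))\<^sup>2 * exp (- (10 * ln (ln (real n)) - L))
      \<le> (9 * (1 + exp L) * exp L) * ((2 * (ln (real n) ^ 3 + 1))\<^sup>2 * exp (- (10 * ln (ln (real n)))))"
    using eventually_ge_at_top[of 1]
  proof eventually_elim
    case (elim n)
    then have "0 \<le> ln (real n) ^ 3" by simp
    then have "real (R n) \<le> ln (real n) ^ 3 + 1" unfolding R by (rule nat_ceiling_le)
    then have sq: "(2 * real (R n))\<^sup>2 \<le> (2 * (ln (real n) ^ 3 + 1))\<^sup>2" by (intro power_mono) auto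
    have e: "exp (- (10 * ln (ln (real n)) - L)) = exp L * exp (- (10 * ln (ln (real n))))"
      by (simp add: exp_add[symmetric])
    have "(9 * (1 + exp L)) * (2 * real (R n))\<^sup>2 * (exp L * exp (- (10 * ln (ln (real n)))))
        \<le> (9 * (1 + exp L)) * (2 * (ln (real n) ^ 3 + 1))\<^sup>2 * (exp L * exp (- (10 * ln (ln (real n)))))"
      using sq by (intro mult_right_mono mult_left_mono) (auto intro: add_nonneg_nonneg)
    then show ?case unfolding e by (simp only: mult_ac)
  qed
qed

text \<open>The hypothesis on \<open>\<rho>\<close> at \<open>x = ln h / h\<close> says that \<open>\<rho> x * h\<^sup>2\<close> eventually exceeds any multiple of \<open>(ln h)\<^sup>2\<close>.\<close>

lemma eventually_window_fits:
  fixes \<rho> :: "real \<Rightarrow> real" and K :: real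
  assumes rho_pos: "\<And>x. x > 0 \<Longrightarrow> \<rho> x > 0" and rho_lim: "((\<lambda>x. x\<^sup>2 / \<rho> x) \<longlongrightarrow> 0) (at_right 0)"
    and K: "0 \<le> K"
  shows "\<forall>\<^sub>F n in sequentially. 2 * real (nat \<lceil>K * (10 * ln (ln (real n)))\<^sup>2\<rceil>)
    \<le> \<rho> (ln (ln (real n)) / ln (real n)) * (ln (real n))\<^sup>2"
proof -
  define \<epsilon> where "\<epsilon> = 1 / (200 * K + 2)"
  have e: "\<epsilon> > 0" using K by (simp add: \<epsilon>_def)
  have "filterlim (\<lambda>n. ln (ln (real n)) / ln (real n)) (at_right 0) sequentially" by real_asymp
  from filterlim_compose[OF rho_lim this]
  have "\<forall>\<^sub>F n in sequentially. (ln (ln (real n)) / ln (real n))\<^sup>2 / \<rho> (ln (ln (real n)) / ln (real n)) < \<epsilon>"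
    using e by (rule order_tendstoD)
  moreover have "\<forall>\<^sub>F n in sequentially. 1 \<le> ln (ln (real n))" by real_asymp
  moreover have "\<forall>\<^sub>F n in sequentially. 1 \<le> ln (real n)" by real_asymp
  ultimately show ?thesis
  proof eventually_elim
    case (elim n)
    define l where "l = ln (real n)"
    define x where "x = ln l / l"
    have l: "1 \<le> l" "1 \<le> ln l" using elim by (auto simp: l_def)
    have x: "0 < x" unfolding x_def using l by (intro divide_pos_pos) linarith+
    have "x\<^sup>2 / \<rho> x < \<epsilon>" using elim by (simp add: x_def l_def)
    then have "x\<^sup>2 < \<epsilon> * \<rho> x" using rho_pos[OF x] by (simp add: pos_divide_less_eq)
    then have "x\<^sup>2 * (200 * K + 2) < \<rho> x" using K by (simp add: \<epsilon>_def pos_less_divide_eq)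
    then have "x\<^sup>2 * (200 * K + 2) * l\<^sup>2 \<le> \<rho> x * l\<^sup>2" by (intro mult_right_mono) auto
    moreover have "x\<^sup>2 * (200 * K + 2) * l\<^sup>2 = (200 * K + 2) * (ln l)\<^sup>2"
      using l by (simp add: x_def power_divide)
    moreover have "2 * real (nat \<lceil>K * (10 * ln l)\<^sup>2\<rceil>) \<le> 2 * (K * (10 * ln l)\<^sup>2 + 1)"
    proof -
      have "0 \<le> K * (10 * ln l)\<^sup>2" using K by simp
      from nat_ceiling_le[OF this] show ?thesis by simp
    qed
    moreover have "1 \<le> (ln l)\<^sup>2" using l by simp
    then have "2 * (K * (10 * ln l)\<^sup>2 + 1) \<le> (200 * K + 2) * (ln l)\<^sup>2"
      by (simp add: power_mult_distrib algebra_simps)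
    ultimately show ?case unfolding l_def[symmetric] x_def[symmetric] by linarith
  qed
qed

theorem theorem3:
  fixes \<kappa> \<alpha> :: real and P :: "env measure" and \<rho> :: "real \<Rightarrow> real"
  assumes kappa: "\<kappa> > 0"
    and prob: "prob_space P"
    and sets_P: "sets P = sets (PiM UNIV (\<lambda>_. restrict_space borel {\<kappa>..1 - \<kappa>}))"
    and indep: "prob_space.indep_vars P (\<lambda>_. borel) (\<lambda>x \<omega>. \<omega> x) UNIV"
    and ident: "\<And>x y. distr P borel (\<lambda>\<omega>. \<omega> x) = distr P borel (\<lambda>\<omega>. \<omega> y)"
    and mean: "\<And>x. (\<integral>\<omega>. ln (\<omega> x / (1 - \<omega> x)) \<partial>P) = 0"
    and var: "\<And>x. (\<integral>\<omega>. (ln (\<omega> x / (1 - \<omega> x)))\<^sup>2 \<partial>P) > 0"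
    and alpha: "\<alpha> > 0"
    and rho_pos: "\<And>x. x > 0 \<Longrightarrow> \<rho> x > 0"
    and rho_lim: "((\<lambda>x. x\<^sup>2 / \<rho> x) \<longlongrightarrow> 0) (at_right 0)"
  shows "\<exists>\<Omega> :: nat \<Rightarrow> env set.
    (\<forall>n\<ge>3. \<Omega> n \<in> sets P \<and> measure P (\<Omega> n) \<ge> 1 - \<alpha>) \<and>
    ((\<lambda>n. INF \<omega>\<in>\<Omega> n.
        \<P>(X in quenched_law \<omega> 0.
          \<bar>real_of_int (X n) / (ln (real n))\<^sup>2 - valley_bottom n \<omega> / (ln (real n))\<^sup>2\<bar>
            \<le> \<rho> (ln (ln (real n)) / ln (real n))))
      \<longlonglongrightarrow> 1)"
proof -
  interpret E: random_environment P \<kappa>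
    using assms by (intro random_environment.intro random_environment_axioms.intro)
  have L0: "0 \<le> E.L" by (rule E.right.L_nonneg)
  have v0: "0 < E.v" by (rule E.right.v_pos)
  define \<beta> where "\<beta> = min \<alpha> (1 / 2)"
  have \<beta>: "0 < \<beta>" "\<beta> \<le> 1 / 2" "\<beta> \<le> \<alpha>" using alpha by (auto simp: \<beta>_def)
  \<comment> \<open>The constants make the three summands of \<open>not_settled_bound\<close>, for each of the two sides, at most \<open>\<beta> / 16\<close>; a near-tie costs
    \<open>\<beta> / 8\<close>. As \<open>\<beta> < 1\<close>, the good set is not empty.\<close>
  define A where "A = 2944 / \<beta>"
  define M where "M = 32 / \<beta>"
  define K where "K = 4 * A ^ 4 / E.v"
  have A: "184 \<le> A" "184 / A = \<beta> / 16" using \<beta> by (auto simp: A_def field_simps)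
  have M: "1 \<le> M" "2 / M = \<beta> / 16" using \<beta> by (auto simp: M_def field_simps)
  have K: "0 < K" using A v0 by (simp add: K_def)
  define h where "h n = ln (real n)" for n :: nat
  define c where "c n = 10 * ln (h n)" for n
  define w where "w n = nat \<lceil>K * (c n)\<^sup>2\<rceil>" for n
  define R where "R n = nat \<lceil>(h n) ^ 3\<rceil>" for n
  define G where "G n = E.good_env (h n) (c n) (A * c n) (w n) (R n)" for n
  define \<epsilon> where "\<epsilon> n = 9 * (1 + exp E.L) * (2 * real (R n))\<^sup>2 * exp (- (c n - E.L))" for n
  define f where "f n \<omega> = \<P>(X in quenched_law \<omega> 0.
          \<bar>real_of_int (X n) / (ln (real n))\<^sup>2 - valley_bottom n \<omega> / (ln (real n))\<^sup>2\<bar>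
            \<le> \<rho> (ln (ln (real n)) / ln (real n)))" for n \<omega>
  have \<epsilon>: "\<epsilon> \<longlonglongrightarrow> 0"
    unfolding \<epsilon>_def c_def h_def using error_tendsto_0[of R E.L] by (simp add: R_def h_def)
  have h_lim: "filterlim h at_top sequentially" unfolding h_def by real_asymp
  have c_lim: "filterlim c at_top sequentially" unfolding c_def h_def by real_asymp
  have ratio: "(\<lambda>n. c n / h n) \<longlonglongrightarrow> 0" unfolding c_def h_def by real_asymp
  have ev: "\<forall>\<^sub>F n in sequentially. 3 \<le> n \<and> 1 + E.L \<le> c n \<and> 1 + E.L \<le> h n \<and>
      (2 * M + 1)\<^sup>2 / E.v * 16 / \<beta> \<le> h n \<and> c n / h n \<le> 1 / (A + 4) \<and> c n / h n \<le> \<beta> / 80 \<and>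
      2 * real (w n) \<le> \<rho> (ln (h n) / h n) * (h n)\<^sup>2"
  proof (intro eventually_conj)
    show "\<forall>\<^sub>F n in sequentially. 1 + E.L \<le> c n" using c_lim by (simp add: filterlim_at_top)
    show "\<forall>\<^sub>F n in sequentially. 1 + E.L \<le> h n" using h_lim by (simp add: filterlim_at_top)
    show "\<forall>\<^sub>F n in sequentially. (2 * M + 1)\<^sup>2 / E.v * 16 / \<beta> \<le> h n" using h_lim by (simp add: filterlim_at_top)
    have "\<forall>\<^sub>F n in sequentially. c n / h n < 1 / (A + 4)" using order_tendstoD(2)[OF ratio, of "1 / (A + 4)"] A by simp
    then show "\<forall>\<^sub>F n in sequentially. c n / h n \<le> 1 / (A + 4)" by eventually_elim simp
    have "\<forall>\<^sub>F n in sequentially. c n / h n < \<beta> / 80" using order_tendstoD(2)[OF ratio, of "\<beta> / 80"] \<beta> by simp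
    then show "\<forall>\<^sub>F n in sequentially. c n / h n \<le> \<beta> / 80" by eventually_elim simp
    show "\<forall>\<^sub>F n in sequentially. 2 * real (w n) \<le> \<rho> (ln (h n) / h n) * (h n)\<^sup>2"
      unfolding w_def c_def h_def using eventually_window_fits[OF rho_pos rho_lim, of K] K by simp
  qed (rule eventually_ge_at_top)
  have good: "1 - \<alpha> \<le> measure P (G n) \<and> G n \<noteq> {} \<and> (\<forall>\<omega>\<in>G n. 1 - \<epsilon> n \<le> f n \<omega>)"
    if n: "3 \<le> n \<and> 1 + E.L \<le> c n \<and> 1 + E.L \<le> h n \<and>
      (2 * M + 1)\<^sup>2 / E.v * 16 / \<beta> \<le> h n \<and> c n / h n \<le> 1 / (A + 4) \<and> c n / h n \<le> \<beta> / 80 \<and>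
      2 * real (w n) \<le> \<rho> (ln (h n) / h n) * (h n)\<^sup>2" for n
  proof -
    have c0: "0 < c n" "E.L \<le> c n" and h0: "1 \<le> h n" "0 < h n" "E.L \<le> h n" using n L0 by auto
    have Ah: "(A + 4) * c n \<le> h n" using n h0 A by (simp add: field_simps)
    have ch: "c n \<le> \<beta> / 80 * h n" using n h0 by (simp add: pos_divide_le_eq)
    have Ac: "184 * c n \<le> A * c n" using A c0 by simp
    have hA: "A * c n + 4 * c n \<le> h n" using Ah by (simp add: algebra_simps)
    have wK: "K * (c n)\<^sup>2 \<le> real (w n)" unfolding w_def by (rule le_nat_ceiling)
    have w: "4 * A ^ 4 * (c n)\<^sup>2 \<le> E.v * real (w n)"
    proof -
      have "4 * A ^ 4 * (c n)\<^sup>2 = E.v * (K * (c n)\<^sup>2)" using v0 by (simp add: K_def)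
      also have "\<dots> \<le> E.v * real (w n)" using wK v0 by (intro mult_left_mono) auto
      finally show ?thesis .
    qed
    have "0 < K * (c n)\<^sup>2" using K c0 by simp
    then have w0: "0 < w n" using wK by (cases "w n") auto
    have Rh: "(h n) ^ 3 \<le> real (R n)" unfolding R_def by (rule le_nat_ceiling)
    have "0 < (h n) ^ 3" using h0 by simp
    then have R0: "0 < R n" using Rh by (cases "R n") auto
    let ?H = "h n + 2 * c n"
    have H: "0 < ?H" "?H \<le> 2 * h n" using c0 h0 hA Ac by linarith+
    have MH: "?H \<le> M * ?H" using M H by simp
    have 1: "(h n + 2 * c n + E.L) / (M * ?H + h n + 2 * c n + E.L) \<le> \<beta> / 16"
    proof -
      have "(?H + E.L) / (M * ?H + h n + 2 * c n + E.L) \<le> (2 * ?H) / (M * ?H)"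
        using H(1) M(1) c0 h0 L0 by (intro frac_le mult_pos_pos) auto
      also have "\<dots> = 2 / M" using H(1) by (intro mult_divide_mult_cancel_right) simp
      also note M(2)
      finally show ?thesis by simp
    qed
    have 2: "(M * ?H + E.L)\<^sup>2 / (E.v * real (R n)) \<le> \<beta> / 16"
    proof -
      have "M * ?H \<le> M * (2 * h n)" using H M by (intro mult_left_mono) auto
      then have "M * ?H + E.L \<le> (2 * M + 1) * h n" using h0 by (simp add: algebra_simps)
      moreover have "0 \<le> M * ?H + E.L" using H M L0 by simp
      ultimately have "(M * ?H + E.L)\<^sup>2 \<le> ((2 * M + 1) * h n)\<^sup>2" by (rule power_mono)
      then have "(M * ?H + E.L)\<^sup>2 / (E.v * real (R n)) \<le> ((2 * M + 1) * h n)\<^sup>2 / (E.v * (h n) ^ 3)"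
        using Rh v0 h0 by (intro frac_le mult_left_mono) auto
      also have "\<dots> = (2 * M + 1)\<^sup>2 / E.v / h n"
        using h0 by (simp add: power_mult_distrib power2_eq_square power3_eq_cube)
      also have "\<dots> \<le> \<beta> / 16"
      proof -
        define X where "X = (2 * M + 1)\<^sup>2 / E.v"
        have "X * 16 / \<beta> \<le> h n" using n by (simp only: X_def)
        then have "X / h n \<le> \<beta> / 16" using h0 \<beta> by (simp add: field_simps)
        then show ?thesis by (simp only: X_def)
      qed
      finally show ?thesis .
    qed
    have 3: "(8 * c n + 2 * E.L) / (h n + E.L) \<le> \<beta> / 8"
    proof -
      have "(8 * c n + 2 * E.L) / (h n + E.L) \<le> (10 * c n) / h n"
        using c0 h0 L0 by (intro frac_le) linarith+
      also have "\<dots> = 10 * (c n / h n)" by simp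
      also have "\<dots> \<le> 10 * (\<beta> / 80)" using n by (intro mult_left_mono) auto
      also have "\<dots> = \<beta> / 8" by simp
      finally show ?thesis .
    qed
    have "1 - (2 * (184 / A + (h n + 2 * c n + E.L) / (M * ?H + h n + 2 * c n + E.L) + (M * ?H + E.L)\<^sup>2 / (E.v * real (R n)))
        + (8 * c n + 2 * E.L) / (h n + E.L)) \<le> measure P (G n)"
      unfolding G_def by (rule E.good_env_prob[OF A(1) c0(2,1) Ah w MH R0])
    moreover have "1 - \<beta> \<le> p"
      if "1 - (2 * (a + b + d) + e) \<le> p" "a = \<beta> / 16" "b \<le> \<beta> / 16" "d \<le> \<beta> / 16" "e \<le> \<beta> / 8" for a b d e p
      using that \<beta>(1) by argo
    ultimately have P: "1 - \<beta> \<le> measure P (G n)" using A(2) 1 2 3 by blast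
    then have "G n \<noteq> {}" using \<beta> by auto
    moreover have "1 - \<epsilon> n \<le> f n \<omega>" if \<omega>: "\<omega> \<in> G n" for \<omega>
    proof -
      let ?B = "{x. \<bar>real_of_int x / (ln (real n))\<^sup>2 - valley_bottom n \<omega> / (ln (real n))\<^sup>2\<bar> \<le> \<rho> (ln (ln (real n)) / ln (real n))}"
      have B: "x \<in> ?B" if x: "\<bar>real_of_int x - valley_bottom n \<omega>\<bar> \<le> real (2 * w n)" for x
      proof -
        have h2: "0 < (h n)\<^sup>2" using h0 by simp
        have "\<bar>real_of_int x / (h n)\<^sup>2 - valley_bottom n \<omega> / (h n)\<^sup>2\<bar> = \<bar>real_of_int x - valley_bottom n \<omega>\<bar> / (h n)\<^sup>2"
          by (simp add: diff_divide_distrib[symmetric])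
        also have "\<dots> \<le> (2 * real (w n)) / (h n)\<^sup>2" using x by (intro divide_right_mono) auto
        also have "\<dots> \<le> \<rho> (ln (h n) / h n)" using n h2 by (simp add: pos_divide_le_eq)
        finally show ?thesis by (simp add: h_def)
      qed
      have "1 - \<epsilon> n \<le> \<P>(X in quenched_law \<omega> 0. X n \<in> ?B)"
        unfolding \<epsilon>_def
        by (rule E.good_env_localised[OF \<omega>[unfolded G_def]])
          (use n c0 hA Ac w0 B in \<open>auto simp: h_def\<close>)
      then show ?thesis by (simp add: f_def)
    qed
    ultimately show ?thesis using P \<beta> by auto
  qed
  obtain n0 where n0: "\<And>n. n0 \<le> n \<Longrightarrow> 1 - \<alpha> \<le> measure P (G n) \<and> G n \<noteq> {} \<and> (\<forall>\<omega>\<in>G n. 1 - \<epsilon> n \<le> f n \<omega>)"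
    using ev good unfolding eventually_sequentially by meson
  \<comment> \<open>For the finitely many other \<open>n\<close> the limit imposes nothing and any set of full measure will do.\<close>
  define \<Omega> where "\<Omega> n = (if n0 \<le> n then G n else space P)" for n
  have "\<Omega> n \<in> sets P \<and> measure P (\<Omega> n) \<ge> 1 - \<alpha>" for n
    using n0[of n] alpha by (auto simp: \<Omega>_def G_def E.good_env_measurable E.prob_space)
  moreover have "(\<lambda>n. INF \<omega>\<in>\<Omega> n. f n \<omega>) \<longlonglongrightarrow> 1"
  proof (rule tendsto_sandwich)
    show "(\<lambda>n. 1 - \<epsilon> n) \<longlonglongrightarrow> 1" using tendsto_diff[OF tendsto_const \<epsilon>, of 1] by simp
    show "(\<lambda>n. 1) \<longlonglongrightarrow> (1::real)" by simp
    have f01: "0 \<le> f n \<omega> \<and> f n \<omega> \<le> 1" for n \<omega>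
      unfolding f_def using prob_space.prob_le_1[OF prob_space_quenched_law] by simp
    show "\<forall>\<^sub>F n in sequentially. 1 - \<epsilon> n \<le> (INF \<omega>\<in>\<Omega> n. f n \<omega>)"
      using eventually_ge_at_top[of n0]
    proof eventually_elim
      case (elim n)
      then show ?case using n0[OF elim] by (intro cINF_greatest) (auto simp: \<Omega>_def)
    qed
    show "\<forall>\<^sub>F n in sequentially. (INF \<omega>\<in>\<Omega> n. f n \<omega>) \<le> 1"
      using eventually_ge_at_top[of n0]
    proof eventually_elim
      case (elim n)
      then obtain \<omega> where "\<omega> \<in> \<Omega> n" using n0[OF elim] by (auto simp: \<Omega>_def)
      then have "(INF \<omega>\<in>\<Omega> n. f n \<omega>) \<le> f n \<omega>"
        using f01 by (intro cINF_lower bdd_belowI2[where m = 0]) auto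
      then show ?case using f01[of n \<omega>] by linarith
    qed
  qed
  ultimately show ?thesis unfolding f_def by blast
qed

end
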